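(* Let $g:\mathbb{M}\to\mathbb{R}^3$ be an arbitrary Möbius strip. Then there exists a principal real-analytic Möbius developable $f:\mathbb{M}\to\mathbb{R}^3$ which is isotopic to $g$.
   Context: Let $S^1=\{p\in\mathbb{R}^2:|p|=1\}$ and let $\mathbb{M}$ be the quotient of $S^1\times(-1,1)$ by the involution $(p,t)\mapsto(-p,-t)$ (an open Möbius band). A Möbius strip is a (smooth) embedding $f:\mathbb{M}\to\mathbb{R}^3$; its centerline is the restriction of $f$ to the image in $\mathbb{M}$ of $S^1\times\{0\}$. A Möbius developable is a Möbius strip which is a ruled surface with identically vanishing Gaussian curvature. Concretely, up to parametrization of the band, it is written as $F_{\gamma,\xi}(t,u)=\gamma(t)+u\,\xi(t)$, $|u|<\varepsilon$, where $\gamma:\mathbb{R}\to\mathbb{R}^3$ is a $c$-periodic regular space curve (the centerline, a simple closed curve), $\xi:\mathbb{R}\to\mathbb{R}^3$ is smooth with $\xi(t+c)=-\xi(t)$ and $\dot\gamma\times\xi\neq0$, and $\det(\dot\gamma,\xi,\dot\xi)=0$ identically (which is equivalent to vanishing of the Gaussian curvature); here $(t,u)$ and $(t+c,-u)$ are identified. The direction $\xi(t)$ is the asymptotic direction. The developable is real-analytic if $\gamma$ and $\xi$ (hence $F_{\gamma,\xi}$) are real-analytic. A Möbius developable is principal (or orthogonal) if the centerline is orthogonal to the asymptotic lines, i.e. $\xi(t)\cdot\dot\gamma(t)=0$ for all $t$. Two Möbius strips are isotopic if they can be joined by a smooth one-parameter family of embeddings of the Möbius band $\mathbb{M}$ into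 $\mathbb{R}^3$ (the parametrization of the image strip by $\mathbb{M}$ being immaterial). *)

theory Defs
  imports "HOL-Analysis.Analysis"
begin

section \<open>Smooth and real-analytic maps\<close>

text \<open>A map is \<open>C\<^sup>k\<close> on an open set \<open>S\<close> iff all its iterated directional derivatives of order
  at most \<open>k\<close> exist in the Frechet sense and are continuous on \<open>S\<close>.\<close>

fun C_k_on :: "nat \<Rightarrow> ('a::real_normed_vector \<Rightarrow> 'b::real_normed_vector) \<Rightarrow> 'a set \<Rightarrow> bool" where
  "C_k_on 0 f S \<longleftrightarrow> continuous_on S f"
| "C_k_on (Suc k) f S \<longleftrightarrow>
     (\<forall>x\<in>S. f differentiable (at x)) \<and> continuous_on S f \<and>
     (\<forall>v. C_k_on k (\<lambda>x. frechet_derivative f (at x) v) S)"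

definition smooth_on :: "('a::real_normed_vector \<Rightarrow> 'b::real_normed_vector) \<Rightarrow> 'a set \<Rightarrow> bool" where
  "smooth_on f S \<longleftrightarrow> (\<forall>k. C_k_on k f S)"

definition real_analytic_curve :: "(real \<Rightarrow> 'b::real_normed_vector) \<Rightarrow> bool" where
  "real_analytic_curve f \<longleftrightarrow>
     (\<forall>t. \<exists>r>0. \<exists>a. \<forall>s. \<bar>s - t\<bar> < r \<longrightarrow> (\<lambda>n. (s - t) ^ n *\<^sub>R a n) sums f s)"


section \<open>The open Moebius band\<close>

definition cylinder :: "(complex \<times> real) set" where
  "cylinder = sphere 0 1 \<times> {-1<..<1}"

definition moebius_class :: "complex \<times> real \<Rightarrow> (complex \<times> real) set" where
  "moebius_class = (\<lambda>(p, t). {(p, t), (- p, - t)})"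

definition moebius_band :: "(complex \<times> real) set set" where
  "moebius_band = moebius_class ` cylinder"

definition moebius_core :: "(complex \<times> real) set set" where
  "moebius_core = moebius_class ` (sphere 0 1 \<times> {0})"

definition moebius_topology :: "(complex \<times> real) set topology" where
  "moebius_topology =
     topology (\<lambda>U. U \<subseteq> moebius_band \<and>
                  openin (top_of_set cylinder) {x \<in> cylinder. moebius_class x \<in> U})"

lemma openin_moebius_topology:
  "openin moebius_topology U \<longleftrightarrow>
     U \<subseteq> moebius_band \<and> openin (top_of_set cylinder) {x \<in> cylinder. moebius_class x \<in> U}"
proof -
  have "istopology (\<lambda>U. U \<subseteq> moebius_band \<and>
          openin (top_of_set cylinder) {x \<in> cylinder. moebius_class x \<in> U})"
    unfolding istopology_def
  proof (intro conjI allI impI, goal_cases)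
    case (1 S T)
    then show ?case by blast
  next
    case (2 S T)
    have "{x \<in> cylinder. moebius_class x \<in> S \<inter> T} =
        {x \<in> cylinder. moebius_class x \<in> S} \<inter> {x \<in> cylinder. moebius_class x \<in> T}"
      by blast
    with 2 show ?case by (simp add: openin_Int)
  next
    case (3 K)
    then show ?case by blast
  next
    case (4 K)
    have "{x \<in> cylinder. moebius_class x \<in> \<Union>K} =
        (\<Union>U\<in>K. {x \<in> cylinder. moebius_class x \<in> U})"
      by blast
    moreover have "openin (top_of_set cylinder) (\<Union>U\<in>K. {x \<in> cylinder. moebius_class x \<in> U})"
      using 4 by (intro openin_Union) blast
    ultimately show ?case using 4 by auto
  qed
  then show ?thesis
    unfolding moebius_topology_def by (simp add: topology_inverse')
qed

lemma topspace_moebius_topology: "topspace moebius_topology = moebius_band"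
proof
  show "topspace moebius_topology \<subseteq> moebius_band"
    unfolding topspace_def by (auto simp: openin_moebius_topology)
  have "{x \<in> cylinder. moebius_class x \<in> moebius_band} = cylinder"
    by (auto simp: moebius_band_def)
  then have "openin moebius_topology moebius_band"
    by (simp add: openin_moebius_topology)
  then show "moebius_band \<subseteq> topspace moebius_topology"
    by (rule openin_subset)
qed

lemma quotient_map_moebius_class:
  "quotient_map (top_of_set cylinder) moebius_topology moebius_class"
  by (auto simp: quotient_map_def topspace_moebius_topology openin_moebius_topology moebius_band_def)

text \<open>The smooth structure is read off in the coordinates \<open>(\<theta>, t)\<close> of the universal cover
  \<open>\<real> \<times> (-1, 1)\<close>; the deck group is generated by \<open>(\<theta>, t) \<mapsto> (\<theta> + \<pi>, - t)\<close>, because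
  the antipodal map of the circle is rotation by \<open>\<pi>\<close>.\<close>

definition moebius_cover :: "real \<times> real \<Rightarrow> (complex \<times> real) set" where
  "moebius_cover = (\<lambda>(\<theta>, t). moebius_class (cis \<theta>, t))"

lemma moebius_cover_deck: "moebius_cover (\<theta> + pi, - t) = moebius_cover (\<theta>, t)"
proof -
  have "cis (\<theta> + pi) = - cis \<theta>"
    by (simp add: complex_eq_iff)
  then show ?thesis
    by (auto simp: moebius_cover_def moebius_class_def)
qed

lemma moebius_cover_image: "moebius_cover ` (UNIV \<times> {-1<..<1}) = moebius_band"
proof -
  have "sphere 0 1 = range cis"
  proof
    show "sphere 0 1 \<subseteq> range cis"
    proof
      fix p :: complex
      assume "p \<in> sphere 0 1"
      then have "p = cis (Arg p)"
        by (metis cis_Arg dist_0_norm div_by_1 mem_sphere norm_zero of_real_1 scaleR_one inverse_1 sgn_div_norm zero_neq_one)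
      then show "p \<in> range cis" by blast
    qed
  qed auto
  then show ?thesis
    by (force simp: moebius_band_def cylinder_def moebius_cover_def)
qed


section \<open>Moebius strips and isotopy\<close>

definition moebius_strip :: "((complex \<times> real) set \<Rightarrow> real^3) \<Rightarrow> bool" where
  "moebius_strip f \<longleftrightarrow>
     smooth_on (f \<circ> moebius_cover) (UNIV \<times> {-1<..<1}) \<and>
     (\<forall>x \<in> UNIV \<times> {-1<..<1}. inj (frechet_derivative (f \<circ> moebius_cover) (at x))) \<and>
     embedding_map moebius_topology euclidean f"

text \<open>Smoothness of a family over \<open>[0, 1]\<close> means that it extends smoothly to a family over \<open>\<real>\<close>;
  only the members over \<open>[0, 1]\<close> are required to be embeddings. The end members have to agree with
  the given strips up to parametrization, that is, as subsets of space.\<close>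

definition moebius_isotopic ::
    "((complex \<times> real) set \<Rightarrow> real^3) \<Rightarrow> ((complex \<times> real) set \<Rightarrow> real^3) \<Rightarrow> bool" where
  "moebius_isotopic f g \<longleftrightarrow>
     (\<exists>H :: real \<Rightarrow> (complex \<times> real) set \<Rightarrow> real^3.
        smooth_on (\<lambda>(s, x). H s (moebius_cover x)) (UNIV \<times> (UNIV \<times> {-1<..<1})) \<and>
        (\<forall>s\<in>{0..1}. moebius_strip (H s)) \<and>
        H 0 ` moebius_band = f ` moebius_band \<and>
        H 1 ` moebius_band = g ` moebius_band)"


section \<open>Moebius developables\<close>

text \<open>\<open>F\<close> is \<open>(t, u) \<mapsto> \<gamma> t + u \<xi> t\<close>, \<open>\<bar>u\<bar> < \<epsilon>\<close>, rescaled by \<open>t = c \<theta> / \<pi>\<close> and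
  \<open>u = \<epsilon> \<tau>\<close>, so that the identification \<open>(t, u) \<sim> (t + c, - u)\<close> becomes that of
  \<^const>\<open>moebius_cover\<close>.\<close>

definition moebius_developable_along ::
    "real \<Rightarrow> real \<Rightarrow> (real \<Rightarrow> real^3) \<Rightarrow> (real \<Rightarrow> real^3) \<Rightarrow>
     ((complex \<times> real) set \<Rightarrow> real^3) \<Rightarrow> bool" where
  "moebius_developable_along c \<epsilon> \<gamma> \<xi> f \<longleftrightarrow>
     moebius_strip f \<and> 0 < c \<and> 0 < \<epsilon> \<and>
     smooth_on \<gamma> UNIV \<and> smooth_on \<xi> UNIV \<and>
     (\<forall>t. \<gamma> (t + c) = \<gamma> t) \<and> inj_on \<gamma> {0..<c} \<and>
     (\<forall>t. vector_derivative \<gamma> (at t) \<noteq> 0) \<and>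
     (\<forall>t. \<xi> (t + c) = - \<xi> t) \<and>
     (\<forall>t. cross3 (vector_derivative \<gamma> (at t)) (\<xi> t) \<noteq> 0) \<and>
     (\<forall>t. det (vector [vector_derivative \<gamma> (at t), \<xi> t, vector_derivative \<xi> (at t)] :: real^3^3) = 0) \<and>
     (\<exists>F. moebius_strip F \<and>
        (\<forall>\<theta>. \<forall>\<tau>\<in>{-1<..<1}.
           F (moebius_cover (\<theta>, \<tau>)) = \<gamma> (c * \<theta> / pi) + (\<epsilon> * \<tau>) *\<^sub>R \<xi> (c * \<theta> / pi)) \<and>
        f ` moebius_band = F ` moebius_band \<and>
        f ` moebius_core = F ` moebius_core)"

definition principal_analytic_moebius_developable ::
    "((complex \<times> real) set \<Rightarrow> real^3) \<Rightarrow> bool" where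
  "principal_analytic_moebius_developable f \<longleftrightarrow>
     (\<exists>c \<epsilon> \<gamma> \<xi>. moebius_developable_along c \<epsilon> \<gamma> \<xi> f \<and>
        real_analytic_curve \<gamma> \<and> real_analytic_curve \<xi> \<and>
        (\<forall>t. \<xi> t \<bullet> vector_derivative \<gamma> (at t) = 0))"

end

theory Submission
  imports Defs "HOL-Complex_Analysis.Complex_Analysis" "HOL-Real_Asymp.Real_Asymp"
begin

text \<open>A unit field \<open>\<xi>\<close> normal to \<open>\<gamma>\<close> rules a developable exactly if it is parallel in the normal
  bundle, so one needs an analytic closed curve near the core of \<open>g\<close> whose normal holonomy is \<open>-1\<close>
  and whose parallel field follows the strip \<open>g\<close>. After analytic approximation of the core and of its
  normal direction, let \<open>m\<close> be the torsion of the resulting normal frame. Replace the core by an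
  elliptic helix around it with frequency \<open>N\<close>, radius of order \<open>N powr (-3/2)\<close> and axes in
  ratio \<open>1 : 2 (m + l)\<close>. This is a \<open>C\<^sup>1\<close>-small change, yet the helix contributes a torsion that
  averages to \<open>- (m + l)\<close> and so cancels \<open>m\<close> up to the small constant \<open>l\<close>, which the intermediate
  value theorem adjusts to close up the parallel field exactly. The linear interpolation between \<open>g\<close>
  and the resulting ruled strip consists of embeddings on a sufficiently narrow band.\<close>

section \<open>Smooth maps\<close>

text \<open>For a principal developable the centerline determines the unit ruling up to a constant
  angle. The direction of the ruling therefore cannot be imposed; it has to be steered through the
  centerline alone. A C^2-small change of the curve cannot do that, because the torsion involves
  second derivatives. The exponent 3/2 is the one at which a C^1-small change has a torsion of order
  one: with N h^2 = 1 and radius h^3 the velocity changes by about N h^3 = h and the acceleration by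
  about N^2 h^3 = 1 / h, and the torsion of the helix is of the order of their product. This torsion
  oscillates like the square of a cosine, whose mean 1/2 explains the factor 2 in the axes. What
  remains after averaging has a primitive of order 1 / N, so the ruling follows the prescribed
  direction at every point and not only over a full turn. The normal frame changes sign after one
  turn; N is odd, so that the offset of the helix compensates this and the curve closes. Centerlines
  are compared through their velocities only, since a translation of the curve affects neither
  transversality nor embeddedness.\<close>

lemma C_k_on_cong:
  assumes "open S" "\<And>x. x \<in> S \<Longrightarrow> f x = g x" "C_k_on k f S"
  shows "C_k_on k g S"
  using assms(2,3)
proof (induction k arbitrary: f g)
  case 0
  then show ?case by (simp cong: continuous_on_cong)
next
  case (Suc k)
  have D: "(g has_derivative frechet_derivative f (at x)) (at x)" if "x \<in> S" for x
    using Suc.prems that assms(1)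
    by (auto intro!: has_derivative_transform_within_open[of f _ x UNIV S g] simp: frechet_derivative_works)
  have E: "frechet_derivative g (at x) = frechet_derivative f (at x)" if "x \<in> S" for x
    using D[OF that] by (metis frechet_derivative_at)
  have "C_k_on k (\<lambda>x. frechet_derivative g (at x) v) S" for v
  proof (rule Suc.IH)
    show "frechet_derivative f (at x) v = frechet_derivative g (at x) v" if "x \<in> S" for x
      using E[OF that] by simp
    show "C_k_on k (\<lambda>x. frechet_derivative f (at x) v) S"
      using Suc.prems(2) by simp
  qed
  moreover have "continuous_on S g"
    using Suc.prems continuous_on_cong[of S S f g] by simp
  moreover have "\<forall>x\<in>S. g differentiable at x"
    using D unfolding differentiable_def by blast
  ultimately show ?case by simp
qed

text \<open>Openness of S lets an explicit derivative formula replace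
  \<open>frechet_derivative\<close>; the closure properties below differentiate by this
  rule.\<close>

lemma C_k_on_SucI:
  assumes "open S" "\<And>x. x \<in> S \<Longrightarrow> (f has_derivative D x) (at x)"
    "\<And>v. C_k_on k (\<lambda>x. D x v) S"
  shows "C_k_on (Suc k) f S"
proof -
  have E: "D x = frechet_derivative f (at x)" if "x \<in> S" for x
    using assms(2)[OF that] by (rule frechet_derivative_at)
  have "C_k_on k (\<lambda>x. frechet_derivative f (at x) v) S" for v
    by (rule C_k_on_cong[OF assms(1) _ assms(3)[of v]]) (simp add: E)
  moreover have "continuous_on S f"
    using assms(1,2) by (meson continuous_at_imp_continuous_on has_derivative_continuous)
  moreover have "\<forall>x\<in>S. f differentiable at x"
    using assms(2) unfolding differentiable_def by blast
  ultimately show ?thesis by simp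
qed

lemma C_k_on_SucD:
  assumes "C_k_on (Suc k) f S" "x \<in> S"
  shows "(f has_derivative frechet_derivative f (at x)) (at x)"
  using assms by (simp add: frechet_derivative_works)

lemma C_k_on_Suc_imp: "C_k_on (Suc k) f S \<Longrightarrow> C_k_on k f S"
proof (induction k arbitrary: f)
  case (Suc k)
  have "C_k_on (Suc k) (\<lambda>x. frechet_derivative f (at x) v) S" for v
    using Suc.prems by (subst (asm) C_k_on.simps) blast
  then have "C_k_on k (\<lambda>x. frechet_derivative f (at x) v) S" for v
    using Suc.IH by blast
  moreover have "\<forall>x\<in>S. f differentiable at x" "continuous_on S f" using Suc.prems by auto
  ultimately show ?case by simp
qed auto

lemma C_k_on_const: "C_k_on k (\<lambda>x. c) S"
  by (induction k arbitrary: c) (simp_all add: frechet_derivative_const)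

lemma C_k_on_bounded_linear:
  assumes "bounded_linear f"
  shows "C_k_on k f S"
proof (cases k)
  case 0
  then show ?thesis using assms by (simp add: linear_continuous_on)
next
  case (Suc k')
  have "frechet_derivative f (at x) = f" for x
    using bounded_linear_imp_has_derivative[OF assms] by (metis frechet_derivative_at)
  moreover have "f differentiable at x" for x
    using bounded_linear_imp_has_derivative[OF assms] by (auto simp: differentiable_def)
  ultimately show ?thesis using assms Suc by (simp add: linear_continuous_on C_k_on_const)
qed

lemma C_k_on_add:
  assumes "open S" "C_k_on k f S" "C_k_on k g S"
  shows "C_k_on k (\<lambda>x. f x + g x) S"
  using assms(2,3)
proof (induction k arbitrary: f g)
  case 0
  then show ?case by (auto intro: continuous_intros)
next
  case (Suc k)
  show ?case
  proof (rule C_k_on_SucI[OF assms(1)])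
    show "((\<lambda>x. f x + g x) has_derivative (\<lambda>v. frechet_derivative f (at x) v + frechet_derivative g (at x) v)) (at x)"
      if "x \<in> S" for x
      using Suc.prems that by (intro has_derivative_add C_k_on_SucD) auto
    show "C_k_on k (\<lambda>x. frechet_derivative f (at x) v + frechet_derivative g (at x) v) S" for v
      using Suc by simp
  qed
qed

lemma C_k_on_bilinear:
  assumes "open S" "bounded_bilinear pr" "C_k_on k f S" "C_k_on k g S"
  shows "C_k_on k (\<lambda>x. pr (f x) (g x)) S"
  using assms(3,4)
proof (induction k arbitrary: f g)
  case 0
  then show ?case using bounded_bilinear.continuous_on[OF assms(2)] by auto
next
  case (Suc k)
  show ?case
  proof (rule C_k_on_SucI[OF assms(1)])
    show "((\<lambda>x. pr (f x) (g x)) has_derivative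
        (\<lambda>v. pr (f x) (frechet_derivative g (at x) v) + pr (frechet_derivative f (at x) v) (g x))) (at x)"
      if "x \<in> S" for x
      using Suc.prems that by (intro bounded_bilinear.FDERIV[OF assms(2)] C_k_on_SucD) auto
    show "C_k_on k (\<lambda>x. pr (f x) (frechet_derivative g (at x) v) + pr (frechet_derivative f (at x) v) (g x)) S" for v
      using Suc.prems C_k_on_Suc_imp[OF Suc.prems(1)] C_k_on_Suc_imp[OF Suc.prems(2)]
      by (intro C_k_on_add assms(1) Suc.IH) auto
  qed
qed

lemma C_k_on_sum:
  assumes "open S" "finite I" "\<And>i. i \<in> I \<Longrightarrow> C_k_on k (f i) S"
  shows "C_k_on k (\<lambda>x. \<Sum>i\<in>I. f i x) S"
  using assms(2,3) by (induction I) (auto intro!: C_k_on_add C_k_on_const assms(1))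

text \<open>\<open>C_k_on\<close> controls derivatives in fixed directions, while the chain rule
  differentiates g in the direction f'(x) v, which varies with x. Expanding that vector in the basis
  gives a finite sum of products, to which the induction applies; hence the Euclidean space in the
  middle.\<close>

lemma C_k_on_compose:
  fixes f :: "'a::real_normed_vector \<Rightarrow> 'b::euclidean_space" and g :: "'b \<Rightarrow> 'c::real_normed_vector"
  assumes "open S" "open T" "f ` S \<subseteq> T" "C_k_on k f S" "C_k_on k g T"
  shows "C_k_on k (\<lambda>x. g (f x)) S"
  using assms(4,5)
proof (induction k arbitrary: g)
  case 0
  then show ?case using assms(3) by (auto intro: continuous_on_compose2)
next
  case (Suc k)
  let ?D = "\<lambda>x v. \<Sum>b\<in>Basis. (frechet_derivative f (at x) v \<bullet> b) *\<^sub>R frechet_derivative g (at (f x)) b"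
  show ?case
  proof (rule C_k_on_SucI[OF assms(1)])
    fix x assume x: "x \<in> S"
    then have "f x \<in> T" using assms(3) by auto
    then have dg: "(g has_derivative frechet_derivative g (at (f x))) (at (f x))"
      using Suc.prems C_k_on_SucD by blast
    have hd: "((\<lambda>x. g (f x)) has_derivative
        (\<lambda>v. frechet_derivative g (at (f x)) (frechet_derivative f (at x) v))) (at x)"
      using diff_chain_at[OF C_k_on_SucD[OF Suc.prems(1) x] dg] by (simp add: o_def)
    have eq: "frechet_derivative g (at (f x)) w =
        (\<Sum>b\<in>Basis. (w \<bullet> b) *\<^sub>R frechet_derivative g (at (f x)) b)" for w
    proof -
      have l: "linear (frechet_derivative g (at (f x)))"
        using dg has_derivative_linear by blast
      have "frechet_derivative g (at (f x)) (\<Sum>b\<in>Basis. (w \<bullet> b) *\<^sub>R b) =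
          (\<Sum>b\<in>Basis. (w \<bullet> b) *\<^sub>R frechet_derivative g (at (f x)) b)"
        by (simp add: linear_sum[OF l] linear_scale[OF l])
      then show ?thesis by (simp add: euclidean_representation)
    qed
    show "((\<lambda>x. g (f x)) has_derivative ?D x) (at x)"
      by (rule has_derivative_eq_rhs[OF hd]) (rule ext, rule eq)
  next
    fix v
    have "C_k_on k (\<lambda>x. frechet_derivative f (at x) v \<bullet> b) S" for b
      using Suc.prems(1)
      by (intro C_k_on_bilinear[OF assms(1) bounded_bilinear_inner] C_k_on_const) auto
    moreover have "C_k_on k (\<lambda>x. frechet_derivative g (at (f x)) b) S" for b
      using Suc.IH[of "\<lambda>y. frechet_derivative g (at y) b"] Suc.prems C_k_on_Suc_imp[OF Suc.prems(1)] by auto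
    ultimately show "C_k_on k (\<lambda>x. ?D x v) S"
      by (intro C_k_on_sum[OF assms(1)] C_k_on_bilinear[OF assms(1) bounded_bilinear_scaleR]) auto
  qed
qed

lemma smooth_on_const: "smooth_on (\<lambda>x. c) S"
  by (simp add: smooth_on_def C_k_on_const)

lemma smooth_on_bounded_linear: "bounded_linear f \<Longrightarrow> smooth_on f S"
  by (simp add: smooth_on_def C_k_on_bounded_linear)

lemma smooth_on_add: "open S \<Longrightarrow> smooth_on f S \<Longrightarrow> smooth_on g S \<Longrightarrow> smooth_on (\<lambda>x. f x + g x) S"
  by (simp add: smooth_on_def C_k_on_add)

lemma smooth_on_scaleR:
  "open S \<Longrightarrow> smooth_on f S \<Longrightarrow> smooth_on g S \<Longrightarrow> smooth_on (\<lambda>x. f x *\<^sub>R g x) S"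
  by (simp add: smooth_on_def C_k_on_bilinear[OF _ bounded_bilinear_scaleR])

lemma smooth_on_mult:
  fixes f g :: "_ \<Rightarrow> real"
  shows "open S \<Longrightarrow> smooth_on f S \<Longrightarrow> smooth_on g S \<Longrightarrow> smooth_on (\<lambda>x. f x * g x) S"
  using smooth_on_scaleR[of S f g] by simp

lemma smooth_on_diff:
  "open S \<Longrightarrow> smooth_on f S \<Longrightarrow> smooth_on g S \<Longrightarrow> smooth_on (\<lambda>x. f x - g x) S"
  using smooth_on_add[of S f "\<lambda>x. (-1) *\<^sub>R g x"] smooth_on_scaleR[of S "\<lambda>_. -1" g]
  by (simp add: smooth_on_const)

lemma smooth_on_compose:
  fixes f :: "'a::real_normed_vector \<Rightarrow> 'b::euclidean_space"
  assumes "open S" "open T" "f ` S \<subseteq> T" "smooth_on f S" "smooth_on g T"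
  shows "smooth_on (\<lambda>x. g (f x)) S"
  unfolding smooth_on_def
proof
  show "C_k_on k (\<lambda>x. g (f x)) S" for k
    by (rule C_k_on_compose[OF assms(1-3)]) (use assms(4,5) in \<open>simp_all add: smooth_on_def\<close>)
qed

lemma smooth_on_cong:
  assumes "open S" "\<And>x. x \<in> S \<Longrightarrow> f x = g x" "smooth_on f S"
  shows "smooth_on g S"
  unfolding smooth_on_def
proof
  show "C_k_on k g S" for k
    by (rule C_k_on_cong[OF assms(1,2)]) (use assms(3) in \<open>simp_all add: smooth_on_def\<close>)
qed

lemma smooth_on_subset: 
  assumes "smooth_on f T" "S \<subseteq> T"
  shows "smooth_on f S"
proof -
  have "C_k_on k f T \<Longrightarrow> C_k_on k f S" for k
    using assms(2)
    by (induction k arbitrary: f) (auto intro: continuous_on_subset)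
  then show ?thesis using assms(1) by (auto simp: smooth_on_def)
qed

lemma smooth_on_Pair:
  fixes f :: "'a::real_normed_vector \<Rightarrow> 'b::real_normed_vector" and g :: "'a \<Rightarrow> 'c::real_normed_vector"
  assumes "open S" "smooth_on f S" "smooth_on g S"
  shows "smooth_on (\<lambda>x. (f x, g x)) S"
proof -
  have "C_k_on k (\<lambda>x. (f x, g x)) S" if "C_k_on k f S" "C_k_on k g S" for k
    using that
  proof (induction k arbitrary: f g)
    case 0
    then show ?case by (auto intro: continuous_intros)
  next
    case (Suc k)
    show ?case
    proof (rule C_k_on_SucI[OF assms(1)])
      show "((\<lambda>x. (f x, g x)) has_derivative
          (\<lambda>v. (frechet_derivative f (at x) v, frechet_derivative g (at x) v))) (at x)"
        if "x \<in> S" for x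
        using Suc.prems that by (intro has_derivative_Pair C_k_on_SucD) auto
      show "C_k_on k (\<lambda>x. (frechet_derivative f (at x) v, frechet_derivative g (at x) v)) S" for v
        using Suc by simp
    qed
  qed
  then show ?thesis using assms(2,3) by (simp add: smooth_on_def)
qed

text \<open>In one real variable the derivative in direction v is v times the next function of the
  tower, so the induction never leaves the tower.\<close>

lemma smooth_on_real_derivatives:
  fixes D :: "nat \<Rightarrow> real \<Rightarrow> 'b::real_normed_vector"
  assumes "\<And>n x. (D n has_vector_derivative D (Suc n) x) (at x)"
  shows "smooth_on (D n) UNIV"
proof -
  have "C_k_on k (D n) UNIV" for k
  proof (induction k arbitrary: n)
    case 0
    then show ?case
      using assms by (auto intro!: continuous_at_imp_continuous_on has_vector_derivative_continuous)
  next
    case (Suc k)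
    show ?case
    proof (rule C_k_on_SucI)
      show "(D n has_derivative (\<lambda>v. v *\<^sub>R D (Suc n) x)) (at x)" for x
        using assms by (simp add: has_vector_derivative_def)
      show "C_k_on k (\<lambda>x. v *\<^sub>R D (Suc n) x) UNIV" for v
        by (intro C_k_on_bilinear[OF _ bounded_bilinear_scaleR] C_k_on_const Suc.IH open_UNIV)
    qed simp
  qed
  then show ?thesis by (simp add: smooth_on_def)
qed

lemma smooth_on_imp_derivative:
  assumes "smooth_on f S" "x \<in> S"
  shows "(f has_derivative frechet_derivative f (at x)) (at x)"
  using assms C_k_on_SucD[of 0 f S x] unfolding smooth_on_def by blast

lemma smooth_on_frechet_derivative:
  assumes "smooth_on f S"
  shows "smooth_on (\<lambda>x. frechet_derivative f (at x) v) S"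
proof -
  have "C_k_on k (\<lambda>x. frechet_derivative f (at x) v) S" for k
    using assms C_k_on.simps(2)[of k f S] unfolding smooth_on_def by blast
  then show ?thesis by (simp add: smooth_on_def)
qed

lemma smooth_on_imp_continuous_on: "smooth_on f S \<Longrightarrow> continuous_on S f"
  using C_k_on.simps(1)[of f S] unfolding smooth_on_def by blast

text \<open>The flat function \<open>exp (- 1 / x)\<close>: all its derivatives have the form \<open>p (1 / x) exp (- 1 / x)\<close>.\<close>

definition flat_fun :: "real poly \<Rightarrow> real \<Rightarrow> real" where
  "flat_fun p x = (if 0 < x then poly p (inverse x) * exp (- inverse x) else 0)"

text \<open>This is the difference quotient of \<open>flat_fun p\<close> at 0 from the right. With y
  = 1 / x it becomes a polynomial in y times exp (- y).\<close>

lemma flat_fun_decay: "((\<lambda>x. inverse x * (poly p (inverse x) * exp (- inverse x))) \<longlongrightarrow> 0) (at_right (0::real))"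
proof -
  have "((\<lambda>y::real. coeff q i * (y ^ i * exp (- y))) \<longlongrightarrow> 0) at_top" for i and q :: "real poly"
    using tendsto_mult_right_zero[OF tendsto_power_div_exp_0[of i], of "coeff q i"]
    by (simp add: exp_minus divide_inverse)
  then have "((\<lambda>y::real. \<Sum>i\<le>degree q. coeff q i * (y ^ i * exp (- y))) \<longlongrightarrow> 0) at_top" for q :: "real poly"
    by (rule tendsto_null_sum)
  then have "((\<lambda>y::real. poly q y * exp (- y)) \<longlongrightarrow> 0) at_top" for q :: "real poly"
    by (simp add: poly_altdef sum_distrib_right mult.assoc)
  \<comment> \<open>\<open>pCons 0 p\<close> is the polynomial y p(y), which absorbs the extra
    factor.\<close>
  from this[of "pCons 0 p"]
  have "((\<lambda>y::real. y * (poly p y * exp (- y))) \<longlongrightarrow> 0) at_top" by (simp add: mult.assoc)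
  from filterlim_compose[OF this filterlim_inverse_at_top_right] show ?thesis .
qed

text \<open>The chain rule produces a factor 1 / x^2, which is \<open>monom 1 2\<close> at 1 / x. It
  multiplies p, from the exponential, and - p', from the polynomial. At 0 the decay of the
  difference quotient decides.\<close>

lemma flat_fun_derivative:
  "(flat_fun p has_real_derivative flat_fun (monom 1 2 * (p - pderiv p)) x) (at x)"
proof (cases "x = 0")
  case False
  show ?thesis
  proof (cases "x > 0")
    case True
    have "((\<lambda>x. poly p (inverse x) * exp (- inverse x)) has_real_derivative
       flat_fun (monom 1 2 * (p - pderiv p)) x) (at x)"
      using True
      by (auto intro!: derivative_eq_intros DERIV_chain2[OF poly_DERIV]
          simp: flat_fun_def poly_monom algebra_simps power2_eq_square)
    then show ?thesis
      by (rule has_field_derivative_transform_within_open[of _ _ _ "{0<..}"])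
        (use True in \<open>auto simp: flat_fun_def\<close>)
  next
    case False2: False
    show ?thesis
      by (rule has_field_derivative_transform_within_open[of "\<lambda>_. 0" _ _ "{..<0}"])
        (use False False2 in \<open>auto simp: flat_fun_def\<close>)
  qed
next
  case True
  have "((\<lambda>y. (flat_fun p y - flat_fun p 0) / (y - 0)) \<longlongrightarrow> 0) (at 0)"
  proof (rule filterlim_split_at)
    show "((\<lambda>y. (flat_fun p y - flat_fun p 0) / (y - 0)) \<longlongrightarrow> 0) (at_left 0)"
      by (rule tendsto_eventually) (auto simp: flat_fun_def eventually_at_left_field intro!: exI[of _ "-1"])
    show "((\<lambda>y. (flat_fun p y - flat_fun p 0) / (y - 0)) \<longlongrightarrow> 0) (at_right 0)"
      by (rule Lim_transform_eventually[OF flat_fun_decay[of p]])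
        (auto simp: flat_fun_def eventually_at_right_field divide_inverse intro!: exI[of _ 1])
  qed
  then show ?thesis using True by (simp add: has_field_derivative_iff flat_fun_def)
qed

lemma smooth_flat_fun: "smooth_on (flat_fun p) UNIV"
proof -
  define D where "D n = flat_fun (((\<lambda>p. monom 1 2 * (p - pderiv p)) ^^ n) p)" for n
  have "(D n has_vector_derivative D (Suc n) x) (at x)" for n x
    unfolding D_def has_real_derivative_iff_has_vector_derivative[symmetric]
    using flat_fun_derivative by simp
  from smooth_on_real_derivatives[of D 0, OF this] show ?thesis by (simp add: D_def)
qed

section \<open>Real-analytic functions\<close>

lemma Re_of_real_mult: "Re (z * complex_of_real x) = Re z * x"
  by simp

text \<open>Encoded by local holomorphic extensions instead of power series, so that closure under
  quotients, square roots and primitives is inherited from complex analysis.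
  \<open>analytic_curve_imp_real_analytic_curve\<close> leads back to power series.\<close>

definition analytic :: "(real \<Rightarrow> real) \<Rightarrow> bool" where
  "analytic f \<longleftrightarrow> (\<forall>t. \<exists>r>0. \<exists>F. F holomorphic_on ball (complex_of_real t) r \<and>
     (\<forall>s. \<bar>s - t\<bar> < r \<longrightarrow> F (complex_of_real s) = complex_of_real (f s)))"

lemma of_real_in_ball: "complex_of_real s \<in> ball (complex_of_real t) r \<longleftrightarrow> \<bar>s - t\<bar> < r"
  by (simp add: dist_norm abs_minus_commute flip: of_real_diff)

lemma analytic_compose:
  assumes f: "analytic f" and U: "open U" "\<And>t. complex_of_real (f t) \<in> U" "G holomorphic_on U"
    and g: "\<And>t. G (complex_of_real (f t)) = complex_of_real (g (f t))"
  shows "analytic (\<lambda>t. g (f t))"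
  unfolding analytic_def
proof
  fix t
  from f obtain r F where r: "r > 0" and F: "F holomorphic_on ball (complex_of_real t) r"
    "\<And>s. \<bar>s - t\<bar> < r \<Longrightarrow> F (complex_of_real s) = complex_of_real (f s)"
    unfolding analytic_def by metis
  \<comment> \<open>The disc is shrunk until the extension of f takes its values in the domain of
    G.\<close>
  have "open (ball (complex_of_real t) r \<inter> F -` U)"
    using F(1) U(1) by (intro continuous_open_preimage holomorphic_on_imp_continuous_on) auto
  moreover have "complex_of_real t \<in> ball (complex_of_real t) r \<inter> F -` U"
    using r F(2)[of t] U(2) by simp
  ultimately obtain d where d: "d > 0" "ball (complex_of_real t) d \<subseteq> ball (complex_of_real t) r \<inter> F -` U"
    using openE by blast
  have "(G \<circ> F) holomorphic_on ball (complex_of_real t) d"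
    using d by (intro holomorphic_on_compose_gen[where t=U] U holomorphic_on_subset[OF F(1)]) auto
  moreover have "(G \<circ> F) (complex_of_real s) = complex_of_real (g (f s))" if "\<bar>s - t\<bar> < d" for s
  proof -
    have "complex_of_real s \<in> ball (complex_of_real t) d" using that of_real_in_ball by blast
    then have "\<bar>s - t\<bar> < r" using d of_real_in_ball by blast
    then show ?thesis using F(2) g by simp
  qed
  ultimately show "\<exists>r>0. \<exists>F. F holomorphic_on ball (complex_of_real t) r \<and>
     (\<forall>s. \<bar>s - t\<bar> < r \<longrightarrow> F (complex_of_real s) = complex_of_real (g (f s)))"
    using d(1) by blast
qed

lemma analytic_binary:
  assumes f: "analytic f" and g: "analytic g"
    and H: "\<And>F G S. F holomorphic_on S \<Longrightarrow> G holomorphic_on S \<Longrightarrow> (\<lambda>z. H (F z) (G z)) holomorphic_on S"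
    and h: "\<And>x y. H (complex_of_real x) (complex_of_real y) = complex_of_real (h x y)"
  shows "analytic (\<lambda>t. h (f t) (g t))"
  unfolding analytic_def
proof
  fix t
  from f obtain r F where r: "r > 0" and F: "F holomorphic_on ball (complex_of_real t) r"
    "\<And>s. \<bar>s - t\<bar> < r \<Longrightarrow> F (complex_of_real s) = complex_of_real (f s)"
    unfolding analytic_def by metis
  from g obtain q G where q: "q > 0" and G: "G holomorphic_on ball (complex_of_real t) q"
    "\<And>s. \<bar>s - t\<bar> < q \<Longrightarrow> G (complex_of_real s) = complex_of_real (g s)"
    unfolding analytic_def by metis
  have "(\<lambda>z. H (F z) (G z)) holomorphic_on ball (complex_of_real t) (min r q)"
    by (intro H holomorphic_on_subset[OF F(1)] holomorphic_on_subset[OF G(1)]) auto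
  moreover have "H (F (complex_of_real s)) (G (complex_of_real s)) = complex_of_real (h (f s) (g s))"
    if "\<bar>s - t\<bar> < min r q" for s
    using that F(2) G(2) h by simp
  ultimately show "\<exists>r>0. \<exists>F. F holomorphic_on ball (complex_of_real t) r \<and>
     (\<forall>s. \<bar>s - t\<bar> < r \<longrightarrow> F (complex_of_real s) = complex_of_real (h (f s) (g s)))"
    using r q by (intro exI[of _ "min r q"] conjI exI[of _ "\<lambda>z. H (F z) (G z)"]) auto
qed

lemma analytic_const [intro]: "analytic (\<lambda>t. c)"
  unfolding analytic_def by (intro allI exI[of _ 1] conjI exI[of _ "\<lambda>_. complex_of_real c"]) auto

lemma analytic_ident [intro]: "analytic (\<lambda>t. t)"
  unfolding analytic_def by (intro allI exI[of _ 1] conjI exI[of _ "\<lambda>z. z"]) auto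

lemma analytic_add [intro]: "analytic f \<Longrightarrow> analytic g \<Longrightarrow> analytic (\<lambda>t. f t + g t)"
  by (rule analytic_binary[where H="(+)"]) (auto intro: holomorphic_intros)

lemma analytic_diff [intro]: "analytic f \<Longrightarrow> analytic g \<Longrightarrow> analytic (\<lambda>t. f t - g t)"
  by (rule analytic_binary[where H="(-)"]) (auto intro: holomorphic_intros)

lemma analytic_mult [intro]: "analytic f \<Longrightarrow> analytic g \<Longrightarrow> analytic (\<lambda>t. f t * g t)"
  by (rule analytic_binary[where H="(*)"]) (auto intro: holomorphic_intros)

lemma analytic_minus [intro]: "analytic f \<Longrightarrow> analytic (\<lambda>t. - f t)"
  by (rule analytic_compose[where U=UNIV and G="\<lambda>z. - z"]) (auto intro: holomorphic_intros)

lemma analytic_power [intro]: "analytic f \<Longrightarrow> analytic (\<lambda>t. f t ^ n)"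
  by (rule analytic_compose[where U=UNIV and G="\<lambda>z. z ^ n"]) (auto intro: holomorphic_intros)

lemma analytic_sin [intro]: "analytic f \<Longrightarrow> analytic (\<lambda>t. sin (f t))"
  by (rule analytic_compose[where U=UNIV and G=sin]) (auto intro: holomorphic_intros simp: sin_of_real)

lemma analytic_cos [intro]: "analytic f \<Longrightarrow> analytic (\<lambda>t. cos (f t))"
  by (rule analytic_compose[where U=UNIV and G=cos]) (auto intro: holomorphic_intros simp: cos_of_real)

lemma analytic_inverse: "analytic f \<Longrightarrow> (\<And>t. f t \<noteq> 0) \<Longrightarrow> analytic (\<lambda>t. inverse (f t))"
  by (rule analytic_compose[where U="- {0}" and G=inverse]) (auto intro: holomorphic_intros)

lemma analytic_divide: "analytic f \<Longrightarrow> analytic g \<Longrightarrow> (\<And>t. g t \<noteq> 0) \<Longrightarrow> analytic (\<lambda>t. f t / g t)"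
  using analytic_mult[of f "\<lambda>t. inverse (g t)"] analytic_inverse[of g] by (simp add: divide_inverse)

lemma analytic_sqrt: "analytic f \<Longrightarrow> (\<And>t. 0 < f t) \<Longrightarrow> analytic (\<lambda>t. sqrt (f t))"
  by (rule analytic_compose[where U="- \<real>\<^sub>\<le>\<^sub>0" and G=csqrt])
    (auto intro: holomorphic_intros simp: not_le less_imp_le)

lemma analytic_sum: "(\<And>i. i \<in> I \<Longrightarrow> analytic (f i)) \<Longrightarrow> analytic (\<lambda>t. \<Sum>i\<in>I. f i t)"
  by (induction I rule: infinite_finite_induct) auto

section \<open>Derivatives and primitives of analytic functions\<close>

lemma holomorphic_real_line_derivative:
  assumes "F holomorphic_on ball (complex_of_real t) r" "\<bar>s - t\<bar> < r"
  shows "((\<lambda>s. F (complex_of_real s)) has_vector_derivative deriv F (complex_of_real s)) (at s)"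
proof -
  have "(F has_field_derivative deriv F (complex_of_real s)) (at (complex_of_real s))"
    using assms holomorphic_derivI of_real_in_ball by (metis open_ball)
  then show ?thesis
    using has_vector_derivative_real_field by blast
qed

lemma analytic_deriv:
  assumes "analytic f"
  shows "(f has_real_derivative deriv f t) (at t)" "analytic (deriv f)"
proof -
  have *: "\<exists>r>0. \<exists>F. F holomorphic_on ball (complex_of_real t) r \<and>
      (\<forall>s. \<bar>s - t\<bar> < r \<longrightarrow> F (complex_of_real s) = complex_of_real (deriv f s) \<and>
        (f has_real_derivative deriv f s) (at s))" for t
  proof -
    from assms obtain r F where r: "r > 0" and F: "F holomorphic_on ball (complex_of_real t) r"
      "\<And>s. \<bar>s - t\<bar> < r \<Longrightarrow> F (complex_of_real s) = complex_of_real (f s)"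
      unfolding analytic_def by metis
    have "deriv F (complex_of_real s) = complex_of_real (deriv f s) \<and> (f has_real_derivative deriv f s) (at s)"
      if s: "\<bar>s - t\<bar> < r" for s
    proof -
      have "((\<lambda>s. complex_of_real (f s)) has_vector_derivative deriv F (complex_of_real s)) (at s)"
        by (rule has_vector_derivative_transform_within_open
            [OF holomorphic_real_line_derivative[OF F(1) s], where S="{s. \<bar>s - t\<bar> < r}"])
          (use s F(2) in \<open>auto intro!: open_Collect_less continuous_intros\<close>)
      note d = bounded_linear.has_vector_derivative[OF bounded_linear_Re this]
        bounded_linear.has_vector_derivative[OF bounded_linear_Im this]
      \<comment> \<open>The extension is real on the real axis, so the imaginary part of its
        derivative along that axis is the derivative of the zero function.\<close>
      have "Im (deriv F (complex_of_real s)) = 0"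
        using d(2) by (simp add: vector_derivative_at[symmetric])
          (metis has_vector_derivative_const vector_derivative_at)
      moreover have 1: "(f has_real_derivative Re (deriv F (complex_of_real s))) (at s)"
        using d(1) by (simp add: has_real_derivative_iff_has_vector_derivative)
      moreover have "deriv f s = Re (deriv F (complex_of_real s))"
        using 1 by (rule DERIV_imp_deriv)
      ultimately show ?thesis by (simp add: complex_eq_iff)
    qed
    then show ?thesis
      using r holomorphic_deriv[OF F(1) open_ball] by blast
  qed
  show "(f has_real_derivative deriv f t) (at t)"
    using *[of t] by force
  show "analytic (deriv f)"
    unfolding analytic_def using * by metis
qed

text \<open>The primitive is found on the whole line from continuity alone. Its analyticity is
  local: on each disc a holomorphic primitive of the extension, with the right additive constant,
  agrees with it on the real segment.\<close>

lemma analytic_primitive: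
  assumes "analytic f"
  obtains P where "analytic P" "P 0 = 0" "\<And>t. (P has_real_derivative f t) (at t)"
proof -
  have "isCont f x" for x
    using DERIV_isCont[OF analytic_deriv(1)[OF assms]] .
  then obtain Q where Q: "\<And>x. (Q has_vector_derivative f x) (at x)"
    using einterval_antiderivative[of "-\<infinity>" "\<infinity>" f] by auto
  define P where "P t = Q t - Q 0" for t
  have P: "(P has_vector_derivative f x) (at x)" for x
    using has_vector_derivative_diff[OF Q[of x] has_vector_derivative_const[of "Q 0"]]
    by (simp add: P_def[abs_def])
  have "analytic P"
    unfolding analytic_def
  proof
    fix t
    from assms obtain r F where r: "r > 0" and F: "F holomorphic_on ball (complex_of_real t) r"
      "\<And>s. \<bar>s - t\<bar> < r \<Longrightarrow> F (complex_of_real s) = complex_of_real (f s)"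
      unfolding analytic_def by metis
    obtain G where G: "\<And>z. z \<in> ball (complex_of_real t) r \<Longrightarrow> (G has_field_derivative F z) (at z)"
      using holomorphic_convex_primitive'[OF convex_ball open_ball F(1)]
      by (metis at_within_open open_ball)
    define K where "K z = G z - G (complex_of_real t) + complex_of_real (P t)" for z
    have K: "(K has_field_derivative F z) (at z)" if "z \<in> ball (complex_of_real t) r" for z
      unfolding K_def by (auto intro!: derivative_eq_intros G that)
    have d: "((\<lambda>s. K (complex_of_real s) - complex_of_real (P s)) has_vector_derivative 0) (at s within {s. \<bar>s - t\<bar> < r})"
      if "s \<in> {s. \<bar>s - t\<bar> < r}" for s
    proof -
      have "((\<lambda>s. K (complex_of_real s)) has_vector_derivative F (complex_of_real s)) (at s)"
        using that K[of "complex_of_real s"] of_real_in_ball has_vector_derivative_real_field by blast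
      from has_vector_derivative_diff[OF this
          bounded_linear.has_vector_derivative[OF bounded_linear_of_real P[of s]]]
      show ?thesis using F(2)[of s] that by (auto intro: has_vector_derivative_at_within)
    qed
    have "{s. \<bar>s - t\<bar> < r} = ball t r" by (auto simp: dist_real_def)
    then have "convex {s. \<bar>s - t\<bar> < r}" by simp
    then obtain c where c: "\<And>s. s \<in> {s. \<bar>s - t\<bar> < r} \<Longrightarrow> K (complex_of_real s) - complex_of_real (P s) = c"
      using has_vector_derivative_zero_constant[OF _ d] by blast
    have "c = 0" using c[of t] r by (simp add: K_def)
    then have "K (complex_of_real s) = complex_of_real (P s)" if "\<bar>s - t\<bar> < r" for s
      using c[of s] that by simp
    moreover have "K holomorphic_on ball (complex_of_real t) r"
      using K by (meson field_differentiable_at_within field_differentiable_def holomorphic_on_def)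
    ultimately show "\<exists>r>0. \<exists>F. F holomorphic_on ball (complex_of_real t) r \<and>
     (\<forall>s. \<bar>s - t\<bar> < r \<longrightarrow> F (complex_of_real s) = complex_of_real (P s))"
      using r by blast
  qed
  moreover have "P 0 = 0" by (simp add: P_def)
  ultimately show ?thesis
    using that P by (simp add: has_real_derivative_iff_has_vector_derivative)
qed

section \<open>Analytic curves in space\<close>

definition analytic_curve :: "(real \<Rightarrow> real^3) \<Rightarrow> bool" where
  "analytic_curve f \<longleftrightarrow> (\<forall>i. analytic (\<lambda>t. f t $ i))"

lemma analytic_curve_const [intro]: "analytic_curve (\<lambda>t. c)"
  by (auto simp: analytic_curve_def)

lemma analytic_curve_add [intro]: "analytic_curve f \<Longrightarrow> analytic_curve g \<Longrightarrow> analytic_curve (\<lambda>t. f t + g t)"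
  by (auto simp: analytic_curve_def)

lemma analytic_curve_diff [intro]: "analytic_curve f \<Longrightarrow> analytic_curve g \<Longrightarrow> analytic_curve (\<lambda>t. f t - g t)"
  by (auto simp: analytic_curve_def)

lemma analytic_curve_scaleR [intro]: "analytic f \<Longrightarrow> analytic_curve g \<Longrightarrow> analytic_curve (\<lambda>t. f t *\<^sub>R g t)"
  by (auto simp: analytic_curve_def)

lemma analytic_curve_cross3 [intro]: "analytic_curve f \<Longrightarrow> analytic_curve g \<Longrightarrow> analytic_curve (\<lambda>t. cross3 (f t) (g t))"
  by (auto simp: analytic_curve_def cross3_def forall_3)

lemma analytic_inner [intro]: "analytic_curve f \<Longrightarrow> analytic_curve g \<Longrightarrow> analytic (\<lambda>t. f t \<bullet> g t)"
  unfolding analytic_curve_def inner_vec_def by (intro analytic_sum) (simp add: analytic_mult)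

lemma has_vector_derivative_componentwise3:
  fixes f :: "real \<Rightarrow> real^3"
  shows "(f has_vector_derivative d) (at t) \<longleftrightarrow> (\<forall>i. ((\<lambda>t. f t $ i) has_real_derivative d $ i) (at t))"
  unfolding has_real_derivative_iff_has_vector_derivative
    has_vector_derivative_def has_derivative_componentwise_within[where f=f]
  by (auto simp: Basis_vec_def inner_axis)

lemma analytic_curve_derivative:
  assumes "analytic_curve f"
  obtains f' where "analytic_curve f'" "\<And>t. (f has_vector_derivative f' t) (at t)"
proof
  show "analytic_curve (\<lambda>t. \<chi> i. deriv (\<lambda>t. f t $ i) t)"
    using assms by (auto simp: analytic_curve_def intro: analytic_deriv)
  show "(f has_vector_derivative (\<chi> i. deriv (\<lambda>t. f t $ i) t)) (at t)" for t
    using assms by (auto simp: analytic_curve_def has_vector_derivative_componentwise3 intro: analytic_deriv)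
qed

lemma analytic_curve_primitive:
  assumes "analytic_curve f"
  obtains P where "analytic_curve P" "P 0 = 0" "\<And>t. (P has_vector_derivative f t) (at t)"
proof -
  have "\<exists>P. analytic P \<and> P 0 = 0 \<and> (\<forall>t. (P has_real_derivative f t $ i) (at t))" for i
  proof -
    have "analytic (\<lambda>t. f t $ i)" using assms by (simp add: analytic_curve_def)
    then show ?thesis by (rule analytic_primitive) blast
  qed
  then obtain P where P: "\<And>i. analytic (P i) \<and> P i 0 = 0 \<and> (\<forall>t. (P i has_real_derivative f t $ i) (at t))"
    by metis
  show ?thesis
  proof
    show "analytic_curve (\<lambda>t. \<chi> i. P i t)" using P by (simp add: analytic_curve_def)
    show "(\<chi> i. P i 0) = 0" using P by (simp add: vec_eq_iff)
    show "((\<lambda>t. \<chi> i. P i t) has_vector_derivative f t) (at t)" for t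
      using P by (simp add: has_vector_derivative_componentwise3)
  qed
qed

text \<open>The derivative of an analytic curve can be chosen analytic; iterating one such choice
  gives a tower for \<open>smooth_on_real_derivatives\<close>.\<close>

lemma analytic_curve_imp_smooth_on: "analytic_curve f \<Longrightarrow> smooth_on f UNIV"
proof -
  assume f: "analytic_curve f"
  define d where "d f = (SOME f'. analytic_curve f' \<and> (\<forall>t. (f has_vector_derivative f' t) (at t)))" for f :: "real \<Rightarrow> real^3"
  have d: "analytic_curve (d f) \<and> (\<forall>t. (f has_vector_derivative d f t) (at t))" if "analytic_curve f" for f
  proof -
    from that have "\<exists>f'. analytic_curve f' \<and> (\<forall>t. (f has_vector_derivative f' t) (at t))"
      by (rule analytic_curve_derivative) blast
    then show ?thesis unfolding d_def by (rule someI_ex)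
  qed
  have v: "analytic_curve ((d ^^ n) f)" for n
    by (induction n) (simp_all add: f d)
  have "(((d ^^ n) f) has_vector_derivative (d ^^ Suc n) f t) (at t)" for n t
    using d[OF v[of n]] by simp
  from smooth_on_real_derivatives[of "\<lambda>n. (d ^^ n) f" 0, OF this] show ?thesis by simp
qed

text \<open>Taylor expansion of the holomorphic extensions of the three coordinates. Their values on
  the line are real, so the real parts of the coefficients suffice; the radius is the smallest of
  the three.\<close>

lemma analytic_curve_imp_real_analytic_curve:
  assumes "analytic_curve f"
  shows "real_analytic_curve f"
  unfolding real_analytic_curve_def
proof
  fix t
  have "\<exists>r>0. \<exists>a. \<forall>s. \<bar>s - t\<bar> < r \<longrightarrow> (\<lambda>n. (s - t) ^ n * a n) sums (f s $ i)" for i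
  proof -
    from assms have "analytic (\<lambda>t. f t $ i)" by (simp add: analytic_curve_def)
    then obtain r F where r: "r > 0" and F: "F holomorphic_on ball (complex_of_real t) r"
      "\<And>s. \<bar>s - t\<bar> < r \<Longrightarrow> F (complex_of_real s) = complex_of_real (f s $ i)"
      unfolding analytic_def by metis
    define a where "a n = Re ((deriv ^^ n) F (complex_of_real t) / fact n)" for n
    have "(\<lambda>n. (s - t) ^ n * a n) sums (f s $ i)" if s: "\<bar>s - t\<bar> < r" for s
    proof -
      have "(\<lambda>n. (deriv ^^ n) F (complex_of_real t) / fact n * (complex_of_real s - complex_of_real t) ^ n)
        sums F (complex_of_real s)"
        by (rule holomorphic_power_series[OF F(1)]) (use s of_real_in_ball in blast)
      then have "(\<lambda>n. (deriv ^^ n) F (complex_of_real t) / fact n * complex_of_real ((s - t) ^ n))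
        sums complex_of_real (f s $ i)"
        using F(2)[OF s] by simp
      from sums_Re[OF this]
      have "(\<lambda>n. Re ((deriv ^^ n) F (complex_of_real t) / fact n) * (s - t) ^ n) sums (f s $ i)"
        by (simp only: Re_complex_of_real Re_of_real_mult)
      then show ?thesis by (simp add: a_def mult.commute)
    qed
    then show ?thesis using r by blast
  qed
  then obtain r a where ra: "\<And>i. r i > 0"
    "\<And>i s. \<bar>s - t\<bar> < r i \<Longrightarrow> (\<lambda>n. (s - t) ^ n * a i n) sums (f s $ i)"
    by metis
  have "(\<lambda>n. (s - t) ^ n *\<^sub>R (\<chi> i. a i n)) sums f s" if "\<bar>s - t\<bar> < Min (range r)" for s
  proof -
    have "(\<lambda>n. (s - t) ^ n * a i n) sums (f s $ i)" for i
      using that by (intro ra(2)) auto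
    then show ?thesis
      unfolding sums_def by (intro vec_tendstoI) (simp add: sum_component)
  qed
  moreover have "Min (range r) > 0" using ra(1) by auto
  ultimately show "\<exists>r>0. \<exists>a. \<forall>s. \<bar>s - t\<bar> < r \<longrightarrow> (\<lambda>n. (s - t) ^ n *\<^sub>R a n) sums f s"
    by (intro exI[of _ "Min (range r)"] conjI exI[of _ "\<lambda>n. \<chi> i. a i n"]) auto
qed

lemma analytic_imp_continuous_on: "analytic f \<Longrightarrow> continuous_on S f"
  using DERIV_isCont[OF analytic_deriv(1)] continuous_at_imp_continuous_on by blast

lemma analytic_curve_imp_continuous_on: "analytic_curve f \<Longrightarrow> continuous_on S f"
  by (rule continuous_on_subset[OF smooth_on_imp_continuous_on[OF analytic_curve_imp_smooth_on]]) auto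

section \<open>Strips from deck-invariant maps\<close>

abbreviation band :: "(real \<times> real) set" where
  "band \<equiv> UNIV \<times> {-1<..<1}"

lemma open_band: "open band"
  by (intro open_Times) auto

text \<open>Near p the angle can be recovered continuously: Arg of q / p has its cut opposite to p,
  and adding Arg p undoes the division.\<close>

lemma continuous_on_sphere_cis:
  fixes F :: "complex \<times> real \<Rightarrow> 'b::topological_space"
  assumes "continuous_on (UNIV \<times> T) (\<lambda>(\<theta>, t). F (cis \<theta>, t))"
  shows "continuous_on (sphere (0::complex) 1 \<times> T) F"
  unfolding continuous_on_eq_continuous_within
proof
  fix x :: "complex \<times> real" assume x: "x \<in> sphere 0 1 \<times> T"
  obtain p t where pt: "x = (p, t)" by (cases x)
  with x have p: "norm p = 1" "t \<in> T" by auto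
  define A :: "(complex \<times> real) set" where "A = {q. q / p \<notin> \<real>\<^sub>\<le>\<^sub>0} \<times> UNIV"
  have "open {q. q / p \<notin> \<real>\<^sub>\<le>\<^sub>0}"
  proof -
    have "{q. q / p \<notin> \<real>\<^sub>\<le>\<^sub>0} = (\<lambda>q. q / p) -` (- \<real>\<^sub>\<le>\<^sub>0)" by auto
    moreover have "open \<dots>" using p by (intro open_vimage continuous_intros) (auto simp: open_Compl)
    ultimately show ?thesis by simp
  qed
  then have A: "open A" by (simp add: A_def open_Times)
  have xA: "x \<in> A" using p by (auto simp: A_def pt)
  have rep: "cis (Arg (q / p) + Arg p) = q" if "norm q = 1" for q
  proof -
    have "q / p \<noteq> 0" "p \<noteq> 0" using p that by auto
    then have "cis (Arg (q / p)) = q / p" "cis (Arg p) = p"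
      using p that by (simp_all add: cis_Arg sgn_div_norm norm_divide)
    then show ?thesis using \<open>p \<noteq> 0\<close> by (simp flip: cis_mult)
  qed
  have "continuous_on (sphere 0 1 \<times> T \<inter> A) ((\<lambda>(\<theta>, t). F (cis \<theta>, t)) \<circ> (\<lambda>y. (Arg (fst y / p) + Arg p, snd y)))"
    using p
    by (intro continuous_on_compose continuous_on_subset[OF assms]
        continuous_intros continuous_on_Arg'[unfolded o_def])
       (auto simp: A_def)
  then have "continuous_on (sphere 0 1 \<times> T \<inter> A) F"
    by (rule continuous_on_eq) (use rep in auto)
  then have "continuous (at x within (sphere 0 1 \<times> T \<inter> A)) F"
    using x xA by (simp add: continuous_on_eq_continuous_within)
  moreover have "at x within (sphere 0 1 \<times> T \<inter> A) = at x within (sphere 0 1 \<times> T)"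
    using A xA by (intro at_within_nhd[of _ A]) auto
  ultimately show "continuous (at x within (sphere 0 1 \<times> T)) F" by simp
qed

section \<open>The deck group and the fibres of the covering\<close>

lemma moebius_class_eq_iff:
  "moebius_class (p, t) = moebius_class (q, u) \<longleftrightarrow> (q = p \<and> u = t) \<or> (q = - p \<and> u = - t)"
  by (auto simp: moebius_class_def doubleton_eq_iff)

text \<open>The deck group is infinite cyclic; this is the k-th power of its generator.\<close>

definition deck :: "int \<Rightarrow> real \<times> real \<Rightarrow> real \<times> real" where
  "deck k x = (fst x + of_int k * pi, if even k then snd x else - snd x)"

lemma deck_0 [simp]: "deck 0 x = x"
  by (simp add: deck_def)

lemma deck_add: "deck (k + l) x = deck k (deck l x)"
  by (auto simp: deck_def algebra_simps)

lemma deck_invariant: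
  assumes "\<And>\<theta> t. \<Phi> (\<theta> + pi, - t) = \<Phi> (\<theta>, t)"
  shows "\<Phi> (deck k x) = \<Phi> x"
proof -
  have 1: "\<Phi> (deck 1 x) = \<Phi> x" for x
    using assms[of "fst x" "snd x"] by (simp add: deck_def)
  show ?thesis
  proof (induction k rule: int_induct[of _ 0])
    case (step1 k)
    then show ?case using 1[of "deck k x"] deck_add[of 1 k x] by (simp add: add.commute)
  next
    case (step2 k)
    then show ?case using 1[of "deck (k - 1) x"] deck_add[of 1 "k - 1" x] by simp
  qed simp
qed

lemma moebius_cover_deck_int: "moebius_cover (deck k x) = moebius_cover x"
  by (rule deck_invariant) (rule moebius_cover_deck)

text \<open>Even k come from equal points of the cylinder, odd k from points exchanged by the
  involution.\<close>

lemma moebius_cover_eq_iff: "moebius_cover x = moebius_cover y \<longleftrightarrow> (\<exists>k. y = deck k x)"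
proof
  assume *: "moebius_cover x = moebius_cover y"
  have eq: "\<exists>n::int. b = a + 2 * pi * of_int n" if "cis b = cis a" for a b
  proof -
    have "sin b = sin a \<and> cos b = cos a" using that by (metis cis.sel)
    then show ?thesis using sin_cos_eq_iff by blast
  qed
  obtain a t b u where xy: "x = (a, t)" "y = (b, u)" by (meson surj_pair)
  with * consider "cis b = cis a" "u = t" | "cis b = - cis a" "u = - t"
    by (auto simp: moebius_cover_def moebius_class_eq_iff)
  then show "\<exists>k. y = deck k x"
  proof cases
    case 1
    then obtain n :: int where "b = a + 2 * pi * of_int n" using eq by blast
    then have "y = deck (2 * n) x" using 1 by (simp add: deck_def xy)
    then show ?thesis by blast
  next
    case 2
    then have "cis b = cis (a + pi)" by (simp add: complex_eq_iff)
    then obtain n :: int where "b = a + pi + 2 * pi * of_int n" using eq by blast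
    then have "y = deck (2 * n + 1) x" using 2 by (simp add: deck_def xy algebra_simps)
    then show ?thesis by blast
  qed
next
  assume "\<exists>k. y = deck k x"
  then show "moebius_cover x = moebius_cover y" using moebius_cover_deck_int by metis
qed

definition descend :: "(real \<times> real \<Rightarrow> 'b) \<Rightarrow> (complex \<times> real) set \<Rightarrow> 'b" where
  "descend \<Phi> c = \<Phi> (SOME x. x \<in> band \<and> moebius_cover x = c)"

lemma descend_moebius_cover:
  assumes "\<And>\<theta> t. \<Phi> (\<theta> + pi, - t) = \<Phi> (\<theta>, t)" "x \<in> band"
  shows "descend \<Phi> (moebius_cover x) = \<Phi> x"
proof -
  define y where "y = (SOME y. y \<in> band \<and> moebius_cover y = moebius_cover x)"
  have "y \<in> band \<and> moebius_cover y = moebius_cover x"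
    unfolding y_def by (rule someI[of _ x]) (use assms in auto)
  then obtain k where "x = deck k y" using moebius_cover_eq_iff by blast
  then have "\<Phi> x = \<Phi> y" using deck_invariant[of \<Phi>, OF assms(1)] by simp
  then show ?thesis by (simp add: descend_def y_def)
qed

lemma periodic_shift:
  fixes c :: real
  assumes "0 < c"
  obtains k :: int where "t + of_int k * c \<in> {a..a + c}"
proof
  show "t + of_int (- \<lfloor>(t - a) / c\<rfloor>) * c \<in> {a..a + c}"
    using floor_divide_lower[OF assms, of "t - a"] floor_divide_upper[OF assms, of "t - a"]
    by (simp add: algebra_simps)
qed

lemma deck_shift:
  obtains k where "fst (deck k x) \<in> {a..a + pi}"
  using periodic_shift[OF pi_gt_zero, of "fst x" a] by (auto simp: deck_def)

text \<open>\<open>moebius_strip\<close> sees a map only through its values on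
  \<open>moebius_band\<close>. This matters at the end of the isotopy, where a map built by
  \<open>descend\<close> is compared with the given strip on the band only.\<close>

lemma moebius_strip_cong:
  assumes "moebius_strip f" "\<And>c. c \<in> moebius_band \<Longrightarrow> f c = g c"
  shows "moebius_strip g"
proof -
  have eq: "(f \<circ> moebius_cover) x = (g \<circ> moebius_cover) x" if "x \<in> band" for x
    using that assms(2) moebius_cover_image by fastforce
  have "smooth_on (g \<circ> moebius_cover) band"
    by (rule smooth_on_cong[OF open_band, of "f \<circ> moebius_cover"])
      (use eq assms(1) in \<open>unfold moebius_strip_def, blast+\<close>)
  moreover have "inj (frechet_derivative (g \<circ> moebius_cover) (at x))" if x: "x \<in> band" for x
  proof -
    have s: "smooth_on (f \<circ> moebius_cover) band" using assms(1) unfolding moebius_strip_def by blast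
    have "(g \<circ> moebius_cover has_derivative frechet_derivative (f \<circ> moebius_cover) (at x)) (at x)"
      by (rule has_derivative_transform_within_open[OF smooth_on_imp_derivative[OF s x] open_band x eq])
    from frechet_derivative_at[OF this] show ?thesis
      using assms(1) x unfolding moebius_strip_def by metis
  qed
  moreover have "embedding_map moebius_topology euclidean g"
  proof -
    have "embedding_map moebius_topology euclidean f" using assms(1) unfolding moebius_strip_def by blast
    moreover have "f ` moebius_band = g ` moebius_band" using assms(2) by auto
    ultimately show ?thesis
      using assms(2) homeomorphic_map_eq[of moebius_topology _ f g]
      by (auto simp: embedding_map_def topspace_moebius_topology)
  qed
  ultimately show ?thesis unfolding moebius_strip_def by blast
qed

text \<open>The width w < 1 leaves room: after rescaling, the map is still continuous, and injective
  modulo the deck group, on the closed band. Compactness of a closed fundamental domain then yields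
  a homeomorphism onto the image, which injectivity and immersion on an open band alone would not
  give.\<close>

lemma moebius_strip_descend:
  fixes \<Phi> :: "real \<times> real \<Rightarrow> real^3"
  assumes w: "0 < w" "w < 1"
    and inv: "\<And>\<theta> t. \<Phi> (\<theta> + pi, - t) = \<Phi> (\<theta>, t)"
    and smooth: "smooth_on \<Phi> band"
    and imm: "\<And>\<theta> t. \<bar>t\<bar> \<le> w \<Longrightarrow> inj (frechet_derivative \<Phi> (at (\<theta>, t)))"
    and inj: "\<And>\<theta> t \<eta> u. \<lbrakk>\<bar>t\<bar> \<le> w; \<bar>u\<bar> \<le> w; \<Phi> (\<theta>, t) = \<Phi> (\<eta>, u)\<rbrakk> \<Longrightarrow>
      moebius_cover (\<theta>, t) = moebius_cover (\<eta>, u)"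
  shows "moebius_strip (descend (\<lambda>(\<theta>, t). \<Phi> (\<theta>, w * t)))"
proof -
  define \<Psi> where "\<Psi> = (\<lambda>(\<theta>, t). \<Phi> (\<theta>, w * t))"
  define L :: "real \<times> real \<Rightarrow> real \<times> real" where "L = (\<lambda>x. (fst x, w * snd x))"
  have \<Psi>L: "\<Psi> = (\<lambda>x. \<Phi> (L x))" by (auto simp: \<Psi>_def L_def)
  have bl: "bounded_linear L"
    unfolding L_def
    by (intro bounded_linear_Pair bounded_linear_fst bounded_linear_const_mult bounded_linear_snd)
  have wt: "\<bar>w * t\<bar> < 1" if "\<bar>t\<bar> \<le> 1" for t :: real
  proof -
    have "\<bar>w * t\<bar> = w * \<bar>t\<bar>" using w by (simp add: abs_mult)
    also have "\<dots> \<le> w" using that w by (simp add: mult_left_le)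
    finally show ?thesis using w by linarith
  qed
  have Lband: "L x \<in> band" if "\<bar>snd x\<bar> \<le> 1" for x
    using wt[OF that] by (auto simp: L_def abs_less_iff mem_Times_iff)
  have \<Psi>inv: "\<Psi> (\<theta> + pi, - t) = \<Psi> (\<theta>, t)" for \<theta> t
    using inv[of \<theta> "w * t"] by (simp add: \<Psi>_def)
  have \<Psi>inj: "moebius_cover x = moebius_cover y" if "\<bar>snd x\<bar> \<le> 1" "\<bar>snd y\<bar> \<le> 1" "\<Psi> x = \<Psi> y" for x y
  proof -
    have "\<bar>w * snd x\<bar> \<le> w" "\<bar>w * snd y\<bar> \<le> w" using that w by (auto simp: abs_mult)
    then have "moebius_cover (fst x, w * snd x) = moebius_cover (fst y, w * snd y)"
      using that(3) by (intro inj) (auto simp: \<Psi>_def split: prod.splits)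
    then obtain k where "(fst y, w * snd y) = deck k (fst x, w * snd x)"
      using moebius_cover_eq_iff by blast
    moreover have "w * a = - (w * b) \<longleftrightarrow> a = - b" for a b
      using w mult_cancel_left[of w a "- b"] by simp
    ultimately have "y = deck k x" using w by (cases x; cases y) (auto simp: deck_def split: if_splits)
    then show ?thesis using moebius_cover_eq_iff by blast
  qed
  have \<Psi>smooth: "smooth_on \<Psi> band"
    unfolding \<Psi>L
  proof (rule smooth_on_compose[OF open_band open_band _ smooth_on_bounded_linear[OF bl] smooth])
    show "L ` band \<subseteq> band"
    proof (rule image_subsetI)
      show "L x \<in> band" if "x \<in> band" for x
        by (rule Lband) (use that in auto)
    qed
  qed
  define f where "f = descend \<Psi>"
  have f: "(f \<circ> moebius_cover) x = \<Psi> x" if "x \<in> band" for x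
    using descend_moebius_cover[of \<Psi>, OF \<Psi>inv that] by (simp add: f_def)
  have "smooth_on (f \<circ> moebius_cover) band"
    by (rule smooth_on_cong[OF open_band f[symmetric] \<Psi>smooth])
  moreover have "inj (frechet_derivative (f \<circ> moebius_cover) (at x))" if x: "x \<in> band" for x
  proof -
    have "\<bar>snd x\<bar> \<le> 1" using x by auto
    then have Lx: "L x \<in> band" by (rule Lband)
    have d: "(\<Psi> has_derivative (\<lambda>v. frechet_derivative \<Phi> (at (L x)) (L v))) (at x)"
      unfolding \<Psi>L
      using diff_chain_at[OF bounded_linear_imp_has_derivative[OF bl]
          smooth_on_imp_derivative[OF smooth Lx]] by (simp add: o_def)
    have "(f \<circ> moebius_cover has_derivative (\<lambda>v. frechet_derivative \<Phi> (at (L x)) (L v))) (at x)"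
      by (rule has_derivative_transform_within_open[OF d open_band x f[symmetric]])
    note frechet_derivative_at[OF this]
    moreover have "inj (\<lambda>v. frechet_derivative \<Phi> (at (L x)) (L v))"
    proof -
      have "inj (frechet_derivative \<Phi> (at (L x)))"
        unfolding L_def by (rule imm) (use x w in \<open>auto simp: abs_mult mult_left_le\<close>)
      moreover have "inj L" using w by (auto simp: L_def inj_on_def prod_eq_iff)
      ultimately show ?thesis using inj_compose by (fastforce simp: o_def)
    qed
    ultimately show ?thesis by metis
  qed
  moreover have "embedding_map moebius_topology euclidean f"
  proof -
    have \<Psi>cont: "continuous_on {x. \<bar>snd x\<bar> \<le> 1} \<Psi>"
    proof -
      have "continuous_on {x. \<bar>snd x\<bar> \<le> 1} L" using bl by (rule linear_continuous_on)
      then show ?thesis unfolding \<Psi>L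
        by (rule continuous_on_compose2[OF smooth_on_imp_continuous_on[OF smooth]])
          (intro image_subsetI, rule Lband, simp)
    qed
    have cont: "continuous_map moebius_topology euclidean f"
    proof -
      have "continuous_on (UNIV \<times> {-1<..<1}) (\<lambda>(\<theta>, t). (f \<circ> moebius_class) (cis \<theta>, t))"
        by (rule continuous_on_eq[OF smooth_on_imp_continuous_on[OF \<Psi>smooth]])
          (use f in \<open>auto simp: moebius_cover_def\<close>)
      then have "continuous_on cylinder (f \<circ> moebius_class)"
        unfolding cylinder_def by (rule continuous_on_sphere_cis)
      then have "continuous_map (top_of_set cylinder) euclidean (f \<circ> moebius_class)"
        by simp
      then show ?thesis
        using continuous_compose_quotient_map_eq[OF quotient_map_moebius_class] by blast
    qed
    have inj: "inj_on f moebius_band"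
    proof (rule inj_onI)
      fix c d assume "c \<in> moebius_band" "d \<in> moebius_band" and eq: "f c = f d"
      then obtain x y where xy: "x \<in> band" "y \<in> band" "c = moebius_cover x" "d = moebius_cover y"
        unfolding moebius_cover_image[symmetric] by auto
      then have "\<Psi> x = \<Psi> y" using f[of x] f[of y] eq by simp
      then show "c = d" using \<Psi>inj[of x y] xy by auto
    qed
    have "open_map moebius_topology (top_of_set (f ` moebius_band)) f"
      unfolding open_map_def
    proof (intro allI impI)
      fix U assume U: "openin moebius_topology U"
      define W where "W = {x \<in> band. moebius_cover x \<in> U}"
      have "open W"
      proof -
        define V where "V = {x \<in> cylinder. moebius_class x \<in> U}"
        have "openin (top_of_set cylinder) V"
          using U by (simp add: openin_moebius_topology V_def)
        then obtain O' where O': "open O'" "V = cylinder \<inter> O'" by (auto simp: openin_open)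
        have "W = band \<inter> (\<lambda>x. (cis (fst x), snd x)) -` O'"
        proof -
          have "x \<in> W \<longleftrightarrow> x \<in> band \<and> (cis (fst x), snd x) \<in> V" for x
            by (cases x) (auto simp: W_def V_def cylinder_def moebius_cover_def)
          moreover have "(cis (fst x), snd x) \<in> cylinder" if "x \<in> band" for x
            using that by (auto simp: cylinder_def)
          ultimately show ?thesis using O'(2) by auto
        qed
        moreover have "open (band \<inter> (\<lambda>x. (cis (fst x), snd x)) -` O')"
          by (intro open_Int open_band open_vimage O'(1) continuous_intros)
        ultimately show ?thesis by simp
      qed
      \<comment> \<open>C is the part of a closed fundamental domain, boundary lines included, that
        lies outside the preimage W of U. Its image is compact, and the image of U is what the strip
        leaves over off that compact set.\<close>
      define C where "C = ({0..pi} \<times> {-1..1}) - W"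
      have "compact C"
        unfolding C_def using \<open>open W\<close> by (intro compact_diff compact_Times) auto
      then have "compact (\<Psi> ` C)"
        by (intro compact_continuous_image continuous_on_subset[OF \<Psi>cont]) (auto simp: C_def)
      then have op: "open (- \<Psi> ` C)" by (simp add: compact_imp_closed open_Compl)
      have "f ` U = f ` moebius_band \<inter> - \<Psi> ` C"
      proof (intro equalityI subsetI)
        fix z assume "z \<in> f ` U"
        then obtain c where c: "c \<in> U" "z = f c" by auto
        have cM: "c \<in> moebius_band" using c(1) U by (auto simp: openin_moebius_topology)
        then obtain x where x: "x \<in> band" "c = moebius_cover x"
          unfolding moebius_cover_image[symmetric] by auto
        have "z \<notin> \<Psi> ` C"
        proof
          assume "z \<in> \<Psi> ` C"
          then obtain y where y: "y \<in> C" "z = \<Psi> y" by auto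
          \<comment> \<open>Injectivity is used up to the boundary lines here: y may lie on one of
            them, and is excluded only as a deck image of the interior point x.\<close>
          then have cov: "moebius_cover x = moebius_cover y"
            using x c f[OF x(1)] by (intro \<Psi>inj) (auto simp: C_def)
          then obtain k where "y = deck k x" using moebius_cover_eq_iff by blast
          then have "y \<in> band" using x(1) by (auto simp: deck_def)
          then show False using y(1) cov x c(1) by (auto simp: C_def W_def)
        qed
        then show "z \<in> f ` moebius_band \<inter> - \<Psi> ` C" using c cM by auto
      next
        fix z assume z: "z \<in> f ` moebius_band \<inter> - \<Psi> ` C"
        then obtain x where x: "x \<in> band" "z = f (moebius_cover x)"
          unfolding moebius_cover_image[symmetric] by auto
        obtain k where k: "fst (deck k x) \<in> {0..0 + pi}" by (rule deck_shift)
        have kb: "deck k x \<in> band" using x(1) by (auto simp: deck_def)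
        have zz: "z = \<Psi> (deck k x)" using f[OF kb] x(2) moebius_cover_deck_int[of k x] by simp
        have "deck k x \<in> W"
        proof (rule ccontr)
          assume "deck k x \<notin> W"
          then have "deck k x \<in> C" using k kb by (auto simp: C_def mem_Times_iff)
          then show False using z zz by auto
        qed
        then show "z \<in> f ` U" using x(2) moebius_cover_deck_int[of k x] by (auto simp: W_def)
      qed
      then show "openin (top_of_set (f ` moebius_band)) (f ` U)"
        using op by (auto simp: openin_open)
    qed
    with cont inj show ?thesis
      unfolding embedding_map_def topspace_moebius_topology
      by (intro bijective_open_imp_homeomorphic_map)
        (auto simp: topspace_moebius_topology continuous_map_in_subtopology)
  qed
  ultimately show ?thesis unfolding moebius_strip_def f_def \<Psi>_def by blast
qed

section \<open>Narrow bands\<close>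

text \<open>Near (s0, x0) the map differs from the injective linear map L by a Lipschitz error of
  half the expansion constant of L, so it cannot identify two points. Joint continuity of P and Q
  makes the neighbourhood uniform in s.\<close>

lemma locally_injective_family:
  fixes \<Phi> P Q :: "real \<Rightarrow> real \<times> real \<Rightarrow> real^3"
  assumes der: "\<And>s x. \<lbrakk>s \<in> {0..1}; x \<in> band\<rbrakk> \<Longrightarrow>
      (\<Phi> s has_derivative (\<lambda>v. fst v *\<^sub>R P s x + snd v *\<^sub>R Q s x)) (at x)"
    and cP: "continuous_on ({0..1} \<times> band) (\<lambda>z. P (fst z) (snd z))"
    and cQ: "continuous_on ({0..1} \<times> band) (\<lambda>z. Q (fst z) (snd z))"
    and s0: "s0 \<in> {0..1}" and x0: "x0 \<in> band"
    and indep: "\<And>a b. a *\<^sub>R P s0 x0 + b *\<^sub>R Q s0 x0 = 0 \<Longrightarrow> a = 0 \<and> b = 0"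
  obtains \<rho> where "\<rho> > 0"
    "\<And>s x. \<lbrakk>s \<in> {0..1}; \<bar>s - s0\<bar> < \<rho>; x \<in> ball x0 \<rho>\<rbrakk> \<Longrightarrow>
      inj (\<lambda>v::real \<times> real. fst v *\<^sub>R P s x + snd v *\<^sub>R Q s x)"
    "\<And>s x y. \<lbrakk>s \<in> {0..1}; \<bar>s - s0\<bar> < \<rho>; x \<in> ball x0 \<rho>; y \<in> ball x0 \<rho>; \<Phi> s x = \<Phi> s y\<rbrakk> \<Longrightarrow> x = y"
proof -
  define L where "L = (\<lambda>v::real \<times> real. fst v *\<^sub>R P s0 x0 + snd v *\<^sub>R Q s0 x0)"
  have bl: "bounded_linear L"
    unfolding L_def
    by (intro bounded_linear_add bounded_linear_scaleR_const bounded_linear_fst bounded_linear_snd)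
  interpret L: bounded_linear L by (rule bl)
  have "inj L"
    using indep unfolding linear_injective_0[OF L.linear] by (auto simp: L_def prod_eq_iff)
  then obtain c where c: "c > 0" "\<And>v. c * norm v \<le> norm (L v)"
    using linear_inj_bounded_below_pos[OF L.linear] by (metis mult.commute)
  have "continuous (at (s0, x0) within {0..1} \<times> band) (\<lambda>z. P (fst z) (snd z))"
    "continuous (at (s0, x0) within {0..1} \<times> band) (\<lambda>z. Q (fst z) (snd z))"
    using cP cQ s0 x0 by (auto simp: continuous_on_eq_continuous_within)
  \<comment> \<open>Each of the two columns P and Q contributes c / 4 to the bound c / 2
    below.\<close>
  then obtain d1 d2 where d: "d1 > 0" "d2 > 0"
    "\<And>z. \<lbrakk>z \<in> {0..1} \<times> band; dist z (s0, x0) < d1\<rbrakk> \<Longrightarrow> dist (P (fst z) (snd z)) (P s0 x0) < c / 4"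
    "\<And>z. \<lbrakk>z \<in> {0..1} \<times> band; dist z (s0, x0) < d2\<rbrakk> \<Longrightarrow> dist (Q (fst z) (snd z)) (Q s0 x0) < c / 4"
    unfolding continuous_within_eps_delta using c(1)
    by (metis divide_pos_pos fst_conv snd_conv zero_less_numeral)
  obtain d3 where d3: "d3 > 0" "ball x0 d3 \<subseteq> band"
    using open_band x0 openE by blast
  define \<rho> where "\<rho> = min d3 (min d1 d2 / 2)"
  have \<rho>: "\<rho> > 0" using d d3 by (simp add: \<rho>_def)
  have near: "x \<in> band \<and> norm (fst v *\<^sub>R P s x + snd v *\<^sub>R Q s x - L v) \<le> c / 2 * norm v"
    if "s \<in> {0..1}" "\<bar>s - s0\<bar> < \<rho>" "x \<in> ball x0 \<rho>" for s x v
  proof -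
    have xb: "x \<in> band" using that(3) d3(2) by (auto simp: \<rho>_def)
    have "dist (s, x) (s0, x0) \<le> dist s s0 + dist x x0"
      using sqrt_sum_squares_le_sum[of "dist s s0" "dist x x0"] by (simp add: dist_Pair_Pair)
    also have "\<dots> < \<rho> + \<rho>"
      using that by (simp add: dist_real_def dist_commute)
    also have "\<dots> \<le> min d1 d2" by (auto simp: \<rho>_def)
    finally have "dist (s, x) (s0, x0) < d1" "dist (s, x) (s0, x0) < d2" by auto
    then have PQ: "norm (P s x - P s0 x0) \<le> c / 4" "norm (Q s x - Q s0 x0) \<le> c / 4"
      using d(3)[of "(s, x)"] d(4)[of "(s, x)"] that xb by (auto simp: dist_norm)
    have "fst v *\<^sub>R P s x + snd v *\<^sub>R Q s x - L v = fst v *\<^sub>R (P s x - P s0 x0) + snd v *\<^sub>R (Q s x - Q s0 x0)"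
      by (simp add: L_def algebra_simps)
    also have "norm \<dots> \<le> \<bar>fst v\<bar> * norm (P s x - P s0 x0) + \<bar>snd v\<bar> * norm (Q s x - Q s0 x0)"
      by (rule norm_triangle_le) simp
    also have "\<dots> \<le> norm v * (c / 4) + norm v * (c / 4)"
      using PQ norm_fst_le[of "fst v" "snd v"] norm_snd_le[of "snd v" "fst v"] by (intro add_mono mult_mono) auto
    finally show ?thesis using xb by simp
  qed
  show ?thesis
  proof
    show "\<rho> > 0" by fact
  next
    fix s x assume *: "s \<in> {0..1}" "\<bar>s - s0\<bar> < \<rho>" "x \<in> ball x0 \<rho>"
    have bl': "bounded_linear (\<lambda>v::real \<times> real. fst v *\<^sub>R P s x + snd v *\<^sub>R Q s x)"
      by (intro bounded_linear_add bounded_linear_scaleR_const bounded_linear_fst bounded_linear_snd)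
    show "inj (\<lambda>v::real \<times> real. fst v *\<^sub>R P s x + snd v *\<^sub>R Q s x)"
      unfolding linear_injective_0[OF bounded_linear.linear[OF bl']]
    proof (intro allI impI)
      fix v :: "real \<times> real" assume "fst v *\<^sub>R P s x + snd v *\<^sub>R Q s x = 0"
      then have "norm (L v) \<le> c / 2 * norm v" using near[OF *, of v] by simp
      then have "c * norm v \<le> c / 2 * norm v" using c(2)[of v] by linarith
      then show "v = 0" using c(1) by simp
    qed
  next
    fix s x y assume *: "s \<in> {0..1}" "\<bar>s - s0\<bar> < \<rho>" "x \<in> ball x0 \<rho>" "y \<in> ball x0 \<rho>" "\<Phi> s x = \<Phi> s y"
    have "norm ((\<Phi> s x - L x) - (\<Phi> s y - L y)) \<le> c / 2 * norm (x - y)"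
    proof (rule differentiable_bound[OF convex_ball _ _ *(3,4)])
      fix z assume z: "z \<in> ball x0 \<rho>"
      show "((\<lambda>z. \<Phi> s z - L z) has_derivative (\<lambda>v. fst v *\<^sub>R P s z + snd v *\<^sub>R Q s z - L v)) (at z within ball x0 \<rho>)"
        using near[OF *(1,2) z] *(1)
        by (intro has_derivative_diff has_derivative_at_withinI[OF der] bounded_linear_imp_has_derivative bl) auto
      show "onorm (\<lambda>v. fst v *\<^sub>R P s z + snd v *\<^sub>R Q s z - L v) \<le> c / 2"
        by (rule onorm_bound) (use c(1) near[OF *(1,2) z] in auto)
    qed
    also have "(\<Phi> s x - L x) - (\<Phi> s y - L y) = - L (x - y)"
      using *(5) by (simp add: L.diff)
    finally have "c * norm (x - y) \<le> c / 2 * norm (x - y)" using c(2)[of "x - y"] by simp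
    then show "x = y" using c(1) by simp
  qed
qed

text \<open>If every width fails, failures on bands of width tending to 0 accumulate at points of
  the core. There \<open>core\<close> forces the two limit points to agree modulo the deck group,
  and \<open>locally_injective_family\<close> excludes failures nearby. Compactness of the unit
  interval gives one width for all s.\<close>

lemma narrow_band_embedded:
  fixes \<Phi> P Q :: "real \<Rightarrow> real \<times> real \<Rightarrow> real^3"
  assumes der: "\<And>s x. \<lbrakk>s \<in> {0..1}; x \<in> band\<rbrakk> \<Longrightarrow>
      (\<Phi> s has_derivative (\<lambda>v. fst v *\<^sub>R P s x + snd v *\<^sub>R Q s x)) (at x)"
    and cP: "continuous_on ({0..1} \<times> band) (\<lambda>z. P (fst z) (snd z))"
    and cQ: "continuous_on ({0..1} \<times> band) (\<lambda>z. Q (fst z) (snd z))"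
    and c\<Phi>: "continuous_on ({0..1} \<times> band) (\<lambda>z. \<Phi> (fst z) (snd z))"
    and inv: "\<And>s \<theta> t. \<Phi> s (\<theta> + pi, - t) = \<Phi> s (\<theta>, t)"
      "\<And>s \<theta> t. \<bar>t\<bar> < 1 \<Longrightarrow> P s (\<theta> + pi, - t) = P s (\<theta>, t)"
      "\<And>s \<theta> t. \<bar>t\<bar> < 1 \<Longrightarrow> Q s (\<theta> + pi, - t) = - Q s (\<theta>, t)"
    and indep: "\<And>s \<theta> a b. \<lbrakk>s \<in> {0..1}; a *\<^sub>R P s (\<theta>, 0) + b *\<^sub>R Q s (\<theta>, 0) = 0\<rbrakk> \<Longrightarrow> a = 0 \<and> b = 0"
    and core: "\<And>s \<theta> \<eta>. \<lbrakk>s \<in> {0..1}; \<Phi> s (\<theta>, 0) = \<Phi> s (\<eta>, 0)\<rbrakk> \<Longrightarrow> \<exists>k::int. \<eta> = \<theta> + of_int k * pi"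
  obtains w where "0 < w" "w < 1"
    "\<And>s \<theta> t. \<lbrakk>s \<in> {0..1}; \<bar>t\<bar> \<le> w\<rbrakk> \<Longrightarrow>
      inj (\<lambda>v::real \<times> real. fst v *\<^sub>R P s (\<theta>, t) + snd v *\<^sub>R Q s (\<theta>, t))"
    "\<And>s \<theta> t \<eta> u. \<lbrakk>s \<in> {0..1}; \<bar>t\<bar> \<le> w; \<bar>u\<bar> \<le> w; \<Phi> s (\<theta>, t) = \<Phi> s (\<eta>, u)\<rbrakk> \<Longrightarrow>
      moebius_cover (\<theta>, t) = moebius_cover (\<eta>, u)"
proof -
  let ?I = "\<lambda>s x. inj (\<lambda>v::real \<times> real. fst v *\<^sub>R P s x + snd v *\<^sub>R Q s x)"
  \<comment> \<open>Both kinds of failure in one predicate; the first concerns x alone and leaves y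
    arbitrary.\<close>
  define bad where "bad s x y \<longleftrightarrow> \<not> ?I s x \<or> (\<Phi> s x = \<Phi> s y \<and> moebius_cover x \<noteq> moebius_cover y)" for s x y
  have \<Phi>d: "\<Phi> s (deck k x) = \<Phi> s x" for s k x
    by (rule deck_invariant) (rule inv(1))
  have Id: "?I s (deck k x) = ?I s x" if "x \<in> band" for s k x
  proof -
    \<comment> \<open>The symmetries of P and Q are available for |t| < 1 only, whereas
      \<open>deck_invariant\<close> asks for invariance everywhere; hence the value
      \<open>True\<close> outside the band.\<close>
    define J where "J x = (if \<bar>snd x\<bar> < 1 then ?I s x else True)" for x
    have "J (deck k x) = J x"
    proof (rule deck_invariant)
      fix \<theta> t
      have "?I s (\<theta> + pi, - t) = ?I s (\<theta>, t)" if t: "\<bar>t\<bar> < 1"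
      proof -
        let ?T = "\<lambda>v::real \<times> real. (fst v, - snd v)"
        let ?f = "\<lambda>v. fst v *\<^sub>R P s (\<theta>, t) + snd v *\<^sub>R Q s (\<theta>, t)"
        have b: "bij ?T" by (rule involuntory_imp_bij) auto
        have "(\<lambda>v::real \<times> real. fst v *\<^sub>R P s (\<theta> + pi, - t) + snd v *\<^sub>R Q s (\<theta> + pi, - t)) = ?f \<circ> ?T"
          using inv(2,3)[OF t] by (auto simp: fun_eq_iff)
        moreover have "inj ?f" if "inj (?f \<circ> ?T)"
          using inj_on_imageI[OF that] bij_is_surj[OF b] by simp
        moreover have "inj (?f \<circ> ?T)" if "inj ?f"
          using inj_compose[OF that bij_is_inj[OF b]] .
        ultimately show ?thesis by argo
      qed
      then show "J (\<theta> + pi, - t) = J (\<theta>, t)" by (simp add: J_def)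
    qed
    moreover have "\<bar>snd x\<bar> < 1" "\<bar>snd (deck k x)\<bar> < 1" using that by (auto simp: deck_def)
    ultimately show ?thesis by (simp add: J_def)
  qed
  have shift: "bad s (deck k x) (deck l y) \<longleftrightarrow> bad s x y" if "x \<in> band" for s k l x y
    using Id[OF that] \<Phi>d moebius_cover_deck_int by (simp add: bad_def)
  have "\<exists>w. 0 < w \<and> w < 1 \<and> (\<forall>s x y. s \<in> {0..1} \<and> \<bar>snd x\<bar> \<le> w \<and> \<bar>snd y\<bar> \<le> w \<longrightarrow> \<not> bad s x y)"
  proof (rule ccontr)
    assume neg: "\<not> ?thesis"
    define w where "w n = 1 / (real n + 2)" for n
    have w: "0 < w n" "w n < 1" for n by (auto simp: w_def field_simps)
    \<comment> \<open>The angle of x is moved into one period and that of y to within pi / 2 of it.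
      This keeps the sequences in a compact set and excludes limits that differ by a nontrivial deck
      transformation, which would be at least pi apart.\<close>
    define ok where "ok n s x y \<longleftrightarrow> s \<in> {0..1} \<and> \<bar>snd x\<bar> \<le> w n \<and> \<bar>snd y\<bar> \<le> w n \<and> bad s x y \<and>
        fst x \<in> {0..pi} \<and> fst y - fst x \<in> {- pi / 2..pi / 2}" for n s x y
    have "\<exists>s x y. ok n s x y" for n
    proof -
      obtain s x y where 1: "s \<in> {0..1}" "\<bar>snd x\<bar> \<le> w n" "\<bar>snd y\<bar> \<le> w n" "bad s x y"
        using neg w[of n] by meson
      obtain k where k: "fst (deck k x) \<in> {0..0 + pi}" by (rule deck_shift)
      obtain l where l: "fst (deck l y) \<in> {fst (deck k x) - pi / 2..fst (deck k x) - pi / 2 + pi}"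
        by (rule deck_shift)
      have "x \<in> band" using 1(2) w(2)[of n] by (auto simp: mem_Times_iff)
      then have "bad s (deck k x) (deck l y)" using 1(4) shift by simp
      moreover have "\<bar>snd (deck k x)\<bar> \<le> w n" "\<bar>snd (deck l y)\<bar> \<le> w n" using 1 by (auto simp: deck_def)
      ultimately show ?thesis using 1(1) k l
        by (intro exI[of _ s] exI[of _ "deck k x"] exI[of _ "deck l y"]) (auto simp: ok_def)
    qed
    then obtain S X Y where "\<And>n. ok n (S n) (X n) (Y n)" by metis
    then have SXY: "\<And>n. S n \<in> {0..1}" "\<And>n. \<bar>snd (X n)\<bar> \<le> w n" "\<And>n. \<bar>snd (Y n)\<bar> \<le> w n"
      "\<And>n. bad (S n) (X n) (Y n)" "\<And>n. fst (X n) \<in> {0..pi}" "\<And>n. fst (Y n) - fst (X n) \<in> {- pi / 2..pi / 2}"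
      unfolding ok_def by blast+
    define K where "K = {0..1::real} \<times> (({0..pi} \<times> {-1..1::real}) \<times> ({-pi..2*pi} \<times> {-1..1::real}))"
    have "seq_compact K" unfolding compact_eq_seq_compact_metric[symmetric] K_def by (intro compact_Times) auto
    have "(S n, X n, Y n) \<in> K" for n
    proof -
      have "\<bar>snd (X n)\<bar> \<le> 1" "\<bar>snd (Y n)\<bar> \<le> 1"
        using SXY(2,3)[of n] w(2)[of n] by linarith+
      then show ?thesis
        using SXY(1)[of n] SXY(5)[of n] SXY(6)[of n] pi_gt_zero by (auto simp: K_def mem_Times_iff abs_le_iff)
    qed
    then have "\<forall>n. (\<lambda>n. (S n, X n, Y n)) n \<in> K" by blast
    with \<open>seq_compact K\<close> obtain l r where lr: "l \<in> K" "strict_mono r" "((\<lambda>n. (S n, X n, Y n)) \<circ> r) \<longlonglongrightarrow> l"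
      by (rule seq_compactE)
    obtain s x y where l: "l = (s, x, y)" by (metis prod.exhaust)
    have lim: "(\<lambda>n. S (r n)) \<longlonglongrightarrow> s" "(\<lambda>n. X (r n)) \<longlonglongrightarrow> x" "(\<lambda>n. Y (r n)) \<longlonglongrightarrow> y"
      using tendsto_fst[OF lr(3)] tendsto_fst[OF tendsto_snd[OF lr(3)]] tendsto_snd[OF tendsto_snd[OF lr(3)]]
      by (simp_all add: l o_def)
    have w0: "(\<lambda>n. w (r n)) \<longlonglongrightarrow> 0"
    proof -
      have "w \<longlonglongrightarrow> 0" unfolding w_def by real_asymp
      from LIMSEQ_subseq_LIMSEQ[OF this lr(2)] show ?thesis by (simp add: o_def)
    qed
    have "(\<lambda>n. snd (X (r n))) \<longlonglongrightarrow> 0"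
      by (rule Lim_null_comparison[OF _ w0]) (use SXY(2) in auto)
    then have x0: "snd x = 0" using LIMSEQ_unique tendsto_snd[OF lim(2)] by blast
    have "(\<lambda>n. snd (Y (r n))) \<longlonglongrightarrow> 0"
      by (rule Lim_null_comparison[OF _ w0]) (use SXY(3) in auto)
    then have y0: "snd y = 0" using LIMSEQ_unique tendsto_snd[OF lim(3)] by blast
    have s: "s \<in> {0..1}" using lr(1) by (simp add: l K_def)
    have dxy: "fst y - fst x \<in> {- pi / 2..pi / 2}"
      by (rule Lim_in_closed_set[OF _ _ _ tendsto_diff[OF tendsto_fst[OF lim(3)] tendsto_fst[OF lim(2)]]])
        (use SXY(6) in auto)
    have xb: "x \<in> band" "y \<in> band" using x0 y0 by (auto simp: mem_Times_iff)
    have xe: "x = (fst x, 0)" "y = (fst y, 0)" using x0 y0 by (auto simp: prod_eq_iff)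
    have xe': "(fst x, 0) = x" using xe(1) by simp
    have ind: "a = 0 \<and> b = 0" if "a *\<^sub>R P s x + b *\<^sub>R Q s x = 0" for a b
      using indep[OF s, of a "fst x" b] that unfolding xe' by blast
    obtain \<rho> where \<rho>: "\<rho> > 0"
      "\<And>s' z. \<lbrakk>s' \<in> {0..1}; \<bar>s' - s\<bar> < \<rho>; z \<in> ball x \<rho>\<rbrakk> \<Longrightarrow> ?I s' z"
      "\<And>s' z z'. \<lbrakk>s' \<in> {0..1}; \<bar>s' - s\<bar> < \<rho>; z \<in> ball x \<rho>; z' \<in> ball x \<rho>; \<Phi> s' z = \<Phi> s' z'\<rbrakk> \<Longrightarrow> z = z'"
      by (rule locally_injective_family[of \<Phi> P Q, OF der cP cQ s xb(1) ind]) (assumption | rule that)+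
    have e1: "\<forall>\<^sub>F n in sequentially. \<bar>S (r n) - s\<bar> < \<rho>"
      using tendstoD[OF lim(1) \<rho>(1)] by (simp add: dist_real_def)
    have e2: "\<forall>\<^sub>F n in sequentially. X (r n) \<in> ball x \<rho>"
      using tendstoD[OF lim(2) \<rho>(1)] by (simp add: dist_commute)
    \<comment> \<open>Close to the limit the immersion cannot fail, so the failure must be a genuine
      double point.\<close>
    have e3: "\<forall>\<^sub>F n in sequentially. \<Phi> (S (r n)) (X (r n)) = \<Phi> (S (r n)) (Y (r n)) \<and>
        moebius_cover (X (r n)) \<noteq> moebius_cover (Y (r n))"
      using e1 e2
    proof eventually_elim
      case (elim n)
      then have "?I (S (r n)) (X (r n))" using \<rho>(2) SXY(1) by blast
      then show ?case using SXY(4)[of "r n"] by (simp add: bad_def)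
    qed
    have Xb: "X n \<in> band" "Y n \<in> band" for n
      using SXY(2,3)[of n] w(2)[of n] by (auto simp: mem_Times_iff)
    have lim\<Phi>: "(\<lambda>n. \<Phi> (S (r n)) (Z (r n))) \<longlonglongrightarrow> \<Phi> s z"
      if "(\<lambda>n. Z (r n)) \<longlonglongrightarrow> z" "z \<in> band" "\<And>n. Z n \<in> band" for Z z
    proof -
      have "((\<lambda>z. \<Phi> (fst z) (snd z)) \<circ> (\<lambda>n. (S (r n), Z (r n)))) \<longlonglongrightarrow> \<Phi> (fst (s, z)) (snd (s, z))"
        using c\<Phi>[unfolded continuous_on_sequentially] that s SXY(1) tendsto_Pair[OF lim(1) that(1)]
        by (auto simp del: fst_conv snd_conv)
      then show ?thesis by (simp add: o_def)
    qed
    have "\<Phi> s x = \<Phi> s y"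
    proof (rule LIMSEQ_unique)
      show "(\<lambda>n. \<Phi> (S (r n)) (X (r n))) \<longlonglongrightarrow> \<Phi> s x" by (rule lim\<Phi>) (use lim xb Xb in auto)
      have "(\<lambda>n. \<Phi> (S (r n)) (Y (r n))) \<longlonglongrightarrow> \<Phi> s y" by (rule lim\<Phi>) (use lim xb Xb in auto)
      then show "(\<lambda>n. \<Phi> (S (r n)) (X (r n))) \<longlonglongrightarrow> \<Phi> s y"
        by (rule Lim_transform_eventually) (use e3 in eventually_elim, simp)
    qed
    then obtain k :: int where k: "fst y = fst x + of_int k * pi" using core[OF s] xe by metis
    have "k = 0"
    proof (rule ccontr)
      assume "k \<noteq> 0"
      then have "1 \<le> \<bar>real_of_int k\<bar>" by linarith
      then have "pi \<le> \<bar>real_of_int k\<bar> * pi" by simp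
      also have "\<dots> = \<bar>fst y - fst x\<bar>" using k by (simp add: abs_mult)
      also have "\<dots> \<le> pi / 2" using dxy unfolding atLeastAtMost_iff by linarith
      finally show False using pi_gt_zero by linarith
    qed
    then have "y = x" using k x0 y0 by (simp add: prod_eq_iff)
    then have e4: "\<forall>\<^sub>F n in sequentially. Y (r n) \<in> ball x \<rho>"
      using tendstoD[OF lim(3) \<rho>(1)] by (simp add: dist_commute)
    have "\<forall>\<^sub>F n in sequentially. False"
      using e1 e2 e3 e4
    proof eventually_elim
      case (elim n)
      then have "X (r n) = Y (r n)" using \<rho>(3) SXY(1) by blast
      then show False using elim by simp
    qed
    then show False by simp
  qed
  then obtain w where "0 < w" "w < 1"
    and w: "\<And>s x y. \<lbrakk>s \<in> {0..1}; \<bar>snd x\<bar> \<le> w; \<bar>snd y\<bar> \<le> w\<rbrakk> \<Longrightarrow> \<not> bad s x y"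
    by blast
  show ?thesis
  proof (rule that[OF \<open>0 < w\<close> \<open>w < 1\<close>])
    show "?I s (\<theta>, t)" if "s \<in> {0..1}" "\<bar>t\<bar> \<le> w" for s \<theta> t
      using w[of s "(\<theta>, t)" "(\<theta>, t)"] that by (simp add: bad_def)
    show "moebius_cover (\<theta>, t) = moebius_cover (\<eta>, u)"
      if "s \<in> {0..1}" "\<bar>t\<bar> \<le> w" "\<bar>u\<bar> \<le> w" "\<Phi> s (\<theta>, t) = \<Phi> s (\<eta>, u)" for s \<theta> t \<eta> u
      using w[of s "(\<theta>, t)" "(\<eta>, u)"] that by (auto simp: bad_def)
  qed
qed

section \<open>Analytic approximation of periodic curves\<close>

lemma analytic_real_polynomial_cis:
  assumes "real_polynomial_function p"
  shows "analytic (\<lambda>t. p (cis t))"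
  using assms
proof induction
  case (linear h)
  interpret bounded_linear h by fact
  have "h (cis t) = cos t * h 1 + sin t * h \<i>" for t
  proof -
    have "cis t = cos t *\<^sub>R 1 + sin t *\<^sub>R \<i>" by (simp add: complex_eq_iff)
    then show ?thesis by (simp add: add scaleR)
  qed
  then show ?case by (simp, intro analytic_add analytic_mult analytic_cos analytic_sin analytic_const analytic_ident)
qed auto

lemma periodic_int:
  fixes f :: "real \<Rightarrow> 'a"
  assumes "\<And>t. f (t + c) = f t"
  shows "f (t + of_int k * c) = f t"
proof (induction k rule: int_induct[of _ 0])
  case (step1 k)
  then show ?case using assms[of "t + of_int k * c"] by (simp add: algebra_simps)
next
  case (step2 k)
  then show ?case using assms[of "t + of_int (k - 1) * c"] by (simp add: algebra_simps)
qed simp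

text \<open>Stone-Weierstrass on the circle: a polynomial restricted to the circle is a
  trigonometric polynomial in the angle, hence analytic and periodic.\<close>

lemma analytic_periodic_approximation:
  fixes f :: "real \<Rightarrow> real^3"
  assumes f: "continuous_on UNIV f" "\<And>t. f (t + 2 * pi) = f t" and e: "e > 0"
  obtains g where "analytic_curve g" "\<And>t. g (t + 2 * pi) = g t" "\<And>t. norm (f t - g t) < e"
proof -
  \<comment> \<open>The dummy second factor lets \<open>continuous_on_sphere_cis\<close> carry the
    continuity of f over to the circle; the periodicity of f hides the jump of Arg.\<close>
  define F where "F x = f (Arg (fst x))" for x :: "complex \<times> real"
  have F: "F (cis \<theta>, t) = f \<theta>" for \<theta> t
  proof -
    have "cis (Arg (cis \<theta>)) = cis \<theta>" by (simp add: cis_Arg sgn_div_norm)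
    then have "sin (Arg (cis \<theta>)) = sin \<theta> \<and> cos (Arg (cis \<theta>)) = cos \<theta>" by (metis cis.sel)
    then obtain n :: int where "Arg (cis \<theta>) = \<theta> + 2 * pi * of_int n" using sin_cos_eq_iff by blast
    then show ?thesis using periodic_int[of f, OF f(2), of \<theta> n] by (simp add: F_def mult.commute)
  qed
  have "continuous_on (UNIV \<times> {0}) (\<lambda>x. f (fst x))"
    by (intro continuous_on_compose2[OF f(1)] continuous_intros) auto
  then have "continuous_on (UNIV \<times> {0}) (\<lambda>(\<theta>, t). F (cis \<theta>, t))"
    by (simp add: F case_prod_unfold)
  then have "continuous_on (sphere 0 1 \<times> {0}) F" by (rule continuous_on_sphere_cis)
  then have "continuous_on (sphere 0 1) (\<lambda>p. F (p, 0))"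
    by (rule continuous_on_compose2) (auto intro!: continuous_intros)
  from Stone_Weierstrass_polynomial_function[OF compact_sphere this e]
  obtain q where "polynomial_function q \<and> (\<forall>p\<in>sphere 0 1. norm (F (p, 0) - q p) < e)"
    by (elim exE)
  then have q: "polynomial_function q" "\<And>p. p \<in> sphere 0 1 \<Longrightarrow> norm (F (p, 0) - q p) < e"
    by blast+
  show ?thesis
  proof
    show "analytic_curve (\<lambda>t. q (cis t))"
      unfolding analytic_curve_def
    proof
      fix i
      have "real_polynomial_function ((\<lambda>x. x $ i) \<circ> q)"
        using q(1) bounded_linear_vec_nth unfolding polynomial_function_def by blast
      from analytic_real_polynomial_cis[OF this] show "analytic (\<lambda>t. q (cis t) $ i)" by simp
    qed
    show "q (cis (t + 2 * pi)) = q (cis t)" for t by (simp flip: cis_mult)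
    show "norm (f t - q (cis t)) < e" for t using q(2)[of "cis t"] by (simp add: F)
  qed
qed

text \<open>Averaging over the half-turn with the sign \<sigma> enforces the symmetry and keeps the
  error bound. The sign is 1 for velocities and -1 for normal directions.\<close>

lemma analytic_half_periodic_approximation:
  fixes f :: "real \<Rightarrow> real^3"
  assumes f: "continuous_on UNIV f" "\<And>t. f (t + pi) = \<sigma> *\<^sub>R f t" and \<sigma>: "\<bar>\<sigma>\<bar> = 1" and e: "e > 0"
  obtains g where "analytic_curve g" "\<And>t. g (t + pi) = \<sigma> *\<^sub>R g t" "\<And>t. norm (g t - f t) < e"
proof -
  have \<sigma>2: "\<sigma> * \<sigma> = 1" using \<sigma> by (metis abs_mult_self_eq mult_1)
  have "f (t + 2 * pi) = f t" for t
    using f(2)[of "t + pi"] f(2)[of t] \<sigma>2 by (simp add: add.assoc)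
  then obtain g where g: "analytic_curve g" "\<And>t. g (t + 2 * pi) = g t" "\<And>t. norm (f t - g t) < e"
    using analytic_periodic_approximation[OF f(1) _ e] by blast
  define k where "k t = (1/2) *\<^sub>R (g t + \<sigma> *\<^sub>R g (t + pi))" for t
  show ?thesis
  proof
    have "analytic (\<lambda>t. g (t + pi) $ i)" for i
      unfolding analytic_def
    proof
      fix t
      from g(1) have "analytic (\<lambda>t. g t $ i)" by (simp add: analytic_curve_def)
      then obtain r F where r: "r > 0" and F: "F holomorphic_on ball (complex_of_real (t + pi)) r"
        "\<And>s. \<bar>s - (t + pi)\<bar> < r \<Longrightarrow> F (complex_of_real s) = complex_of_real (g s $ i)"
        unfolding analytic_def by metis
      have "(F \<circ> (\<lambda>z. z + complex_of_real pi)) holomorphic_on ball (complex_of_real t) r"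
        by (rule holomorphic_on_compose_gen[OF _ F(1)])
          (auto intro!: holomorphic_intros simp: dist_norm algebra_simps)
      moreover have "(F \<circ> (\<lambda>z. z + complex_of_real pi)) (complex_of_real s) = complex_of_real (g (s + pi) $ i)"
        if "\<bar>s - t\<bar> < r" for s
        using F(2)[of "s + pi"] that by simp
      ultimately show "\<exists>r>0. \<exists>F. F holomorphic_on ball (complex_of_real t) r \<and>
         (\<forall>s. \<bar>s - t\<bar> < r \<longrightarrow> F (complex_of_real s) = complex_of_real (g (s + pi) $ i))"
        using r by blast
    qed
    then have "analytic_curve (\<lambda>t. g (t + pi))" by (simp add: analytic_curve_def)
    then show "analytic_curve k" unfolding k_def using g(1) by (intro analytic_curve_scaleR analytic_curve_add analytic_const)
    show "k (t + pi) = \<sigma> *\<^sub>R k t" for t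
      using g(2)[of t] \<sigma>2 by (simp add: k_def algebra_simps)
    show "norm (k t - f t) < e" for t
    proof -
      have "\<sigma> *\<^sub>R f (t + pi) = f t" using f(2)[of t] \<sigma>2 by simp
      then have "k t - f t = (1/2) *\<^sub>R ((g t - f t) + \<sigma> *\<^sub>R (g (t + pi) - f (t + pi)))"
        by (simp add: k_def vec_eq_iff field_simps)
      also have "norm \<dots> \<le> (1/2) * (norm (g t - f t) + norm (g (t + pi) - f (t + pi)))"
        using norm_triangle_ineq[of "g t - f t" "\<sigma> *\<^sub>R (g (t + pi) - f (t + pi))"] \<sigma> by simp
      also have "\<dots> < e" using g(3)[of t] g(3)[of "t + pi"] by (simp add: norm_minus_commute)
      finally show ?thesis .
    qed
  qed
qed

lemma has_vector_derivative_zero_imp_const: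
  fixes f :: "real \<Rightarrow> 'a::real_normed_vector"
  assumes "\<And>t. (f has_vector_derivative 0) (at t)"
  shows "f t = f s"
  using has_vector_derivative_zero_constant[of UNIV f] assms by (metis UNIV_I convex_UNIV)

lemma has_vector_derivative_shift_real:
  fixes f :: "real \<Rightarrow> 'a::real_normed_vector"
  assumes "\<And>t. (f has_vector_derivative d t) (at t)"
  shows "((\<lambda>t. f (t + c)) has_vector_derivative d (t + c)) (at t)"
proof -
  have "((\<lambda>t. t + c) has_vector_derivative 1) (at t)"
    by (auto intro!: derivative_eq_intros)
  from vector_diff_chain_at[OF this, of f "d (t + c)"] assms[of "t + c"]
  show ?thesis by (simp add: o_def)
qed

text \<open>The velocity is approximated and then integrated, so the closeness is that of first
  derivatives. The constant M removes the drift over one period; it is at most e / 2 because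
  \<gamma> is closed. The position of the new curve is left free.\<close>

lemma analytic_closed_curve_approximation:
  fixes \<gamma> :: "real \<Rightarrow> real^3"
  assumes \<gamma>: "\<And>t. (\<gamma> has_vector_derivative d t) (at t)" "continuous_on UNIV d" "\<And>t. \<gamma> (t + pi) = \<gamma> t"
    and dper: "\<And>t. d (t + pi) = d t" and e: "e > 0"
  obtains \<gamma>1 d1 where "analytic_curve \<gamma>1" "analytic_curve d1" "\<And>t. (\<gamma>1 has_vector_derivative d1 t) (at t)"
    "\<And>t. \<gamma>1 (t + pi) = \<gamma>1 t" "\<And>t. norm (d1 t - d t) < e"
proof -
  obtain g where g: "analytic_curve g" "\<And>t. g (t + pi) = 1 *\<^sub>R g t" "\<And>t. norm (g t - d t) < e / 2"
    by (rule analytic_half_periodic_approximation[of d 1 "e / 2"]) (use \<gamma>(2) dper e in auto)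
  obtain P where P: "analytic_curve P" "P 0 = 0" "\<And>t. (P has_vector_derivative g t) (at t)"
    using analytic_curve_primitive[OF g(1)] by blast
  define M where "M = (1 / pi) *\<^sub>R P pi"
  have "norm ((P pi - \<gamma> pi) - (P 0 - \<gamma> 0)) \<le> e / 2 * norm (pi - 0)"
  proof (rule differentiable_bound[of UNIV "\<lambda>t. P t - \<gamma> t" "\<lambda>t x. x *\<^sub>R (g t - d t)"])
    show "((\<lambda>t. P t - \<gamma> t) has_derivative (\<lambda>x. x *\<^sub>R (g t - d t))) (at t within UNIV)" for t
      using has_vector_derivative_diff[OF P(3) \<gamma>(1)] by (simp add: has_vector_derivative_def)
    show "onorm (\<lambda>x. x *\<^sub>R (g t - d t)) \<le> e / 2" for t
    proof (rule onorm_bound)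
      fix x :: real
      have "\<bar>x\<bar> * norm (g t - d t) \<le> \<bar>x\<bar> * (e / 2)"
        using g(3)[of t] by (intro mult_left_mono) auto
      then show "norm (x *\<^sub>R (g t - d t)) \<le> e / 2 * norm x" by (simp add: mult.commute)
    qed (use e in simp)
  qed auto
  then have M: "norm M \<le> e / 2" using P(2) \<gamma>(3)[of 0] by (simp add: M_def divide_simps mult.commute)
  define \<gamma>1 where "\<gamma>1 t = P t - t *\<^sub>R M" for t
  define d1 where "d1 t = g t - M" for t
  have D: "(\<gamma>1 has_vector_derivative d1 t) (at t)" for t
    unfolding \<gamma>1_def d1_def
    by (auto intro!: derivative_eq_intros P(3) simp: has_vector_derivative_diff)
  show ?thesis
  proof
    show "analytic_curve \<gamma>1" unfolding \<gamma>1_def by (intro analytic_curve_diff P(1) analytic_curve_scaleR analytic_ident analytic_curve_const)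
    show "analytic_curve d1" unfolding d1_def by (intro analytic_curve_diff g(1) analytic_curve_const)
    show "(\<gamma>1 has_vector_derivative d1 t) (at t)" for t by (rule D)
    show "\<gamma>1 (t + pi) = \<gamma>1 t" for t
    proof -
      have "((\<lambda>t. \<gamma>1 (t + pi) - \<gamma>1 t) has_vector_derivative 0) (at t)" for t
        using has_vector_derivative_diff[OF has_vector_derivative_shift_real[OF D] D, of pi t]
        by (simp add: d1_def g(2))
      from has_vector_derivative_zero_imp_const[OF this, of t 0]
      show ?thesis by (simp add: \<gamma>1_def P(2) M_def)
    qed
    show "norm (d1 t - d t) < e" for t
      using norm_triangle_ineq4[of "g t - d t" M] g(3)[of t] M by (simp add: d1_def algebra_simps)
  qed
qed

section \<open>The unit normal component of a vector (Gram-Schmidt)\<close>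

definition unit_normal :: "real^3 \<Rightarrow> real^3 \<Rightarrow> real^3" where
  "unit_normal x y = (let z = y - ((x \<bullet> y) / (x \<bullet> x)) *\<^sub>R x in z /\<^sub>R norm z)"

lemma normal_part_nonzero:
  assumes "cross3 x y \<noteq> 0"
  shows "y - ((x \<bullet> y) / (x \<bullet> x)) *\<^sub>R x \<noteq> 0" "x \<noteq> 0"
proof -
  show "y - ((x \<bullet> y) / (x \<bullet> x)) *\<^sub>R x \<noteq> 0"
  proof
    assume "y - ((x \<bullet> y) / (x \<bullet> x)) *\<^sub>R x = 0"
    then have y: "y = ((x \<bullet> y) / (x \<bullet> x)) *\<^sub>R x" by simp
    have "cross3 x y = ((x \<bullet> y) / (x \<bullet> x)) *\<^sub>R cross3 x x" by (subst y) (rule cross_mult_right)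
    then show False using assms by simp
  qed
  show "x \<noteq> 0" using assms by auto
qed

text \<open>The positive factor in the last clause keeps the normalised vector on the same side of x
  as y. This later rules out cancellation when the two vectors are interpolated.\<close>

lemma unit_normal:
  assumes "cross3 x y \<noteq> 0"
  shows "norm (unit_normal x y) = 1" "x \<bullet> unit_normal x y = 0"
    "\<exists>k>0. cross3 x (unit_normal x y) = k *\<^sub>R cross3 x y"
proof -
  let ?z = "y - ((x \<bullet> y) / (x \<bullet> x)) *\<^sub>R x"
  note nz = normal_part_nonzero[OF assms]
  show "norm (unit_normal x y) = 1" using nz by (simp add: unit_normal_def Let_def)
  show "x \<bullet> unit_normal x y = 0" using nz by (simp add: unit_normal_def Let_def inner_diff_right)
  have "cross3 x (unit_normal x y) = inverse (norm ?z) *\<^sub>R cross3 x y"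
    by (simp add: unit_normal_def Let_def cross_mult_right right_diff_distrib cross3_def vec_eq_iff forall_3 algebra_simps)
  then show "\<exists>k>0. cross3 x (unit_normal x y) = k *\<^sub>R cross3 x y"
    using nz by (intro exI[of _ "inverse (norm ?z)"]) auto
qed

lemma unit_normal_minus: "unit_normal x (- y) = - unit_normal x y"
proof -
  have "- y - ((x \<bullet> - y) / (x \<bullet> x)) *\<^sub>R x = - (y - ((x \<bullet> y) / (x \<bullet> x)) *\<^sub>R x)" by simp
  then show ?thesis unfolding unit_normal_def Let_def by (simp only: norm_minus_cancel scaleR_minus_right)
qed

lemma continuous_on_unit_normal:
  "continuous_on {z. cross3 (fst z) (snd z) \<noteq> 0} (\<lambda>z. unit_normal (fst z) (snd z))"
  unfolding unit_normal_def Let_def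
  by (intro continuous_intros) (use normal_part_nonzero in auto)

lemma analytic_norm: "analytic_curve f \<Longrightarrow> (\<And>t. f t \<noteq> 0) \<Longrightarrow> analytic (\<lambda>t. norm (f t))"
  unfolding norm_eq_sqrt_inner by (intro analytic_sqrt analytic_inner) auto

lemma analytic_curve_unit_normal:
  assumes "analytic_curve f" "analytic_curve g" "\<And>t. cross3 (f t) (g t) \<noteq> 0"
  shows "analytic_curve (\<lambda>t. unit_normal (f t) (g t))"
  unfolding unit_normal_def Let_def
  using normal_part_nonzero[OF assms(3)] assms(1,2)
  by (intro analytic_curve_scaleR analytic_inverse analytic_norm analytic_curve_diff analytic_divide analytic_inner) auto

section \<open>Parallel normal fields\<close>

lemma bounded_bilinear_cross3: "bounded_bilinear cross3"
  using bilinear_cross bilinear_conv_bounded_bilinear by blast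

text \<open>Applied to the vectors of an orthonormal frame, this is the skew symmetry of the frame
  equations.\<close>

lemma inner_derivative_of_constant_inner:
  fixes f g :: "real \<Rightarrow> 'a::real_inner"
  assumes "(f has_vector_derivative f') (at t)" "(g has_vector_derivative g') (at t)" "\<And>t. f t \<bullet> g t = c"
  shows "f t \<bullet> g' + f' \<bullet> g t = 0"
proof -
  have "((\<lambda>t. f t \<bullet> g t) has_vector_derivative f t \<bullet> g' + f' \<bullet> g t) (at t)"
    using bounded_bilinear.has_vector_derivative[OF bounded_bilinear_inner assms(1,2)] .
  moreover have "((\<lambda>t. f t \<bullet> g t) has_vector_derivative 0) (at t)"
    using assms(3) by simp
  ultimately show ?thesis by (rule vector_derivative_unique_at)
qed

text \<open>Rotating an orthonormal normal frame \<open>(f1, f2)\<close> against its own torsion \<open>f1' \<bullet> f2\<close> makes it parallel.\<close>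

lemma parallel_normal_field:
  fixes f0 f1 :: "real \<Rightarrow> real^3"
  assumes on: "\<And>t. f0 t \<bullet> f0 t = 1" "\<And>t. f1 t \<bullet> f1 t = 1" "\<And>t. f0 t \<bullet> f1 t = 0"
    and d0: "(f0 has_vector_derivative f0') (at t)" and d1: "(f1 has_vector_derivative f1') (at t)"
    and \<phi>: "(\<phi> has_real_derivative - (f1' \<bullet> cross3 (f0 t) (f1 t))) (at t)"
  defines "\<xi> \<equiv> \<lambda>t. cos (\<phi> t) *\<^sub>R f1 t + sin (\<phi> t) *\<^sub>R cross3 (f0 t) (f1 t)"
  obtains \<xi>' where "(\<xi> has_vector_derivative \<xi>') (at t)" "cross3 (f0 t) (\<xi> t) \<bullet> \<xi>' = 0"
    "f0 t \<bullet> \<xi> t = 0"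
proof -
  define f2 where "f2 t = cross3 (f0 t) (f1 t)" for t
  define f2' where "f2' = cross3 (f0 t) f1' + cross3 f0' (f1 t)"
  have d2: "(f2 has_vector_derivative f2') (at t)"
    unfolding f2_def f2'_def
    by (rule bounded_bilinear.has_vector_derivative[OF bounded_bilinear_cross3 d0 d1])
  have on2: "f0 t \<bullet> f2 t = 0" "f1 t \<bullet> f2 t = 0" "f2 t \<bullet> f2 t = 1" for t
  proof -
    show "f0 t \<bullet> f2 t = 0" "f1 t \<bullet> f2 t = 0" by (simp_all add: f2_def dot_cross_self)
    have "norm (f0 t) = 1" "norm (f1 t) = 1" by (simp_all add: norm_eq_sqrt_inner on)
    then have "(norm (f2 t))\<^sup>2 = 1"
      using norm_cross_dot[of "f0 t" "f1 t"] on(3)[of t] by (simp add: f2_def)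
    then show "f2 t \<bullet> f2 t = 1" by (simp only: dot_square_norm)
  qed
  have c02: "cross3 (f0 t) (f2 t) = - f1 t"
    using Lagrange[of "f0 t" "f0 t" "f1 t"] on by (simp add: f2_def)
  have i1: "f1 t \<bullet> f1' = 0"
    using inner_derivative_of_constant_inner[OF d1 d1 on(2)] by (simp add: inner_commute)
  have i2: "f2 t \<bullet> f2' = 0"
    using inner_derivative_of_constant_inner[OF d2 d2 on2(3)] by (simp add: inner_commute)
  have i12: "f1 t \<bullet> f2' = - (f1' \<bullet> f2 t)"
    using inner_derivative_of_constant_inner[OF d1 d2 on2(2)] by simp
  define w where "w = f1' \<bullet> f2 t"
  define \<xi>' where "\<xi>' = (cos (\<phi> t) *\<^sub>R f1' + (sin (\<phi> t) * w) *\<^sub>R f1 t)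
     + (sin (\<phi> t) *\<^sub>R f2' - (cos (\<phi> t) * w) *\<^sub>R f2 t)"
  have \<xi>_eq: "\<xi> = (\<lambda>t. cos (\<phi> t) *\<^sub>R f1 t + sin (\<phi> t) *\<^sub>R f2 t)" by (simp add: \<xi>_def f2_def)
  have p: "(\<phi> has_real_derivative - w) (at t)" using \<phi> by (simp add: w_def f2_def)
  have "((\<lambda>t. cos (\<phi> t)) has_real_derivative sin (\<phi> t) * w) (at t)"
    "((\<lambda>t. sin (\<phi> t)) has_real_derivative - (cos (\<phi> t) * w)) (at t)"
    using p by (auto intro!: derivative_eq_intros)
  then have "(\<xi> has_vector_derivative \<xi>') (at t)"
    unfolding \<xi>_eq \<xi>'_def
    using has_vector_derivative_add[OF has_vector_derivative_scaleR[OF _ d1] has_vector_derivative_scaleR[OF _ d2]]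
    by fastforce
  moreover have "cross3 (f0 t) (\<xi> t) \<bullet> \<xi>' = 0"
  proof -
    have eq: "cross3 (f0 t) (\<xi> t) = cos (\<phi> t) *\<^sub>R f2 t - sin (\<phi> t) *\<^sub>R f1 t"
      by (simp add: \<xi>_eq cross_add_right cross_mult_right c02) (simp add: f2_def)
    have w2: "f2 t \<bullet> f1' = w" by (simp add: w_def inner_commute)
    show ?thesis
      unfolding eq \<xi>'_def using on2(2)[of t] on2(3)[of t] on(2)[of t] i1 i2 i12
      by (simp add: inner_add_right inner_diff_right inner_diff_left inner_commute[of "f2 t" "f1 t"] w2
          w_def[symmetric])
  qed
  moreover have "f0 t \<bullet> \<xi> t = 0"
    by (simp add: \<xi>_eq inner_add_right on(3) on2)
  ultimately show ?thesis by (rule that)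
qed

text \<open>Replaces explicit estimates for the helix: its errors extend continuously to h = 0 and
  vanish there, hence they are small uniformly in the remaining parameters.\<close>

lemma compact_limit_uniform:
  fixes f :: "real \<times> 'k::metric_space \<Rightarrow> real"
  assumes "compact K" "0 < a" "continuous_on ({0..a} \<times> K) f" "\<And>k. k \<in> K \<Longrightarrow> f (0, k) = 0" "0 < e"
  obtains d where "0 < d" "d \<le> a" "\<And>h k. \<lbrakk>0 \<le> h; h \<le> d; k \<in> K\<rbrakk> \<Longrightarrow> \<bar>f (h, k)\<bar> < e"
proof -
  have "uniformly_continuous_on ({0..a} \<times> K) f"
    using assms by (intro compact_uniformly_continuous compact_Times) auto
  then obtain d where d: "d > 0" "\<And>x y. \<lbrakk>x \<in> {0..a} \<times> K; y \<in> {0..a} \<times> K; dist y x < d\<rbrakk> \<Longrightarrow> dist (f y) (f x) < e"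
    unfolding uniformly_continuous_on_def using assms(5) by metis
  show ?thesis
  proof (rule that[of "min a (d / 2)"])
    fix h k assume h: "0 \<le> h" "h \<le> min a (d / 2)" "k \<in> K"
    have "dist (h, k) (0, k) < d" using h d(1) by (simp add: dist_Pair_Pair dist_real_def)
    then have "dist (f (h, k)) (f (0, k)) < e" using d(2)[of "(0, k)" "(h, k)"] h assms(2) by auto
    then show "\<bar>f (h, k)\<bar> < e" using assms(4)[OF h(3)] by (simp add: dist_real_def)
  qed (use d assms(2) in auto)
qed

section \<open>Helices along a framed curve\<close>

text \<open>T will be the unit tangent and v the speed of the curve, so derivatives are taken in the
  given parameter and not in arc length; m is the torsion of the normal frame (e1, e2). The sign
  changes of e1 and e2, and with them of k1 and k2, after a shift by pi are the Moebius
  twist.\<close>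

locale moving_frame =
  fixes T e1 e2 :: "real \<Rightarrow> real^3" and v m k1 k2 :: "real \<Rightarrow> real"
  assumes orthonormal: "\<And>t. T t \<bullet> T t = 1" "\<And>t. e1 t \<bullet> e1 t = 1" "\<And>t. e2 t \<bullet> e2 t = 1"
      "\<And>t. T t \<bullet> e1 t = 0" "\<And>t. T t \<bullet> e2 t = 0" "\<And>t. e1 t \<bullet> e2 t = 0"
    and crosses: "\<And>t. cross3 (T t) (e1 t) = e2 t" "\<And>t. cross3 (e1 t) (e2 t) = T t"
      "\<And>t. cross3 (e2 t) (T t) = e1 t"
    and frame_derivatives: "\<And>t. (T has_vector_derivative k1 t *\<^sub>R e1 t + k2 t *\<^sub>R e2 t) (at t)"
      "\<And>t. (e1 has_vector_derivative - k1 t *\<^sub>R T t + m t *\<^sub>R e2 t) (at t)"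
      "\<And>t. (e2 has_vector_derivative - k2 t *\<^sub>R T t - m t *\<^sub>R e1 t) (at t)"
    and frame_analytic: "analytic_curve T" "analytic_curve e1" "analytic_curve e2"
    and coefficients_analytic: "analytic v" "analytic m" "analytic k1" "analytic k2"
    and v_pos: "\<And>t. 0 < v t"
    and periodic: "\<And>t. T (t + pi) = T t" "\<And>t. e1 (t + pi) = - e1 t" "\<And>t. e2 (t + pi) = - e2 t"
      "\<And>t. v (t + pi) = v t" "\<And>t. m (t + pi) = m t" "\<And>t. k1 (t + pi) = - k1 t" "\<And>t. k2 (t + pi) = - k2 t"
begin

lemma frame_combination_derivative:
  assumes "(x has_real_derivative x') (at t)" "(y has_real_derivative y') (at t)" "(z has_real_derivative z') (at t)"
  shows "((\<lambda>t. x t *\<^sub>R T t + y t *\<^sub>R e1 t + z t *\<^sub>R e2 t) has_vector_derivative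
    (x' - y t * k1 t - z t * k2 t) *\<^sub>R T t + (y' + x t * k1 t - z t * m t) *\<^sub>R e1 t
      + (z' + x t * k2 t + y t * m t) *\<^sub>R e2 t) (at t)"
proof -
  have "((\<lambda>t. x t *\<^sub>R T t + y t *\<^sub>R e1 t + z t *\<^sub>R e2 t) has_vector_derivative
     (x t *\<^sub>R (k1 t *\<^sub>R e1 t + k2 t *\<^sub>R e2 t) + x' *\<^sub>R T t) + (y t *\<^sub>R (- k1 t *\<^sub>R T t + m t *\<^sub>R e2 t) + y' *\<^sub>R e1 t)
      + (z t *\<^sub>R (- k2 t *\<^sub>R T t - m t *\<^sub>R e1 t) + z' *\<^sub>R e2 t)) (at t)"
    by (intro has_vector_derivative_add has_vector_derivative_scaleR assms frame_derivatives)
  then show ?thesis by (simp add: algebra_simps)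
qed

lemma frame_inner:
  "(x *\<^sub>R T t + y *\<^sub>R e1 t + z *\<^sub>R e2 t) \<bullet> (x' *\<^sub>R T t + y' *\<^sub>R e1 t + z' *\<^sub>R e2 t) = x * x' + y * y' + z * z'"
  by (simp add: inner_add_left inner_add_right orthonormal inner_commute[of "e1 t" "T t"]
      inner_commute[of "e2 t" "T t"] inner_commute[of "e2 t" "e1 t"])

lemma frame_cross:
  "cross3 (x *\<^sub>R T t + y *\<^sub>R e1 t + z *\<^sub>R e2 t) (x' *\<^sub>R T t + y' *\<^sub>R e1 t + z' *\<^sub>R e2 t) =
    (y * z' - z * y') *\<^sub>R T t + (z * x' - x * z') *\<^sub>R e1 t + (x * y' - y * x') *\<^sub>R e2 t"
  by (simp add: cross_add_left cross_add_right cross_mult_left cross_mult_right crosses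
      cross_skew[of "e1 t" "T t"] cross_skew[of "T t" "e2 t"] cross_skew[of "e2 t" "e1 t"] algebra_simps)

lemma frame_norm:
  "norm (x *\<^sub>R T t + y *\<^sub>R e1 t + z *\<^sub>R e2 t) = sqrt (x\<^sup>2 + y\<^sup>2 + z\<^sup>2)"
  by (simp add: norm_eq_sqrt_inner frame_inner power2_eq_square)

lemma frame_norm_le: "norm (x *\<^sub>R T t + y *\<^sub>R e1 t + z *\<^sub>R e2 t) \<le> \<bar>x\<bar> + \<bar>y\<bar> + \<bar>z\<bar>"
  using orthonormal
  by (intro norm_triangle_le add_mono) (auto simp: norm_eq_sqrt_inner)

abbreviation "v1 \<equiv> deriv v"
abbreviation "v2 \<equiv> deriv (deriv v)"
abbreviation "m1 \<equiv> deriv m"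
abbreviation "k11 \<equiv> deriv k1"
abbreviation "k21 \<equiv> deriv k2"

lemmas coefficient_derivatives =
  analytic_deriv(1)[OF coefficients_analytic(1)] analytic_deriv(1)[OF analytic_deriv(2)[OF coefficients_analytic(1)]]
  analytic_deriv(1)[OF coefficients_analytic(2)] analytic_deriv(1)[OF coefficients_analytic(3)]
  analytic_deriv(1)[OF coefficients_analytic(4)]

lemmas all_analytic = coefficients_analytic
  analytic_deriv(2)[OF coefficients_analytic(1)] analytic_deriv(2)[OF analytic_deriv(2)[OF coefficients_analytic(1)]]
  analytic_deriv(2)[OF coefficients_analytic(2)] analytic_deriv(2)[OF coefficients_analytic(3)]
  analytic_deriv(2)[OF coefficients_analytic(4)]

text \<open>The helix is \<open>\<gamma> + h\<^sup>3 v cos (N t) e1 + h\<^sup>3 B sin (N t) e2\<close> with \<open>N h\<^sup>2 = 1\<close>. Its velocity is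
  \<open>R T + h P e1 + h Q e2\<close>; further, \<open>(h P)' = P1 / h\<close>, \<open>R' = R1\<close>, and \<open>W\<close> is the torsion of the normal
  frame whose first vector is proportional to \<open>R e1 - h P T\<close>. As functions of \<open>h\<close>, of \<open>c = cos (N t)\<close>,
  \<open>s = sin (N t)\<close>, of \<open>t\<close> and of \<open>l\<close> all of them remain continuous at \<open>h = 0\<close>.\<close>

definition B where "B t l = 2 * v t * (m t + l)"
definition B1 where "B1 t l = 2 * (v1 t * (m t + l) + v t * m1 t)"
definition P where "P h c s t l = - v t * s + h\<^sup>2 * (v1 t * c - B t l * m t * s)"
definition Q where "Q h c s t l = B t l * c + h\<^sup>2 * (B1 t l * s + v t * m t * c)"
definition R where "R h c s t l = v t - h ^ 3 * (v t * k1 t * c + B t l * k2 t * s)"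
definition P1 where "P1 h c s t l = - v t * c - h\<^sup>2 * v1 t * s + h\<^sup>2 * (h\<^sup>2 * v2 t * c - v1 t * s
   - h\<^sup>2 * (B1 t l * m t + B t l * m1 t) * s - B t l * m t * c)"
definition R1 where "R1 h c s t l = v1 t - h ^ 3 * ((v1 t * k1 t + v t * k11 t) * c + (B1 t l * k2 t + B t l * k21 t) * s)
   - h * (- v t * k1 t * s + B t l * k2 t * c)"
definition W where "W h c s t l =
   (Q h c s t l * (R h c s t l * P1 h c s t l - h\<^sup>2 * P h c s t l * R1 h c s t l)
       / ((R h c s t l)\<^sup>2 + h\<^sup>2 * (P h c s t l)\<^sup>2)
     + h * Q h c s t l * k1 t + R h c s t l * m t - h * P h c s t l * k2 t)
   / sqrt ((R h c s t l)\<^sup>2 + h\<^sup>2 * ((P h c s t l)\<^sup>2 + (Q h c s t l)\<^sup>2))"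

text \<open>For c = cos (N t) the factor 2 c^2 - 1 = cos (2 N t) oscillates about zero, so the
  limiting torsion has mean - l. The factor 2 in B makes up for the mean 1/2 of c^2.\<close>

lemma W_0: "W 0 c s t l = - l - (m t + l) * (2 * c\<^sup>2 - 1)"
proof -
  have "(B t l * c * (v t * (- (v t * c))) / (v t)\<^sup>2 + v t * m t) / v t = m t - 2 * (m t + l) * c\<^sup>2"
    using v_pos[of t] by (simp add: B_def field_simps power2_eq_square)
  then show ?thesis using v_pos[of t] by (simp add: W_def P_def Q_def R_def P1_def algebra_simps)
qed

lemma B_derivative: "((\<lambda>t. B t l) has_real_derivative B1 t l) (at t)"
  unfolding B_def B1_def
  by (auto intro!: derivative_eq_intros coefficient_derivatives simp: algebra_simps)

lemma B_analytic: "analytic (\<lambda>t. B t l)" "analytic (\<lambda>t. B1 t l)"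
  unfolding B_def B1_def by (intro analytic_add analytic_mult all_analytic analytic_const)+

context
  fixes h N l :: real
  assumes h: "h > 0" and N: "N * h\<^sup>2 = 1"
begin

definition p where "p t = h * P h (cos (N * t)) (sin (N * t)) t l"
definition q where "q t = h * Q h (cos (N * t)) (sin (N * t)) t l"
definition r where "r t = R h (cos (N * t)) (sin (N * t)) t l"

lemma N_eq: "N = inverse (h\<^sup>2)"
  using h N by (simp add: field_simps)

text \<open>Differentiating the oscillation costs a factor N = 1 / h^2, of which the factor h in p
  absorbs only a part. The remaining 1 / h is compensated in the torsion by the factor h of
  q.\<close>

lemma p_derivative: "(p has_real_derivative P1 h (cos (N * t)) (sin (N * t)) t l / h) (at t)"
  unfolding p_def[abs_def] P_def P1_def
  by (rule derivative_eq_intros coefficient_derivatives B_derivative refl)+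
    (use h in \<open>simp add: N_eq power2_eq_square power3_eq_cube field_simps\<close>)

lemma r_derivative: "(r has_real_derivative R1 h (cos (N * t)) (sin (N * t)) t l) (at t)"
  unfolding r_def[abs_def] R_def R1_def
  by (rule derivative_eq_intros coefficient_derivatives B_derivative refl)+
    (use h in \<open>simp add: N_eq power2_eq_square power3_eq_cube field_simps\<close>)

lemma pqr_analytic: "analytic p" "analytic q" "analytic r"
  unfolding p_def[abs_def] P_def q_def[abs_def] Q_def r_def[abs_def] R_def
  by (intro analytic_add analytic_diff analytic_minus analytic_mult analytic_power analytic_cos analytic_sin all_analytic analytic_const analytic_ident B_analytic)+

definition velocity where "velocity t = r t *\<^sub>R T t + p t *\<^sub>R e1 t + q t *\<^sub>R e2 t"
definition helix where "helix \<gamma> t = \<gamma> t + (h ^ 3 * v t * cos (N * t)) *\<^sub>R e1 t + (h ^ 3 * B t l * sin (N * t)) *\<^sub>R e2 t"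
text \<open>Orthogonal to \<open>velocity\<close> and without e2 component, hence nearly a multiple
  of e1 for small h. The zero summand keeps the shape to which \<open>frame_norm\<close> and
  \<open>frame_cross\<close> apply.\<close>

definition normal where "normal t = (- p t) *\<^sub>R T t + r t *\<^sub>R e1 t + 0 *\<^sub>R e2 t"

lemma velocity_analytic: "analytic_curve velocity"
  unfolding velocity_def[abs_def] by (intro analytic_curve_add analytic_curve_scaleR pqr_analytic frame_analytic)

lemma helix_analytic: "analytic_curve \<gamma> \<Longrightarrow> analytic_curve (helix \<gamma>)"
  unfolding helix_def[abs_def]
  by (intro analytic_curve_add analytic_curve_scaleR frame_analytic analytic_mult analytic_power analytic_cos analytic_sin all_analytic analytic_const analytic_ident B_analytic)

lemma helix_derivative:
  assumes "(\<gamma> has_vector_derivative v t *\<^sub>R T t) (at t)"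
  shows "(helix \<gamma> has_vector_derivative velocity t) (at t)"
proof -
  let ?y' = "h ^ 3 * (v1 t * cos (N * t)) - h * (v t * sin (N * t))"
  let ?z' = "h ^ 3 * (B1 t l * sin (N * t)) + h * (B t l * cos (N * t))"
  have x: "((\<lambda>t. 0) has_real_derivative 0) (at t)" by simp
  have y: "((\<lambda>t. h ^ 3 * v t * cos (N * t)) has_real_derivative ?y') (at t)"
    by (rule derivative_eq_intros coefficient_derivatives refl)+
      (use h in \<open>simp add: N_eq power2_eq_square power3_eq_cube field_simps\<close>)
  have z: "((\<lambda>t. h ^ 3 * B t l * sin (N * t)) has_real_derivative ?z') (at t)"
    by (rule derivative_eq_intros B_derivative refl)+
      (use h in \<open>simp add: N_eq power2_eq_square power3_eq_cube field_simps\<close>)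
  let ?y = "h ^ 3 * v t * cos (N * t)" and ?z = "h ^ 3 * B t l * sin (N * t)"
  have "(helix \<gamma> has_vector_derivative v t *\<^sub>R T t + ((0 - ?y * k1 t - ?z * k2 t) *\<^sub>R T t +
      (?y' + 0 * k1 t - ?z * m t) *\<^sub>R e1 t + (?z' + 0 * k2 t + ?y * m t) *\<^sub>R e2 t)) (at t)"
    using has_vector_derivative_add[OF assms frame_combination_derivative[OF x y z]]
    by (simp add: helix_def[abs_def] add.assoc)
  also have "v t *\<^sub>R T t + ((0 - ?y * k1 t - ?z * k2 t) *\<^sub>R T t +
      (?y' + 0 * k1 t - ?z * m t) *\<^sub>R e1 t + (?z' + 0 * k2 t + ?y * m t) *\<^sub>R e2 t) =
      (v t - ?y * k1 t - ?z * k2 t) *\<^sub>R T t + (?y' - ?z * m t) *\<^sub>R e1 t + (?z' + ?y * m t) *\<^sub>R e2 t"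
    by (simp add: scaleR_diff_left)
  also have "v t - ?y * k1 t - ?z * k2 t = r t" by (simp add: r_def R_def algebra_simps)
  also have "?y' - ?z * m t = p t" by (simp add: p_def P_def power2_eq_square power3_eq_cube algebra_simps)
  also have "?z' + ?y * m t = q t" by (simp add: q_def Q_def power2_eq_square power3_eq_cube algebra_simps)
  finally show ?thesis by (simp add: velocity_def)
qed

lemma velocity_inner_normal: "velocity t \<bullet> normal t = 0"
  unfolding velocity_def normal_def frame_inner by simp

lemma normal_derivative:
  "(normal has_vector_derivative (- (P1 h (cos (N * t)) (sin (N * t)) t l / h) - r t * k1 t) *\<^sub>R T t
     + (R1 h (cos (N * t)) (sin (N * t)) t l - p t * k1 t) *\<^sub>R e1 t + (r t * m t - p t * k2 t) *\<^sub>R e2 t) (at t)"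
proof -
  have z: "((\<lambda>t. 0) has_real_derivative 0) (at t)" by simp
  from frame_combination_derivative[OF DERIV_minus[OF p_derivative] r_derivative z]
  show ?thesis by (simp add: normal_def[abs_def] algebra_simps)
qed

definition torsion where "torsion t = W h (cos (N * t)) (sin (N * t)) t l"

text \<open>This is \<open>parallel_normal_field\<close> for the frame that starts with the
  normalised \<open>normal\<close>; the work consists in identifying the torsion of that frame with
  \<open>W\<close>. The last clause admits any derivative \<xi>' because
  \<open>parallel_strip\<close> asks for it in this form.\<close>

lemma parallel_field_along_helix:
  assumes r: "\<And>t. 0 < r t" and \<phi>: "analytic \<phi>" "\<And>t. (\<phi> has_real_derivative - torsion t) (at t)"
  defines "f0 \<equiv> \<lambda>t. velocity t /\<^sub>R norm (velocity t)" and "f1 \<equiv> \<lambda>t. normal t /\<^sub>R norm (normal t)"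
  defines "\<xi> \<equiv> \<lambda>t. cos (\<phi> t) *\<^sub>R f1 t + sin (\<phi> t) *\<^sub>R cross3 (f0 t) (f1 t)"
  shows "analytic_curve \<xi>" "velocity t \<bullet> \<xi> t = 0"
    "(\<xi> has_vector_derivative \<xi>') (at t) \<Longrightarrow> cross3 (velocity t) (\<xi> t) \<bullet> \<xi>' = 0"
proof -
  define G where "G t = inverse (norm (normal t))" for t
  have nv: "norm (velocity t) = sqrt ((r t)\<^sup>2 + (p t)\<^sup>2 + (q t)\<^sup>2)" for t
    unfolding velocity_def by (rule frame_norm)
  have nn: "norm (normal t) = sqrt ((r t)\<^sup>2 + (p t)\<^sup>2)" for t
    unfolding normal_def frame_norm by (simp add: add.commute)
  have pos: "0 < norm (velocity t)" "0 < norm (normal t)" for t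
    using r[of t] by (simp_all add: nv nn add_pos_nonneg)
  have nz: "velocity t \<noteq> 0" "normal t \<noteq> 0" for t using pos[of t] by auto
  have aN: "analytic_curve normal" unfolding normal_def[abs_def]
    by (intro analytic_curve_add analytic_curve_scaleR pqr_analytic frame_analytic analytic_minus analytic_const)
  have aG: "analytic G" unfolding G_def[abs_def] by (intro analytic_inverse analytic_norm aN) (use nz in auto)
  have a0: "analytic_curve f0" unfolding f0_def
    by (intro analytic_curve_scaleR analytic_inverse analytic_norm velocity_analytic) (use nz in auto)
  have a1: "analytic_curve f1" unfolding f1_def
    by (intro analytic_curve_scaleR analytic_inverse analytic_norm aN) (use nz in auto)
  show \<xi>: "analytic_curve \<xi>" unfolding \<xi>_def by (intro analytic_curve_add analytic_curve_scaleR analytic_cos analytic_sin analytic_curve_cross3 a0 a1 \<phi>)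
  have on: "f0 t \<bullet> f0 t = 1" "f1 t \<bullet> f1 t = 1" "f0 t \<bullet> f1 t = 0" for t
    using nz[of t] velocity_inner_normal[of t] by (auto simp: f0_def f1_def dot_square_norm power2_eq_square field_simps)
  obtain f0' where f0': "\<And>t. (f0 has_vector_derivative f0' t) (at t)"
    using analytic_curve_derivative[OF a0] by blast
  define X' where "X' = (- (P1 h (cos (N * t)) (sin (N * t)) t l / h) - r t * k1 t) *\<^sub>R T t
     + (R1 h (cos (N * t)) (sin (N * t)) t l - p t * k1 t) *\<^sub>R e1 t + (r t * m t - p t * k2 t) *\<^sub>R e2 t"
  \<comment> \<open>The derivative of the normalising factor G contributes a multiple of
    \<open>normal\<close>, which is orthogonal to the cross product below; only X' enters the
    torsion.\<close>
  define f1' where "f1' = G t *\<^sub>R X' + deriv G t *\<^sub>R normal t"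
  have f1': "(f1 has_vector_derivative f1') (at t)"
    using has_vector_derivative_scaleR[OF analytic_deriv(1)[OF aG, of t] normal_derivative[of t]]
    by (simp add: f1_def G_def[abs_def] X'_def f1'_def)
  have "f1' \<bullet> cross3 (f0 t) (f1 t) = (X' \<bullet> cross3 (velocity t) (normal t)) / (norm (velocity t) * (norm (normal t))\<^sup>2)"
    using nz[of t]
    by (simp add: f0_def f1_def f1'_def inner_add_left cross_mult_left cross_mult_right dot_cross_self G_def
        power2_eq_square field_simps)
  also have "\<dots> = torsion t"
  proof -
    define pp where "pp = P h (cos (N * t)) (sin (N * t)) t l"
    define qq where "qq = Q h (cos (N * t)) (sin (N * t)) t l"
    define P1' where "P1' = P1 h (cos (N * t)) (sin (N * t)) t l"
    define R1' where "R1' = R1 h (cos (N * t)) (sin (N * t)) t l"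
    have pq: "p t = h * pp" "q t = h * qq" by (simp_all add: p_def q_def pp_def qq_def)
    have cr: "cross3 (velocity t) (normal t) = (- q t * r t) *\<^sub>R T t + (- q t * p t) *\<^sub>R e1 t + ((r t)\<^sup>2 + (p t)\<^sup>2) *\<^sub>R e2 t"
      unfolding velocity_def normal_def frame_cross by (simp add: power2_eq_square)
    have "X' \<bullet> cross3 (velocity t) (normal t) =
        q t * (r t * (P1' / h) - p t * R1') + ((r t)\<^sup>2 + (p t)\<^sup>2) * (q t * k1 t + r t * m t - p t * k2 t)"
      unfolding cr X'_def frame_inner P1'_def R1'_def by (simp add: algebra_simps power2_eq_square)
    \<comment> \<open>The factor h of q cancels the 1 / h in the derivative of p. This keeps the
      torsion bounded as h tends to 0.\<close>
    also have "\<dots> = qq * (r t * P1' - h\<^sup>2 * pp * R1') + ((r t)\<^sup>2 + (p t)\<^sup>2) * (q t * k1 t + r t * m t - p t * k2 t)"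
      using h by (simp add: pq power2_eq_square field_simps)
    finally have 1: "X' \<bullet> cross3 (velocity t) (normal t) = \<dots>" .
    have D: "0 < (r t)\<^sup>2 + (p t)\<^sup>2" using r[of t] by (simp add: add_pos_nonneg)
    have E: "(norm (normal t))\<^sup>2 = (r t)\<^sup>2 + (p t)\<^sup>2" by (simp add: nn)
    have F: "norm (velocity t) = sqrt ((r t)\<^sup>2 + h\<^sup>2 * (pp\<^sup>2 + qq\<^sup>2))"
      unfolding nv pq by (simp add: power_mult_distrib algebra_simps)
    have "torsion t = (qq * (r t * P1' - h\<^sup>2 * pp * R1') / ((r t)\<^sup>2 + (p t)\<^sup>2)
        + (q t * k1 t + r t * m t - p t * k2 t)) / norm (velocity t)"
      unfolding F by (simp add: torsion_def W_def pp_def[symmetric] qq_def[symmetric] r_def[symmetric]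
        P1'_def[symmetric] R1'_def[symmetric] pq power_mult_distrib algebra_simps)
    moreover have "(a + d * k) / (n * d) = (a / d + k) / n" if "0 < d" "0 < n" for a d k n :: real
      using that by (simp add: field_simps)
    ultimately show ?thesis unfolding 1 E using D pos(1)[of t] by metis
  qed
  finally have tor: "f1' \<bullet> cross3 (f0 t) (f1 t) = torsion t" .
  have "(\<phi> has_real_derivative - (f1' \<bullet> cross3 (f0 t) (f1 t))) (at t)"
    unfolding tor by (rule \<phi>(2))
  from parallel_normal_field[of f0 f1, OF on f0' f1' this]
  obtain \<xi>'' where 2: "(\<xi> has_vector_derivative \<xi>'') (at t)" "cross3 (f0 t) (\<xi> t) \<bullet> \<xi>'' = 0" "f0 t \<bullet> \<xi> t = 0"
    unfolding \<xi>_def by blast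
  have vf: "velocity t = norm (velocity t) *\<^sub>R f0 t" using nz by (simp add: f0_def)
  show "velocity t \<bullet> \<xi> t = 0" by (subst vf) (simp add: 2(3))
  assume "(\<xi> has_vector_derivative \<xi>') (at t)"
  then have "\<xi>' = \<xi>''" using 2(1) vector_derivative_unique_at by blast
  then show "cross3 (velocity t) (\<xi> t) \<bullet> \<xi>' = 0" by (subst vf) (simp add: 2(2) cross_mult_left)
qed

end

end

section \<open>Closing up the parallel field along the helix\<close>

lemma deriv_half_periodic:
  assumes "analytic f" "\<And>t. f (t + pi) = \<sigma> * f t"
  shows "deriv f (t + pi) = \<sigma> * deriv f t"
proof -
  have "((\<lambda>t. f (t + pi)) has_real_derivative deriv f (t + pi)) (at t)"
    using analytic_deriv(1)[OF assms(1), of "t + pi"] by (simp add: DERIV_shift)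
  moreover have "((\<lambda>t. f (t + pi)) has_real_derivative \<sigma> * deriv f t) (at t)"
    unfolding assms(2) by (rule DERIV_cmult[OF analytic_deriv(1)[OF assms(1)]])
  ultimately show ?thesis by (rule DERIV_unique)
qed

lemma periodic_bound:
  fixes f :: "real \<Rightarrow> real"
  assumes "\<And>t. f (t + pi) = f t" "\<And>t. t \<in> {0..pi} \<Longrightarrow> Pr (f t)"
  shows "Pr (f t)"
proof -
  obtain k :: int where "t + of_int k * pi \<in> {0..0 + pi}" by (rule periodic_shift[OF pi_gt_zero])
  then have "Pr (f (t + of_int k * pi))" by (intro assms(2)) simp
  then show ?thesis using periodic_int[of f pi t k, OF assms(1)] by simp
qed

text \<open>Interface between the helix and the isotopy, with period pi to match the covering. The
  last condition says that the determinant of d, \<xi> and \<xi>' vanishes; quantifying over the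
  derivative avoids one more parameter. No length of \<xi> is prescribed.\<close>

definition parallel_strip :: "(real \<Rightarrow> real^3) \<Rightarrow> (real \<Rightarrow> real^3) \<Rightarrow> (real \<Rightarrow> real^3) \<Rightarrow> bool" where
  "parallel_strip \<gamma> d \<xi> \<longleftrightarrow> analytic_curve \<gamma> \<and> analytic_curve \<xi> \<and> (\<forall>t. (\<gamma> has_vector_derivative d t) (at t)) \<and>
    (\<forall>t. \<gamma> (t + pi) = \<gamma> t) \<and> (\<forall>t. \<xi> (t + pi) = - \<xi> t) \<and> (\<forall>t. d t \<bullet> \<xi> t = 0) \<and>
    (\<forall>t \<xi>'. (\<xi> has_vector_derivative \<xi>') (at t) \<longrightarrow> cross3 (d t) (\<xi> t) \<bullet> \<xi>' = 0)"

lemma parallel_stripD: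
  assumes "parallel_strip \<gamma> d \<xi>"
  shows "analytic_curve \<gamma>" "analytic_curve \<xi>" "(\<gamma> has_vector_derivative d t) (at t)"
    "\<gamma> (t + pi) = \<gamma> t" "\<xi> (t + pi) = - \<xi> t" "d t \<bullet> \<xi> t = 0"
    "(\<xi> has_vector_derivative \<xi>') (at t) \<Longrightarrow> cross3 (d t) (\<xi> t) \<bullet> \<xi>' = 0"
  using assms by (simp_all add: parallel_strip_def)

context moving_frame
begin

lemma derivative_periodic:
  "v1 (t + pi) = v1 t" "v2 (t + pi) = v2 t" "m1 (t + pi) = m1 t" "k11 (t + pi) = - k11 t" "k21 (t + pi) = - k21 t"
proof -
  show 1: "v1 (t + pi) = v1 t" for t
    using deriv_half_periodic[of v 1 t] all_analytic periodic by simp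
  show "v2 (t + pi) = v2 t"
    using deriv_half_periodic[of v1 1 t] all_analytic 1 by simp
  show "m1 (t + pi) = m1 t"
    using deriv_half_periodic[of m 1 t] all_analytic periodic by simp
  show "k11 (t + pi) = - k11 t"
    using deriv_half_periodic[of k1 "-1" t] all_analytic periodic by simp
  show "k21 (t + pi) = - k21 t"
    using deriv_half_periodic[of k2 "-1" t] all_analytic periodic by simp
qed

text \<open>For odd N a shift by pi changes the signs of cos (N t), sin (N t), k1 and k2 at once.
  The velocity components along e1 and e2 then change sign together with these vectors, and the
  torsion is periodic.\<close>

lemma shifted_coefficients:
  "P h (- c) (- s) (t + pi) l = - P h c s t l" "Q h (- c) (- s) (t + pi) l = - Q h c s t l"
  "R h (- c) (- s) (t + pi) l = R h c s t l" "W h (- c) (- s) (t + pi) l = W h c s t l"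
proof -
  have B: "B (t + pi) l = B t l" "B1 (t + pi) l = B1 t l"
    by (simp_all add: B_def B1_def periodic derivative_periodic)
  show P: "P h (- c) (- s) (t + pi) l = - P h c s t l"
    unfolding P_def B periodic derivative_periodic by (simp add: algebra_simps)
  show Q: "Q h (- c) (- s) (t + pi) l = - Q h c s t l"
    unfolding Q_def B periodic derivative_periodic by (simp add: algebra_simps)
  show R: "R h (- c) (- s) (t + pi) l = R h c s t l"
    unfolding R_def B periodic derivative_periodic by (simp add: algebra_simps)
  have P1: "P1 h (- c) (- s) (t + pi) l = - P1 h c s t l"
    unfolding P1_def B periodic derivative_periodic by (simp add: algebra_simps)
  have R1: "R1 h (- c) (- s) (t + pi) l = R1 h c s t l"
    unfolding R1_def B periodic derivative_periodic by (simp add: algebra_simps)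
  show "W h (- c) (- s) (t + pi) l = W h c s t l"
    unfolding W_def P Q R P1 R1 periodic by (simp add: algebra_simps)
qed

lemma coefficient_continuous:
  assumes "continuous_on S g"
  shows "continuous_on S (\<lambda>z. v (g z))" "continuous_on S (\<lambda>z. m (g z))" "continuous_on S (\<lambda>z. k1 (g z))"
    "continuous_on S (\<lambda>z. k2 (g z))" "continuous_on S (\<lambda>z. v1 (g z))" "continuous_on S (\<lambda>z. v2 (g z))"
    "continuous_on S (\<lambda>z. m1 (g z))" "continuous_on S (\<lambda>z. k11 (g z))" "continuous_on S (\<lambda>z. k21 (g z))"
  by (rule all_analytic[THEN analytic_imp_continuous_on, THEN continuous_on_compose2, OF assms subset_UNIV])+

lemma PQR_continuous:
  fixes h c s t l :: "'z::topological_space \<Rightarrow> real"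
  assumes hcstl: "continuous_on S h" "continuous_on S c" "continuous_on S s" "continuous_on S t" "continuous_on S l"
  shows "continuous_on S (\<lambda>z. P (h z) (c z) (s z) (t z) (l z))" (is ?P)
    "continuous_on S (\<lambda>z. Q (h z) (c z) (s z) (t z) (l z))" (is ?Q)
    "continuous_on S (\<lambda>z. R (h z) (c z) (s z) (t z) (l z))" (is ?R)
    "(\<And>z. z \<in> S \<Longrightarrow> 0 < R (h z) (c z) (s z) (t z) (l z)) \<Longrightarrow>
      continuous_on S (\<lambda>z. W (h z) (c z) (s z) (t z) (l z))"
proof -
  have B: "continuous_on S (\<lambda>z. B (t z) (l z))" "continuous_on S (\<lambda>z. B1 (t z) (l z))"
    unfolding B_def B1_def by (intro continuous_intros coefficient_continuous hcstl)+
  show P: ?P unfolding P_def by (intro continuous_intros coefficient_continuous hcstl B)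
  show Q: ?Q unfolding Q_def by (intro continuous_intros coefficient_continuous hcstl B)
  show R: ?R unfolding R_def by (intro continuous_intros coefficient_continuous hcstl B)
  have P1: "continuous_on S (\<lambda>z. P1 (h z) (c z) (s z) (t z) (l z))"
    unfolding P1_def by (intro continuous_intros coefficient_continuous hcstl B)
  have R1: "continuous_on S (\<lambda>z. R1 (h z) (c z) (s z) (t z) (l z))"
    unfolding R1_def by (intro continuous_intros coefficient_continuous hcstl B)
  assume pos: "\<And>z. z \<in> S \<Longrightarrow> 0 < R (h z) (c z) (s z) (t z) (l z)"
  have D: "(R (h z) (c z) (s z) (t z) (l z))\<^sup>2 + (h z)\<^sup>2 * x \<noteq> 0" if "z \<in> S" "0 \<le> x" for z x
  proof -
    have "0 < (R (h z) (c z) (s z) (t z) (l z))\<^sup>2 + (h z)\<^sup>2 * x"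
      using pos[OF that(1)] that(2) by (intro add_pos_nonneg) auto
    then show ?thesis by simp
  qed
  show "continuous_on S (\<lambda>z. W (h z) (c z) (s z) (t z) (l z))"
    unfolding W_def
    by (intro continuous_intros coefficient_continuous hcstl P Q R P1 R1) (use D in auto)
qed

text \<open>Defect of - W from the derivative of l t + h^2 (m + l) sin (N t) cos (N t), computed
  with N h^2 = 1. Removing the oscillation in closed form leaves a quantity that vanishes at h =
  0.\<close>

definition W_error where
  "W_error h c s t l = - W h c s t l - l - (m t + l) * (2 * c\<^sup>2 - 1) - h\<^sup>2 * (m1 t * s * c)"

text \<open>A single sum, so that one compactness argument serves the angle, the velocity and the
  direction of \<open>normal\<close>. The last summand is the oscillating part of the angle.\<close>

definition total_error where
  "total_error h c s t l = \<bar>W_error h c s t l\<bar> + \<bar>R h c s t l - v t\<bar> + \<bar>h * P h c s t l\<bar> + \<bar>h * Q h c s t l\<bar>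
    + \<bar>R h c s t l / sqrt ((R h c s t l)\<^sup>2 + (h * P h c s t l)\<^sup>2) - 1\<bar>
    + \<bar>h * P h c s t l / sqrt ((R h c s t l)\<^sup>2 + (h * P h c s t l)\<^sup>2)\<bar> + \<bar>h\<^sup>2 * ((m t + l) * s * c)\<bar>"

abbreviation parameters :: "(real \<times> real \<times> real \<times> real) set" where
  "parameters \<equiv> {-1..1} \<times> {-1..1} \<times> {0..pi} \<times> {-1..1}"

lemma compact_parameters: "compact parameters"
  by (intro compact_Times) auto

text \<open>Two rounds are needed: \<open>total_error\<close> contains quotients whose continuity
  relies on R > 0, so positivity for small h is secured first, by comparison with the least speed
  \<open>v t0\<close>.\<close>

lemma total_error_small:
  assumes "0 < e"
  obtains d where "0 < d"
    "\<And>h c s t l. \<lbrakk>0 \<le> h; h \<le> d; (c, s, t, l) \<in> parameters\<rbrakk> \<Longrightarrow> 0 < R h c s t l \<and> total_error h c s t l < e"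
proof -
  obtain t0 where t0: "\<And>t. t \<in> {0..pi} \<Longrightarrow> v t0 \<le> v t"
    using continuous_attains_inf[of "{0..pi}" v] analytic_imp_continuous_on[OF coefficients_analytic(1)]
    by (metis atLeastAtMost_iff compact_Icc empty_iff order_refl pi_ge_zero)
  let ?H = "\<lambda>z. fst z" and ?C = "\<lambda>z. fst (snd z)" and ?S = "\<lambda>z. fst (snd (snd z))"
    and ?T = "\<lambda>z. fst (snd (snd (snd z)))" and ?L = "\<lambda>z::real \<times> real \<times> real \<times> real \<times> real. snd (snd (snd (snd z)))"
  have proj: "continuous_on S ?H" "continuous_on S ?C" "continuous_on S ?S" "continuous_on S ?T" "continuous_on S ?L" for S
    by (intro continuous_intros)+
  define A where "A = (\<lambda>z. R (?H z) (?C z) (?S z) (?T z) (?L z) - v (?T z))"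
  have cA: "continuous_on ({0..1} \<times> parameters) A"
    unfolding A_def by (intro continuous_intros PQR_continuous coefficient_continuous proj)
  have A0: "A (0, k) = 0" for k by (simp add: A_def R_def)
  obtain a where a: "0 < a" "a \<le> 1" "\<And>h k. \<lbrakk>0 \<le> h; h \<le> a; k \<in> parameters\<rbrakk> \<Longrightarrow> \<bar>A (h, k)\<bar> < v t0"
    by (rule compact_limit_uniform[OF compact_parameters zero_less_one cA A0 v_pos[of t0]]) (rule that; blast)
  have pos: "0 < R h c s t l" if "0 \<le> h" "h \<le> a" "(c, s, t, l) \<in> parameters" for h c s t l
    using a(3)[OF that] t0[of t] that by (auto simp: A_def)
  define E where "E = (\<lambda>z. total_error (?H z) (?C z) (?S z) (?T z) (?L z))"
  have posS: "0 < R (?H z) (?C z) (?S z) (?T z) (?L z)" if "z \<in> {0..a} \<times> parameters" for z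
    by (rule pos) (use that in auto)
  have sq: "sqrt ((R (?H z) (?C z) (?S z) (?T z) (?L z))\<^sup>2 + x\<^sup>2) \<noteq> 0" if "z \<in> {0..a} \<times> parameters" for z x
    using posS[OF that] by (simp add: sum_power2_eq_zero_iff)
  have cE: "continuous_on ({0..a} \<times> parameters) E"
    unfolding E_def total_error_def W_error_def
    by (intro continuous_intros PQR_continuous coefficient_continuous proj posS ballI sq)
  have E0: "E (0, k) = 0" for k
  proof -
    obtain c s t l where k: "k = (c, s, t, l)" by (metis prod.exhaust)
    have "R 0 c s t l = v t" by (simp add: R_def)
    then show ?thesis using v_pos[of t] by (simp add: E_def k total_error_def W_error_def W_0)
  qed
  obtain d where d: "0 < d" "d \<le> a" "\<And>h k. \<lbrakk>0 \<le> h; h \<le> d; k \<in> parameters\<rbrakk> \<Longrightarrow> \<bar>E (h, k)\<bar> < e"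
    by (rule compact_limit_uniform[OF compact_parameters a(1) cE E0 assms]) (rule that; blast)
  show ?thesis
  proof (rule that[OF d(1)])
    fix h c s t l assume *: "0 \<le> h" "h \<le> d" "(c, s, t, l) \<in> parameters"
    have "total_error h c s t l < e" using d(3)[OF *] by (auto simp: E_def)
    moreover have "0 < R h c s t l" using pos * d(2) by auto
    ultimately show "0 < R h c s t l \<and> total_error h c s t l < e" by blast
  qed
qed

lemma torsion_analytic:
  assumes h: "h > 0" "N * h\<^sup>2 = 1" and r: "\<And>t. 0 < r h N l t"
  shows "analytic (torsion h N l)"
proof -
  have t: "torsion h N l = (\<lambda>t. W h (cos (N * t)) (sin (N * t)) t l)"
    by (simp add: torsion_def[OF h] fun_eq_iff)
  have D: "0 < (R h (cos (N * t)) (sin (N * t)) t l)\<^sup>2 + h\<^sup>2 * x" if "0 \<le> x" for t x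
    using r[of t] that by (intro add_pos_nonneg) (auto simp: r_def[OF h])
  have B: "analytic (\<lambda>t. B t l)" "analytic (\<lambda>t. B1 t l)" by (rule B_analytic)+
  have A: "analytic (\<lambda>t. P h (cos (N * t)) (sin (N * t)) t l)" "analytic (\<lambda>t. Q h (cos (N * t)) (sin (N * t)) t l)"
    "analytic (\<lambda>t. R h (cos (N * t)) (sin (N * t)) t l)" "analytic (\<lambda>t. P1 h (cos (N * t)) (sin (N * t)) t l)"
    "analytic (\<lambda>t. R1 h (cos (N * t)) (sin (N * t)) t l)"
    unfolding P_def Q_def R_def P1_def R1_def
    by (intro analytic_add analytic_diff analytic_minus analytic_mult analytic_power analytic_cos analytic_sin all_analytic analytic_const analytic_ident B)+
  let ?P = "\<lambda>t. P h (cos (N * t)) (sin (N * t)) t l" and ?Q = "\<lambda>t. Q h (cos (N * t)) (sin (N * t)) t l"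
    and ?R = "\<lambda>t. R h (cos (N * t)) (sin (N * t)) t l"
  show ?thesis
    unfolding t W_def
  proof (intro analytic_divide analytic_sqrt analytic_add analytic_diff analytic_mult analytic_power analytic_const all_analytic A)
    show "(?R t)\<^sup>2 + h\<^sup>2 * (?P t)\<^sup>2 \<noteq> 0" for t
      using D[of "(?P t)\<^sup>2" t] by simp
    show pos: "0 < (?R t)\<^sup>2 + h\<^sup>2 * ((?P t)\<^sup>2 + (?Q t)\<^sup>2)" for t
      by (rule D) simp
    show "sqrt ((?R t)\<^sup>2 + h\<^sup>2 * ((?P t)\<^sup>2 + (?Q t)\<^sup>2)) \<noteq> 0" for t
      using pos[of t] by (metis less_irrefl real_sqrt_gt_0_iff)
  qed
qed

text \<open>Once the linear part and the oscillation are removed, the derivative of the angle is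
  \<open>W_error\<close>, which integrates to at most e * pi. Putting the oscillation back costs the
  other e.\<close>

lemma angle_estimate:
  assumes h: "0 < h" "N * h\<^sup>2 = 1" and l: "l \<in> {-1..1}"
    and small: "\<And>t. t \<in> {0..pi} \<Longrightarrow> total_error h (cos (N * t)) (sin (N * t)) t l < e"
    and \<phi>: "\<phi> 0 = 0" "\<And>t. (\<phi> has_real_derivative - torsion h N l t) (at t)" and t: "t \<in> {0..pi}"
  shows "\<bar>\<phi> t - l * t\<bar> \<le> e + e * pi"
proof -
  define \<psi> where "\<psi> t = \<phi> t - l * t - h\<^sup>2 * ((m t + l) * sin (N * t) * cos (N * t))" for t
  have te: "\<bar>W_error h c s t l\<bar> \<le> total_error h c s t l" "\<bar>h\<^sup>2 * ((m t + l) * s * c)\<bar> \<le> total_error h c s t l" for c s t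
    by (simp_all add: total_error_def)
  have sc: "(sin x)\<^sup>2 = 1 - (cos x)\<^sup>2" for x :: real by (simp add: sin_squared_eq)
  have "(\<psi> has_real_derivative W_error h (cos (N * t)) (sin (N * t)) t l) (at t)" for t
    unfolding \<psi>_def[abs_def]
    by (rule derivative_eq_intros \<phi>(2) coefficient_derivatives refl)+
      (use h in \<open>simp add: W_error_def torsion_def N_eq[OF h] sc field_simps flip: power2_eq_square\<close>)
  moreover have "\<bar>W_error h (cos (N * z)) (sin (N * z)) z l\<bar> \<le> e" if "z \<in> {0..pi}" for z
    using small[OF that] te(1)[of "cos (N * z)" "sin (N * z)" z] by linarith
  ultimately have "norm (\<psi> t - \<psi> 0) \<le> e * norm (t - 0)"
    using t
    by (intro field_differentiable_bound[of "{0..pi}" \<psi> "\<lambda>t. W_error h (cos (N * t)) (sin (N * t)) t l"])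
      (auto intro: has_field_derivative_at_within)
  moreover have "\<psi> 0 = 0" by (simp add: \<psi>_def \<phi>)
  ultimately have "\<bar>\<psi> t\<bar> \<le> e * t" using t by simp
  moreover have "0 \<le> e" using small[OF t] te(1)[of "cos (N * t)" "sin (N * t)" t] by linarith
  then have "e * t \<le> e * pi" using t by (intro mult_left_mono) auto
  ultimately show ?thesis
    using small[OF t] te(2)[of t "sin (N * t)" "cos (N * t)"] by (simp add: \<psi>_def)
qed

text \<open>The angle by which the parallel field turns against the helix frame over one period is l
  pi up to a small error, so it vanishes for some small l. The same estimate at intermediate times
  keeps the field near e1.\<close>

lemma exists_parallel_helix:
  assumes \<gamma>: "analytic_curve \<gamma>0" "\<And>t. (\<gamma>0 has_vector_derivative v t *\<^sub>R T t) (at t)" "\<And>t. \<gamma>0 (t + pi) = \<gamma>0 t"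
    and e: "0 < e"
  obtains \<gamma> d \<xi> where "parallel_strip \<gamma> d \<xi>"
    "\<forall>t. norm (d t - v t *\<^sub>R T t) < e" "\<forall>t. norm (\<xi> t - e1 t) < e"
proof -
  \<comment> \<open>The bound 1 / 2 keeps l inside the parameter range. The number 14 covers the
    final estimate, in which \<xi> deviates by at most 2 * (17 / 3) \<delta> + \<delta> / 3.\<close>
  define \<delta> where "\<delta> = min (1 / 2) (e / 14)"
  have \<delta>: "0 < \<delta>" "\<delta> < 1" "14 * \<delta> \<le> e" using e by (auto simp: \<delta>_def)
  define \<epsilon> where "\<epsilon> = \<delta> / 3"
  have "0 < \<epsilon>" using \<delta> by (simp add: \<epsilon>_def)
  then obtain h0 where h0: "0 < h0"
    "\<And>h c s t l. \<lbrakk>0 \<le> h; h \<le> h0; (c, s, t, l) \<in> parameters\<rbrakk> \<Longrightarrow> 0 < R h c s t l \<and> total_error h c s t l < \<epsilon>"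
    by (rule total_error_small) (rule that; blast)
  obtain n :: nat where n: "1 / h0\<^sup>2 < real n" using reals_Archimedean2 by blast
  \<comment> \<open>Odd, so that the offset of the helix changes sign in the normal frame when the
    frame itself does.\<close>
  define N where "N = 2 * real n + 1"
  define h where "h = 1 / sqrt N"
  have N0: "0 < N" by (simp add: N_def add_nonneg_pos)
  have h: "0 < h" "N * h\<^sup>2 = 1" using N0 by (simp_all add: h_def power_divide)
  have "h \<le> h0"
  proof -
    have "1 / h0\<^sup>2 < N" using n by (simp add: N_def)
    then have "1 < N * h0\<^sup>2" using h0(1) by (simp add: field_simps)
    then have "N * h\<^sup>2 < N * h0\<^sup>2" using h by simp
    then have "h\<^sup>2 < h0\<^sup>2" using N0 by simp
    then show ?thesis using h0(1) by (meson less_imp_le power2_less_imp_less)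
  qed
  then have small: "0 < R h (cos (N * t)) (sin (N * t)) t l" "total_error h (cos (N * t)) (sin (N * t)) t l < \<epsilon>"
    if "t \<in> {0..pi}" "l \<in> {-1..1}" for t l
    using h0(2)[of h "cos (N * t)" "sin (N * t)" t l] h(1) that by auto
  have cs: "cos (N * (t + pi)) = - cos (N * t)" "sin (N * (t + pi)) = - sin (N * t)" for t
  proof -
    have "N * (t + pi) = (N * t + pi) + 2 * of_int (int n) * pi" by (simp add: N_def algebra_simps)
    then show "cos (N * (t + pi)) = - cos (N * t)" "sin (N * (t + pi)) = - sin (N * t)"
      using sin_cos_eq_iff[of "N * (t + pi)" "N * t + pi"]
      by (auto simp: cos_add sin_add sin_cos_eq_iff)
  qed
  note defs = p_def[OF h] q_def[OF h] r_def[OF h] torsion_def[OF h]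
  have per: "p h N l (t + pi) = - p h N l t" "q h N l (t + pi) = - q h N l t"
    "r h N l (t + pi) = r h N l t" "torsion h N l (t + pi) = torsion h N l t" for l t
    unfolding defs cs shifted_coefficients by simp_all
  have rpos: "0 < r h N l t" if "l \<in> {-1..1}" for l t
    by (rule periodic_bound[of "r h N l"]) (use per small(1) that in \<open>auto simp: r_def[OF h]\<close>)
  define \<phi> where "\<phi> l = (SOME \<phi>. analytic \<phi> \<and> \<phi> 0 = 0 \<and> (\<forall>t. (\<phi> has_real_derivative - torsion h N l t) (at t)))" for l
  have \<phi>: "analytic (\<phi> l) \<and> \<phi> l 0 = 0 \<and> (\<forall>t. (\<phi> l has_real_derivative - torsion h N l t) (at t))"
    if "l \<in> {-1..1}" for l
  proof -
    have "analytic (\<lambda>t. - torsion h N l t)" by (intro analytic_minus torsion_analytic h rpos that)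
    then have "\<exists>\<phi>. analytic \<phi> \<and> \<phi> 0 = 0 \<and> (\<forall>t. (\<phi> has_real_derivative - torsion h N l t) (at t))"
      by (rule analytic_primitive) blast
    then show ?thesis unfolding \<phi>_def by (rule someI_ex)
  qed
  have est: "\<bar>\<phi> l t - l * t\<bar> \<le> \<epsilon> + \<epsilon> * pi" if "l \<in> {-1..1}" "t \<in> {0..pi}" for l t
    by (rule angle_estimate[OF h that(1) small(2)]) (use \<phi> that in auto)
  have pi4: "\<epsilon> + \<epsilon> * pi \<le> 5 / 3 * \<delta>" "\<epsilon> + \<epsilon> * pi < \<delta> * pi"
  proof -
    have "\<epsilon> * pi \<le> \<epsilon> * 4" using \<open>0 < \<epsilon>\<close> pi_less_4 by (intro mult_left_mono) auto
    then show "\<epsilon> + \<epsilon> * pi \<le> 5 / 3 * \<delta>" by (simp add: \<epsilon>_def)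
    moreover have "\<delta> * 2 \<le> \<delta> * pi" using \<delta> pi_ge_two by (intro mult_left_mono) auto
    ultimately show "\<epsilon> + \<epsilon> * pi < \<delta> * pi" using \<delta>(1) by linarith
  qed
  \<comment> \<open>The primitives are chosen separately for each l, so their continuity in l has to
    be read off from the integral of the torsion over one period.\<close>
  have "\<exists>l\<in>{-\<delta>..\<delta>}. \<phi> l pi = 0"
  proof -
    have int: "\<phi> l pi = - integral {0..pi} (torsion h N l)" if "l \<in> {-1..1}" for l
    proof -
      have "((\<lambda>t. - torsion h N l t) has_integral \<phi> l pi - \<phi> l 0) {0..pi}"
        using \<phi>[OF that]
        by (intro fundamental_theorem_of_calculus)
          (auto simp flip: has_real_derivative_iff_has_vector_derivative intro: has_field_derivative_at_within)
      from has_integral_neg[OF this] have "integral {0..pi} (torsion h N l) = - (\<phi> l pi - \<phi> l 0)"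
        by (simp add: integral_unique)
      then show ?thesis using \<phi>[OF that] by simp
    qed
    have "continuous_on ({-\<delta>..\<delta>} \<times> cbox 0 pi) (\<lambda>z. W h (cos (N * snd z)) (sin (N * snd z)) (snd z) (fst z))"
      by (intro PQR_continuous(4) continuous_intros) (use small(1) \<delta> in auto)
    then have "continuous_on ({-\<delta>..\<delta>} \<times> cbox 0 pi) (\<lambda>(l, t). torsion h N l t)"
      by (simp add: case_prod_unfold torsion_def[OF h])
    from integral_continuous_on_param[OF this]
    have "continuous_on {-\<delta>..\<delta>} (\<lambda>l. integral {0..pi} (torsion h N l))" by simp
    then have "continuous_on {-\<delta>..\<delta>} (\<lambda>l. - integral {0..pi} (torsion h N l))"
      by (rule continuous_on_minus)
    then have "continuous_on {-\<delta>..\<delta>} (\<lambda>l. \<phi> l pi)"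
      by (rule continuous_on_eq) (use int \<delta> in auto)
    \<comment> \<open>The error of the angle is below \<delta> pi, so the linear part l pi decides
      the sign at both ends.\<close>
    moreover have "\<phi> (-\<delta>) pi \<le> 0" "0 \<le> \<phi> \<delta> pi"
      using est[of "-\<delta>" pi] est[of \<delta> pi] pi4(2) \<delta> by auto
    ultimately obtain x where "-\<delta> \<le> x" "x \<le> \<delta>" "\<phi> x pi = 0"
      using IVT'[of "\<lambda>l. \<phi> l pi" "-\<delta>" 0 \<delta>] \<delta>(1) by auto
    then show ?thesis by auto
  qed
  then obtain l where l': "-\<delta> \<le> l" "l \<le> \<delta>" "\<phi> l pi = 0" by auto
  then have l: "l \<in> {-1..1}" using \<delta> by auto
  note \<phi>l = \<phi>[OF l]
  have D\<phi>: "(\<phi> l has_vector_derivative - torsion h N l t) (at t)" for t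
    using \<phi>l by (simp add: has_real_derivative_iff_has_vector_derivative)
  have \<phi>per: "\<phi> l (t + pi) = \<phi> l t" for t
  proof -
    have "((\<lambda>t. \<phi> l (t + pi) - \<phi> l t) has_vector_derivative 0) (at t)" for t
      using has_vector_derivative_diff[OF has_vector_derivative_shift_real[OF D\<phi>] D\<phi>, of pi t]
      by (simp add: per)
    from has_vector_derivative_zero_imp_const[OF this, of t 0]
    show ?thesis using l'(3) \<phi>l by simp
  qed
  define d where "d = velocity h N l"
  define f0 where "f0 t = d t /\<^sub>R norm (d t)" for t
  define f1 where "f1 t = normal h N l t /\<^sub>R norm (normal h N l t)" for t
  define \<xi> where "\<xi> t = cos (\<phi> l t) *\<^sub>R f1 t + sin (\<phi> l t) *\<^sub>R cross3 (f0 t) (f1 t)" for t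
  define \<gamma> where "\<gamma> = helix h N l \<gamma>0"
  have dper: "d (t + pi) = d t" for t
    by (simp add: d_def velocity_def[OF h] per periodic)
  have nper: "normal h N l (t + pi) = - normal h N l t" for t
    by (simp add: normal_def[OF h] per periodic)
  have \<xi>per: "\<xi> (t + pi) = - \<xi> t" for t
    by (simp add: \<xi>_def f0_def f1_def \<phi>per dper nper)
  have comp: "\<bar>r h N l t - v t\<bar> < \<epsilon> \<and> \<bar>p h N l t\<bar> < \<epsilon> \<and> \<bar>q h N l t\<bar> < \<epsilon>
     \<and> \<bar>r h N l t / sqrt ((r h N l t)\<^sup>2 + (p h N l t)\<^sup>2) - 1\<bar> + \<bar>p h N l t / sqrt ((r h N l t)\<^sup>2 + (p h N l t)\<^sup>2)\<bar> < \<epsilon>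
     \<and> \<bar>r h N l t - v t\<bar> + \<bar>p h N l t\<bar> + \<bar>q h N l t\<bar> < \<epsilon>"
    if "t \<in> {0..pi}" for t
    using small(2)[OF that l] unfolding total_error_def defs by (smt (verit))
  have d_close: "norm (d t - v t *\<^sub>R T t) < e" for t
  proof (rule periodic_bound[of "\<lambda>t. norm (d t - v t *\<^sub>R T t)"])
    fix t assume t: "t \<in> {0..pi}"
    have "d t - v t *\<^sub>R T t = (r h N l t - v t) *\<^sub>R T t + p h N l t *\<^sub>R e1 t + q h N l t *\<^sub>R e2 t"
      by (simp add: d_def velocity_def[OF h] algebra_simps)
    also have "norm \<dots> < \<epsilon>" using frame_norm_le comp[OF t] by (meson le_less_trans)
    also have "\<dots> \<le> e" using \<delta> by (simp add: \<epsilon>_def)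
    finally show "norm (d t - v t *\<^sub>R T t) < e" .
  qed (simp add: dper periodic)
  have \<xi>_close: "norm (\<xi> t - e1 t) < e" for t
  proof (rule periodic_bound[of "\<lambda>t. norm (\<xi> t - e1 t)"])
    show "norm (\<xi> (t + pi) - e1 (t + pi)) = norm (\<xi> t - e1 t)" for t
      by (simp add: \<xi>per periodic norm_minus_commute)
    fix t assume t: "t \<in> {0..pi}"
    define \<rho> where "\<rho> = sqrt ((r h N l t)\<^sup>2 + (p h N l t)\<^sup>2)"
    have \<rho>: "norm (normal h N l t) = \<rho>"
      unfolding normal_def[OF h] frame_norm \<rho>_def by (simp add: add.commute)
    have "\<bar>l * t\<bar> \<le> \<delta> * 4"
      unfolding abs_mult using l' t pi_less_4 by (intro mult_mono) auto
    \<comment> \<open>The linear part gives 4 \<delta>, by pi < 4, and the error of the angle 5 / 3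
      \<delta>.\<close>
    then have \<phi>t: "\<bar>\<phi> l t\<bar> \<le> 17 / 3 * \<delta>" using est[OF l t] pi4(1) by linarith
    have "f1 t - e1 t = (- (p h N l t / \<rho>)) *\<^sub>R T t + (r h N l t / \<rho> - 1) *\<^sub>R e1 t + 0 *\<^sub>R e2 t"
      by (simp add: f1_def \<rho>) (simp add: normal_def[OF h] algebra_simps divide_inverse)
    also have "norm \<dots> \<le> \<epsilon>"
      using frame_norm_le[of "- (p h N l t / \<rho>)" t "r h N l t / \<rho> - 1" 0] comp[OF t] unfolding \<rho>_def by simp
    finally have f1: "norm (f1 t - e1 t) \<le> \<epsilon>" .
    have unit: "norm (x /\<^sub>R norm x) \<le> 1" for x :: "real^3" by (cases "x = 0") auto
    have n1: "norm (f1 t) \<le> 1" unfolding f1_def by (rule unit)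
    have n2: "norm (cross3 (f0 t) (f1 t)) \<le> 1"
    proof -
      have "norm (f0 t) \<le> 1" unfolding f0_def by (rule unit)
      then have "norm (f0 t) * norm (f1 t) \<le> 1" using n1 by (simp add: mult_le_one)
      moreover have "(norm (cross3 (f0 t) (f1 t)))\<^sup>2 \<le> (norm (f0 t) * norm (f1 t))\<^sup>2"
        using norm_cross_dot[of "f0 t" "f1 t"] by (metis le_add_same_cancel1 zero_le_power2)
      ultimately show ?thesis
        by (meson mult_nonneg_nonneg norm_ge_zero order_trans power2_le_imp_le)
    qed
    have c: "\<bar>cos (\<phi> l t) - 1\<bar> \<le> \<bar>\<phi> l t\<bar>" "\<bar>sin (\<phi> l t)\<bar> \<le> \<bar>\<phi> l t\<bar>"
    proof -
      show "\<bar>sin (\<phi> l t)\<bar> \<le> \<bar>\<phi> l t\<bar>" by (rule abs_sin_x_le_abs_x)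
      have "norm (cos (\<phi> l t) - cos 0) \<le> 1 * norm (\<phi> l t - 0)"
        by (rule field_differentiable_bound[of UNIV cos "\<lambda>x. - sin x"]) (auto intro!: derivative_eq_intros)
      then show "\<bar>cos (\<phi> l t) - 1\<bar> \<le> \<bar>\<phi> l t\<bar>" by simp
    qed
    have "\<xi> t - e1 t = (cos (\<phi> l t) - 1) *\<^sub>R f1 t + sin (\<phi> l t) *\<^sub>R cross3 (f0 t) (f1 t) + (f1 t - e1 t)"
      by (simp add: \<xi>_def algebra_simps)
    also have "norm \<dots> \<le> \<bar>cos (\<phi> l t) - 1\<bar> * norm (f1 t) + \<bar>sin (\<phi> l t)\<bar> * norm (cross3 (f0 t) (f1 t)) + norm (f1 t - e1 t)"
      by (intro norm_triangle_le add_mono) auto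
    also have "\<dots> \<le> \<bar>\<phi> l t\<bar> * 1 + \<bar>\<phi> l t\<bar> * 1 + \<epsilon>"
      using c n1 n2 f1 by (intro add_mono mult_mono) auto
    also have "\<dots> < e" using \<phi>t \<delta> by (simp add: \<epsilon>_def)
    finally show "norm (\<xi> t - e1 t) < e" .
  qed
  have a\<phi>: "analytic (\<phi> l)" "\<And>t. (\<phi> l has_real_derivative - torsion h N l t) (at t)" using \<phi>l by auto
  note field = parallel_field_along_helix[OF h rpos[OF l] a\<phi>, folded d_def f0_def f1_def \<xi>_def]
  have "parallel_strip \<gamma> d \<xi>"
    unfolding parallel_strip_def
  proof (intro conjI allI impI)
    show "analytic_curve \<gamma>" unfolding \<gamma>_def by (rule helix_analytic[OF h \<gamma>(1)])
    show "analytic_curve \<xi>" using field(1) by (simp add: \<xi>_def[abs_def] f0_def f1_def d_def)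
    show "(\<gamma> has_vector_derivative d t) (at t)" for t
      unfolding \<gamma>_def d_def by (rule helix_derivative[OF h \<gamma>(2)])
    show "\<gamma> (t + pi) = \<gamma> t" for t
      unfolding \<gamma>_def helix_def[OF h] cs periodic \<gamma>(3) B_def by (simp add: periodic)
    show "d t \<bullet> \<xi> t = 0" for t using field(2)[of t] by (simp add: \<xi>_def f0_def f1_def d_def)
    show "cross3 (d t) (\<xi> t) \<bullet> \<xi>' = 0" if "(\<xi> has_vector_derivative \<xi>') (at t)" for t \<xi>'
      using field(3)[of \<xi>' t] that by (simp add: \<xi>_def[abs_def] f0_def f1_def d_def)
  qed (rule \<xi>per)
  then show ?thesis using d_close \<xi>_close by (intro that allI)
qed

end

section \<open>Stability under perturbation\<close>

text \<open>The remainder y is orthogonal to a and b, so its cross product with c = a \<times> b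
  vanishes by Lagrange's identity; being orthogonal to c as well, it is zero.\<close>

lemma orthonormal_expansion3:
  fixes a b z :: "real^3"
  assumes "a \<bullet> a = 1" "b \<bullet> b = 1" "a \<bullet> b = 0"
  shows "z = (z \<bullet> a) *\<^sub>R a + (z \<bullet> b) *\<^sub>R b + (z \<bullet> cross3 a b) *\<^sub>R cross3 a b"
proof -
  define c where "c = cross3 a b"
  have "(norm c)\<^sup>2 = 1"
    using norm_cross_dot[of a b] assms by (simp add: c_def norm_eq_sqrt_inner)
  then have c: "c \<bullet> c = 1" by (simp only: dot_square_norm)
  have ac: "a \<bullet> c = 0" "b \<bullet> c = 0" "c \<bullet> a = 0" "c \<bullet> b = 0" by (simp_all add: c_def dot_cross_self)
  define y where "y = z - ((z \<bullet> a) *\<^sub>R a + (z \<bullet> b) *\<^sub>R b + (z \<bullet> c) *\<^sub>R c)"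
  have y: "y \<bullet> a = 0" "y \<bullet> b = 0" "y \<bullet> c = 0"
    using assms ac c by (simp_all add: y_def inner_diff_left inner_add_left inner_commute[of b a])
  have "cross3 y c = 0" using Lagrange[of y a b] y by (simp add: c_def)
  then have "y = 0 \<or> c = 0" using norm_and_cross_eq_0[of y c] y(3) by simp
  then have "y = 0" using c by auto
  then show ?thesis by (simp add: y_def c_def)
qed

lemma half_periodic_derivative:
  fixes f :: "real \<Rightarrow> 'a::real_normed_vector"
  assumes "\<And>t. (f has_vector_derivative f' t) (at t)" "\<And>t. f (t + pi) = \<sigma> *\<^sub>R f t"
  shows "f' (t + pi) = \<sigma> *\<^sub>R f' t"
proof -
  have "((\<lambda>t. f (t + pi)) has_vector_derivative f' (t + pi)) (at t)"
    by (rule has_vector_derivative_shift_real) (rule assms)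
  moreover have "((\<lambda>t. f (t + pi)) has_vector_derivative \<sigma> *\<^sub>R f' t) (at t)"
    unfolding assms(2) using bounded_linear.has_vector_derivative[OF bounded_linear_scaleR_right assms(1)] .
  ultimately show ?thesis by (rule vector_derivative_unique_at)
qed

text \<open>Differentiating the six constant inner products of the frame leaves three independent
  coefficients, which are taken as k1, k2 and m.\<close>

lemma moving_frame_exists:
  assumes d: "analytic_curve d" "\<And>t. d (t + pi) = d t" and E: "analytic_curve E" "\<And>t. E (t + pi) = - E t"
    and dE: "\<And>t. cross3 (d t) (E t) \<noteq> 0"
  obtains T e2 m k1 k2 where "moving_frame T (\<lambda>t. unit_normal (d t) (E t)) e2 (\<lambda>t. norm (d t)) m k1 k2"
    "\<And>t. norm (d t) *\<^sub>R T t = d t"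
proof -
  have d0: "d t \<noteq> 0" for t using normal_part_nonzero(2)[OF dE[of t]] .
  define T where "T t = d t /\<^sub>R norm (d t)" for t
  define e1 where "e1 t = unit_normal (d t) (E t)" for t
  define e2 where "e2 t = cross3 (T t) (e1 t)" for t
  have av: "analytic (\<lambda>t. norm (d t))" by (rule analytic_norm[OF d(1) d0])
  have aT: "analytic_curve T" unfolding T_def[abs_def] by (intro analytic_curve_scaleR analytic_inverse av d) (simp add: d0)
  have a1: "analytic_curve e1" unfolding e1_def[abs_def] by (intro analytic_curve_unit_normal d E dE)
  have a2: "analytic_curve e2" unfolding e2_def[abs_def] by (intro analytic_curve_cross3 aT a1)
  have perT: "T (t + pi) = T t" for t by (simp add: T_def d)
  have per1: "e1 (t + pi) = - e1 t" for t by (simp add: e1_def d E unit_normal_minus)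
  have per2: "e2 (t + pi) = - e2 t" for t by (simp add: e2_def perT per1)
  have on: "T t \<bullet> T t = 1" "e1 t \<bullet> e1 t = 1" "T t \<bullet> e1 t = 0" for t
    using unit_normal(1,2)[OF dE[of t]] d0[of t]
    by (auto simp: T_def e1_def dot_square_norm power2_eq_square)
  have on2: "T t \<bullet> e2 t = 0" "e1 t \<bullet> e2 t = 0" "e2 t \<bullet> T t = 0" "e2 t \<bullet> e1 t = 0" for t
    by (simp_all add: e2_def dot_cross_self)
  have "(norm (e2 t))\<^sup>2 = 1" for t
    using norm_cross_dot[of "T t" "e1 t"] on[of t] by (simp add: e2_def norm_eq_sqrt_inner)
  then have on3: "e2 t \<bullet> e2 t = 1" for t by (simp only: dot_square_norm)
  have cr: "cross3 (e1 t) (e2 t) = T t" "cross3 (e2 t) (T t) = e1 t" for t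
    using Lagrange[of "e1 t" "T t" "e1 t"] Lagrange[of "T t" "T t" "e1 t"] on[of t]
      cross_skew[of "e2 t" "T t"] by (simp_all add: e2_def inner_commute[of "e1 t" "T t"])
  obtain T' where T': "analytic_curve T'" "\<And>t. (T has_vector_derivative T' t) (at t)" using analytic_curve_derivative[OF aT] by blast
  obtain e1' where e1': "analytic_curve e1'" "\<And>t. (e1 has_vector_derivative e1' t) (at t)" using analytic_curve_derivative[OF a1] by blast
  obtain e2' where e2': "analytic_curve e2'" "\<And>t. (e2 has_vector_derivative e2' t) (at t)" using analytic_curve_derivative[OF a2] by blast
  define k1 where "k1 t = T' t \<bullet> e1 t" for t
  define k2 where "k2 t = T' t \<bullet> e2 t" for t
  define m where "m t = e1' t \<bullet> e2 t" for t
  have exp: "z = (z \<bullet> T t) *\<^sub>R T t + (z \<bullet> e1 t) *\<^sub>R e1 t + (z \<bullet> e2 t) *\<^sub>R e2 t" for z t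
    using orthonormal_expansion3[OF on(1,2,3)] by (simp add: e2_def)
  have i: "T' t \<bullet> T t = 0" "e1' t \<bullet> e1 t = 0" "e2' t \<bullet> e2 t = 0"
    "e1' t \<bullet> T t = - k1 t" "e2' t \<bullet> T t = - k2 t" "e2' t \<bullet> e1 t = - m t" for t
    using inner_derivative_of_constant_inner[OF T'(2) T'(2) on(1), of t]
      inner_derivative_of_constant_inner[OF e1'(2) e1'(2) on(2), of t]
      inner_derivative_of_constant_inner[OF e2'(2) e2'(2) on3, of t]
      inner_derivative_of_constant_inner[OF T'(2) e1'(2) on(3), of t]
      inner_derivative_of_constant_inner[OF T'(2) e2'(2) on2(1), of t]
      inner_derivative_of_constant_inner[OF e1'(2) e2'(2) on2(2), of t]
    by (simp_all add: k1_def k2_def m_def inner_commute)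
  have "T' t = k1 t *\<^sub>R e1 t + k2 t *\<^sub>R e2 t" "e1' t = - k1 t *\<^sub>R T t + m t *\<^sub>R e2 t"
    "e2' t = - k2 t *\<^sub>R T t - m t *\<^sub>R e1 t" for t
    using exp[of "T' t" t] exp[of "e1' t" t] exp[of "e2' t" t]
    by (simp_all add: i k1_def[symmetric] k2_def[symmetric] m_def[symmetric])
  note ders = T'(2)[unfolded this(1)] e1'(2)[unfolded this(2)] e2'(2)[unfolded this(3)]
  have perT': "T' (t + pi) = T' t" for t
    using half_periodic_derivative[OF T'(2), of 1 t] perT by simp
  have pere1': "e1' (t + pi) = - e1' t" for t
    using half_periodic_derivative[OF e1'(2), of "-1" t] per1 by simp
  have "moving_frame T e1 e2 (\<lambda>t. norm (d t)) m k1 k2"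
  proof
    show "analytic m" "analytic k1" "analytic k2"
      unfolding m_def[abs_def] k1_def[abs_def] k2_def[abs_def] by (intro analytic_inner T' e1' a1 a2)+
    show "k1 (t + pi) = - k1 t" "k2 (t + pi) = - k2 t" "m (t + pi) = m t" for t
      by (simp_all add: k1_def k2_def m_def perT' pere1' per1 per2)
  qed (use on on2 on3 cr ders aT a1 a2 av d0 perT per1 per2 d in \<open>simp_all add: e2_def\<close>)
  then show ?thesis
    using that[of T e2 m k1 k2] d0 by (simp add: e1_def[abs_def] T_def)
qed

text \<open>Uniform continuity at the points of K with y allowed outside K: a closed neighbourhood
  of K inside U is still compact.\<close>

lemma continuous_near_compact:
  fixes f :: "'a::euclidean_space \<Rightarrow> 'b::metric_space"
  assumes "compact K" "open U" "K \<subseteq> U" "continuous_on U f" "0 < e"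
  obtains \<delta> where "0 < \<delta>" "\<And>k y. \<lbrakk>k \<in> K; dist k y < \<delta>\<rbrakk> \<Longrightarrow> y \<in> U \<and> dist (f y) (f k) < e"
proof -
  obtain r where r: "0 < r" "(\<Union>x\<in>K. cball x r) \<subseteq> U"
    using compact_subset_open_imp_cball_epsilon_subset[OF assms(1-3)] by blast
  define M where "M = (\<Union>x\<in>K. cball x r)"
  have "compact M" unfolding M_def by (rule compact_minkowski_sum_cball[OF assms(1)])
  moreover have "continuous_on M f" by (rule continuous_on_subset[OF assms(4)]) (use r(2) in \<open>simp add: M_def\<close>)
  ultimately have "uniformly_continuous_on M f" by (rule compact_uniformly_continuous[rotated])
  then obtain d where d: "0 < d" "\<And>x y. \<lbrakk>x \<in> M; y \<in> M; dist y x < d\<rbrakk> \<Longrightarrow> dist (f y) (f x) < e"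
    unfolding uniformly_continuous_on_def using assms(5) by meson
  show ?thesis
  proof (rule that[of "min r d"])
    show "0 < min r d" using r d by simp
    fix k y assume k: "k \<in> K" "dist k y < min r d"
    have y: "y \<in> M" unfolding M_def by (rule UN_I[of k]) (use k in auto)
    have k': "k \<in> M" unfolding M_def by (rule UN_I[of k]) (use k r(1) in auto)
    have "y \<in> U" by (rule subsetD[OF r(2)]) (use y in \<open>simp add: M_def\<close>)
    moreover have "dist (f y) (f k) < e" by (rule d(2)[OF k' y]) (use k(2) in \<open>simp add: dist_commute\<close>)
    ultimately show "y \<in> U \<and> dist (f y) (f k) < e" ..
  qed
qed

lemma dist_Pair_le: "dist (a, b) (c, d) \<le> dist a c + dist b d"
  unfolding dist_Pair_Pair by (rule sqrt_sum_squares_le_sum) simp_all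

lemma open_cross_nonzero: "open {z::(real^3) \<times> (real^3). cross3 (fst z) (snd z) \<noteq> 0}"
proof -
  have "{z::(real^3) \<times> (real^3). cross3 (fst z) (snd z) \<noteq> 0} = (\<lambda>z. cross3 (fst z) (snd z)) -` (- {0})" by auto
  moreover have "open \<dots>"
    by (intro open_vimage continuous_on_cross continuous_intros)
  ultimately show ?thesis by simp
qed

lemma compact_range_periodic:
  fixes f :: "real \<Rightarrow> 'a::metric_space"
  assumes "continuous_on UNIV f" "\<And>t. f (t + 2 * pi) = f t"
  shows "compact (range f)"
proof -
  have "range f \<subseteq> f ` {0..2 * pi}"
  proof
    fix y assume "y \<in> range f"
    then obtain t where t: "y = f t" by auto
    obtain k :: int where "t + of_int k * (2 * pi) \<in> {0..0 + 2 * pi}"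
      by (rule periodic_shift[of "2 * pi" t 0]) (simp, rule that)
    then have "f (t + of_int k * (2 * pi)) \<in> f ` {0..2 * pi}" by simp
    then show "y \<in> f ` {0..2 * pi}" using periodic_int[of f "2 * pi" t k, OF assms(2)] t by simp
  qed
  then have "range f = f ` {0..2 * pi}" by auto
  then show ?thesis using assms(1) by (metis compact_Icc compact_continuous_image continuous_on_subset subset_UNIV)
qed

text \<open>Half of e is spent on making the data analytic, half on the helix. In the first half the
  data must be so close that \<open>unit_normal\<close>, which is continuous only away from parallel
  vectors, moves by less than e / 2.\<close>

lemma parallel_approximation:
  fixes \<gamma>0 d0 \<eta> :: "real \<Rightarrow> real^3"
  assumes \<gamma>0: "\<And>t. (\<gamma>0 has_vector_derivative d0 t) (at t)" "continuous_on UNIV d0" "\<And>t. \<gamma>0 (t + pi) = \<gamma>0 t"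
    and \<eta>: "continuous_on UNIV \<eta>" "\<And>t. \<eta> (t + pi) = - \<eta> t"
    and ne: "\<And>t. cross3 (d0 t) (\<eta> t) \<noteq> 0" and e: "0 < e"
  obtains \<gamma> d \<xi> where "parallel_strip \<gamma> d \<xi>"
    "\<forall>t. norm (d t - d0 t) < e" "\<forall>t. norm (\<xi> t - unit_normal (d0 t) (\<eta> t)) < e"
proof -
  let ?U = "{z::(real^3) \<times> (real^3). cross3 (fst z) (snd z) \<noteq> 0}"
  let ?f = "\<lambda>z::(real^3) \<times> (real^3). unit_normal (fst z) (snd z)"
  have d0per: "d0 (t + pi) = d0 t" for t
    using half_periodic_derivative[OF \<gamma>0(1), of 1 t] \<gamma>0(3) by simp
  have "compact (range (\<lambda>t. (d0 t, \<eta> t)))"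
  proof (rule compact_range_periodic)
    show "continuous_on UNIV (\<lambda>t. (d0 t, \<eta> t))" by (intro continuous_intros \<gamma>0 \<eta>)
    show "(d0 (t + 2 * pi), \<eta> (t + 2 * pi)) = (d0 t, \<eta> t)" for t
      using d0per[of "t + pi"] d0per[of t] \<eta>(2)[of "t + pi"] \<eta>(2)[of t] by (simp add: add.assoc)
  qed
  then obtain \<delta> where \<delta>: "0 < \<delta>"
    "\<And>k y. \<lbrakk>k \<in> range (\<lambda>t. (d0 t, \<eta> t)); dist k y < \<delta>\<rbrakk> \<Longrightarrow> y \<in> ?U \<and> dist (?f y) (?f k) < e / 2"
    by (rule continuous_near_compact[OF _ open_cross_nonzero _ continuous_on_unit_normal, of _ "e / 2"])
      (use ne e in auto)
  define \<mu> where "\<mu> = min (\<delta> / 2) (e / 2)"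
  have \<mu>: "0 < \<mu>" "\<mu> \<le> \<delta> / 2" "\<mu> \<le> e / 2" using \<delta>(1) e by (auto simp: \<mu>_def)
  obtain \<gamma>1 d1 where 1: "analytic_curve \<gamma>1" "analytic_curve d1" "\<And>t. (\<gamma>1 has_vector_derivative d1 t) (at t)"
    "\<And>t. \<gamma>1 (t + pi) = \<gamma>1 t" "\<And>t. norm (d1 t - d0 t) < \<mu>"
    apply (rule analytic_closed_curve_approximation[OF \<gamma>0 d0per \<mu>(1)])
    subgoal premises prems by (rule that[OF prems(2-)])
    done
  obtain E where E: "analytic_curve E" "\<And>t. E (t + pi) = (-1) *\<^sub>R E t" "\<And>t. norm (E t - \<eta> t) < \<mu>"
  proof (rule analytic_half_periodic_approximation[of \<eta> "-1", OF \<eta>(1) _ _ \<mu>(1)])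
    fix E assume "analytic_curve E" "\<And>t. E (t + pi) = (-1) *\<^sub>R E t" "\<And>t. norm (E t - \<eta> t) < \<mu>"
    then show thesis by (rule that)
  qed (use \<eta>(2) in simp_all)
  have near: "(d1 t, E t) \<in> ?U \<and> dist (?f (d1 t, E t)) (?f (d0 t, \<eta> t)) < e / 2" for t
  proof (rule \<delta>(2))
    have "dist (d0 t, \<eta> t) (d1 t, E t) \<le> norm (d1 t - d0 t) + norm (E t - \<eta> t)"
      using dist_Pair_le[of "d0 t" "\<eta> t" "d1 t" "E t"]
      by (simp only: dist_norm norm_minus_commute)
    then show "dist (d0 t, \<eta> t) (d1 t, E t) < \<delta>" using 1(5)[of t] E(3)[of t] \<mu> by linarith
  qed auto
  have d1per: "d1 (t + pi) = d1 t" for t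
    using half_periodic_derivative[OF 1(3), of 1 t] 1(4) by simp
  obtain T e2 m k1 k2 where fr: "moving_frame T (\<lambda>t. unit_normal (d1 t) (E t)) e2 (\<lambda>t. norm (d1 t)) m k1 k2"
    and T: "\<And>t. norm (d1 t) *\<^sub>R T t = d1 t"
  proof (rule moving_frame_exists[OF 1(2) d1per E(1)])
    show "E (t + pi) = - E t" "cross3 (d1 t) (E t) \<noteq> 0" for t using E(2)[of t] near[of t] by simp_all
    fix T e2 m k1 k2
    assume "moving_frame T (\<lambda>t. unit_normal (d1 t) (E t)) e2 (\<lambda>t. norm (d1 t)) m k1 k2"
      "\<And>t. norm (d1 t) *\<^sub>R T t = d1 t"
    then show thesis by (rule that)
  qed
  have D1: "(\<gamma>1 has_vector_derivative norm (d1 t) *\<^sub>R T t) (at t)" for t unfolding T by (rule 1(3))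
  obtain \<gamma> d \<xi> where *: "parallel_strip \<gamma> d \<xi>"
    "\<forall>t. norm (d t - norm (d1 t) *\<^sub>R T t) < e / 2" "\<forall>t. norm (\<xi> t - unit_normal (d1 t) (E t)) < e / 2"
    by (rule moving_frame.exists_parallel_helix[OF fr 1(1) D1 1(4), of "e / 2"]) (use e in simp, rule that)
  show ?thesis
  proof (rule that[OF *(1)]; rule allI)
    show "norm (d t - d0 t) < e" for t
      using norm_triangle_ineq[of "d t - d1 t" "d1 t - d0 t"] *(2)[rule_format, of t] 1(5)[of t] \<mu> by (simp add: T)
    show "norm (\<xi> t - unit_normal (d0 t) (\<eta> t)) < e" for t
      using norm_triangle_ineq[of "\<xi> t - unit_normal (d1 t) (E t)" "unit_normal (d1 t) (E t) - unit_normal (d0 t) (\<eta> t)"]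
        *(3)[rule_format, of t] near[of t] by (simp add: dist_norm)
  qed
qed

text \<open>Without perturbation the direction moves between \<eta> and its unit normal component.
  Their cross products with d0 are positive multiples of each other, so it never becomes tangent.
  The pairs that occur form a compact subset of the open set of transversal pairs, which leaves a
  uniform margin.\<close>

lemma transversal_interpolation:
  fixes d0 \<eta> :: "real \<Rightarrow> real^3"
  assumes d0: "continuous_on UNIV d0" "\<And>t. d0 (t + pi) = d0 t"
    and \<eta>: "continuous_on UNIV \<eta>" "\<And>t. \<eta> (t + pi) = - \<eta> t"
    and ne: "\<And>t. cross3 (d0 t) (\<eta> t) \<noteq> 0"
  obtains \<mu> where "0 < \<mu>"
    "\<And>s t d \<xi>. \<lbrakk>s \<in> {0..1}; norm (d - d0 t) < \<mu>; norm (\<xi> - unit_normal (d0 t) (\<eta> t)) < \<mu>\<rbrakk> \<Longrightarrow>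
      cross3 (s *\<^sub>R d0 t + (1 - s) *\<^sub>R d) (s *\<^sub>R \<eta> t + (1 - s) *\<^sub>R \<xi>) \<noteq> 0"
proof -
  define n0 where "n0 t = unit_normal (d0 t) (\<eta> t)" for t
  \<comment> \<open>The first component is d0 t, written as a convex combination so that the
    perturbed pair arises by replacing the second d0 by d and n0 by \<xi>.\<close>
  define c where "c = (\<lambda>(s, t). (s *\<^sub>R d0 t + (1 - s) *\<^sub>R d0 t, s *\<^sub>R \<eta> t + (1 - s) *\<^sub>R n0 t))"
  let ?U = "{z::(real^3) \<times> (real^3). cross3 (fst z) (snd z) \<noteq> 0}"
  have n0c: "continuous_on UNIV n0"
  proof -
    have "continuous_on UNIV (\<lambda>t. (d0 t, \<eta> t))" by (intro continuous_intros d0 \<eta>)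
    from continuous_on_compose2[OF continuous_on_unit_normal this]
    have "continuous_on UNIV (\<lambda>x. unit_normal (fst (d0 x, \<eta> x)) (snd (d0 x, \<eta> x)))"
      using ne by (simp add: image_subset_iff)
    then show ?thesis by (simp add: n0_def[abs_def])
  qed
  have n0per: "n0 (t + pi) = - n0 t" for t by (simp add: n0_def d0 \<eta> unit_normal_minus)
  have "compact (range (\<lambda>t. (d0 t, \<eta> t, n0 t)))"
  proof (rule compact_range_periodic)
    show "continuous_on UNIV (\<lambda>t. (d0 t, \<eta> t, n0 t))" by (intro continuous_intros d0 \<eta> n0c)
    show "(d0 (t + 2 * pi), \<eta> (t + 2 * pi), n0 (t + 2 * pi)) = (d0 t, \<eta> t, n0 t)" for t
      using d0(2)[of "t + pi"] d0(2)[of t] \<eta>(2)[of "t + pi"] \<eta>(2)[of t] n0per[of "t + pi"] n0per[of t]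
      by (simp add: add.assoc)
  qed
  then have "compact ({0..1::real} \<times> range (\<lambda>t. (d0 t, \<eta> t, n0 t)))" by (intro compact_Times) auto
  then have "compact ((\<lambda>(s, x, y, z). (s *\<^sub>R x + (1 - s) *\<^sub>R x, s *\<^sub>R y + (1 - s) *\<^sub>R z)) `
      ({0..1} \<times> range (\<lambda>t. (d0 t, \<eta> t, n0 t))))"
    by (rule compact_continuous_image[rotated]) (auto simp: case_prod_unfold intro!: continuous_intros)
  moreover have "(\<lambda>(s, x, y, z). (s *\<^sub>R x + (1 - s) *\<^sub>R x, s *\<^sub>R y + (1 - s) *\<^sub>R z)) `
      ({0..1} \<times> range (\<lambda>t. (d0 t, \<eta> t, n0 t))) = c ` ({0..1} \<times> UNIV)"
    by (force simp: c_def)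
  ultimately have K: "compact (c ` ({0..1} \<times> UNIV))" by simp
  have sub: "c ` ({0..1} \<times> UNIV) \<subseteq> ?U"
  proof (rule image_subsetI)
    fix z :: "real \<times> real" assume z: "z \<in> {0..1} \<times> UNIV"
    obtain s t where st: "z = (s, t)" "0 \<le> s" "s \<le> 1" using z by auto
    obtain k where k: "0 < k" "cross3 (d0 t) (n0 t) = k *\<^sub>R cross3 (d0 t) (\<eta> t)"
      using unit_normal(3)[OF ne[of t]] by (auto simp: n0_def)
    have "s *\<^sub>R d0 t + (1 - s) *\<^sub>R d0 t = d0 t" by (simp add: algebra_simps)
    moreover have "cross3 (d0 t) (s *\<^sub>R \<eta> t + (1 - s) *\<^sub>R n0 t) = (s + (1 - s) * k) *\<^sub>R cross3 (d0 t) (\<eta> t)"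
      by (simp only: cross_add_right cross_mult_right k(2) scaleR_scaleR scaleR_add_left)
    moreover have "0 < s + (1 - s) * k"
    proof (cases "s = 0")
      case False
      then show ?thesis using st k(1) by (intro add_pos_nonneg) auto
    qed (use k in simp)
    ultimately show "c z \<in> ?U" using ne[of t] by (simp add: c_def st(1))
  qed
  obtain r where r: "0 < r" "(\<Union>x\<in>c ` ({0..1} \<times> UNIV). cball x r) \<subseteq> ?U"
    using compact_subset_open_imp_cball_epsilon_subset[OF K open_cross_nonzero sub] by blast
  show ?thesis
  proof (rule that[of "r / 2"])
    show "0 < r / 2" using r(1) by simp
    fix s t :: real and d \<xi> :: "real^3"
    assume *: "s \<in> {0..1}" "norm (d - d0 t) < r / 2" "norm (\<xi> - unit_normal (d0 t) (\<eta> t)) < r / 2"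
    let ?z = "(s *\<^sub>R d0 t + (1 - s) *\<^sub>R d, s *\<^sub>R \<eta> t + (1 - s) *\<^sub>R \<xi>)"
    have le: "norm ((1 - s) *\<^sub>R x) \<le> norm x" for x :: "real^3"
      using *(1) by (simp add: mult_left_le_one_le)
    have "dist (c (s, t)) ?z \<le> norm ((1 - s) *\<^sub>R (d - d0 t)) + norm ((1 - s) *\<^sub>R (\<xi> - n0 t))"
    proof -
      have *: "dist (y + (1 - s) *\<^sub>R x) (y + (1 - s) *\<^sub>R x') = norm ((1 - s) *\<^sub>R (x' - x))" for x x' y :: "real^3"
        by (simp add: norm_minus_commute[of x' x] dist_norm flip: scaleR_diff_right)
      show ?thesis using dist_Pair_le unfolding c_def prod.case by (metis *)
    qed
    also have "\<dots> \<le> r" using le[of "d - d0 t"] le[of "\<xi> - n0 t"] *(2,3) by (simp add: n0_def)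
    finally have "?z \<in> cball (c (s, t)) r" by simp
    then have "?z \<in> ?U" using r(2) *(1) by blast
    then show "cross3 (s *\<^sub>R d0 t + (1 - s) *\<^sub>R d) (s *\<^sub>R \<eta> t + (1 - s) *\<^sub>R \<xi>) \<noteq> 0" by simp
  qed
qed

text \<open>Simplicity concerns differences of values only, so closeness of velocities is enough.
  The secants of \<gamma>0 over parameter steps u, divided by u, are bounded below by compactness,
  and a velocity error below half of that bound cannot make a secant vanish.\<close>

lemma closed_curve_stability:
  fixes \<gamma>0 d0 :: "real \<Rightarrow> real^3"
  assumes \<gamma>0: "\<And>t. (\<gamma>0 has_vector_derivative d0 t) (at t)" "continuous_on UNIV d0" "\<And>t. \<gamma>0 (t + pi) = \<gamma>0 t"
    and reg: "\<And>t. d0 t \<noteq> 0" and simple: "\<And>x y. \<gamma>0 x = \<gamma>0 y \<Longrightarrow> \<exists>k::int. y = x + of_int k * pi"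
  obtains \<mu> where "0 < \<mu>"
    "\<And>\<gamma> d x y. \<lbrakk>\<And>t. (\<gamma> has_vector_derivative d t) (at t); \<And>t. \<gamma> (t + pi) = \<gamma> t; \<And>t. norm (d t - d0 t) < \<mu>; \<gamma> x = \<gamma> y\<rbrakk>
      \<Longrightarrow> \<exists>k::int. y = x + of_int k * pi"
proof -
  \<comment> \<open>The secant from x to x + u divided by u, as an integral: this form is continuous
    through u = 0, where its value is d0 x.\<close>
  define g where "g z = integral {0..1} (\<lambda>s. d0 (fst z + s * snd z))" for z :: "real \<times> real"
  \<comment> \<open>Modulo the period any two points have parameters at most pi / 2 apart; in this
    range a vanishing secant of \<gamma>0 means u = 0.\<close>
  define K where "K = {0..pi} \<times> {- pi / 2..pi / 2}"
  have g: "u *\<^sub>R g (x, u) = \<gamma>0 (x + u) - \<gamma>0 x" for x u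
  proof -
    have "((\<lambda>s. \<gamma>0 (x + s * u)) has_vector_derivative u *\<^sub>R d0 (x + s * u)) (at s within {0..1})" for s
    proof -
      have "((\<lambda>s. x + s * u) has_vector_derivative u) (at s)"
        by (auto intro!: derivative_eq_intros simp flip: has_real_derivative_iff_has_vector_derivative)
      from vector_diff_chain_at[OF this \<gamma>0(1)] show ?thesis
        by (simp add: o_def has_vector_derivative_at_within)
    qed
    then have hi: "((\<lambda>s. u *\<^sub>R d0 (x + s * u)) has_integral (\<gamma>0 (x + 1 * u) - \<gamma>0 (x + 0 * u))) {0..1}"
      by (intro fundamental_theorem_of_calculus) auto
    then show ?thesis using integral_unique[OF hi] by (simp add: g_def)
  qed
  have "continuous_on (K \<times> cbox 0 1) (\<lambda>(z, s). d0 (fst z + s * snd z))"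
    unfolding case_prod_unfold by (rule continuous_on_compose2[OF \<gamma>0(2)]) (auto intro!: continuous_intros)
  from integral_continuous_on_param[OF this] have gc: "continuous_on K (\<lambda>z. norm (g z))"
    unfolding g_def cbox_interval by (rule continuous_on_norm)
  have "compact K" unfolding K_def by (intro compact_Times compact_Icc)
  moreover have "(0, 0) \<in> K" by (simp add: K_def)
  then have "K \<noteq> {}" by blast
  ultimately have "\<exists>z0\<in>K. \<forall>z\<in>K. norm (g z0) \<le> norm (g z)"
    by (rule continuous_attains_inf[OF _ _ gc])
  then
  obtain z0 where "z0 \<in> K" "\<forall>z\<in>K. norm (g z0) \<le> norm (g z)" by (elim bexE)
  then have z0: "z0 \<in> K" "\<And>z. z \<in> K \<Longrightarrow> norm (g z0) \<le> norm (g z)" by simp_all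
  have gnz: "g z \<noteq> 0" if "z \<in> K" for z
  proof
    assume gz: "g z = 0"
    obtain x u where z: "z = (x, u)" by (cases z)
    have "\<gamma>0 x = \<gamma>0 (x + u)" using g[of u x] gz z by simp
    from simple[OF this] obtain k :: int where "x + u = x + of_int k * pi" by blast
    then have k: "u = of_int k * pi" by simp
    have "k = 0"
    proof (rule ccontr)
      assume "k \<noteq> 0"
      then have "1 \<le> \<bar>real_of_int k\<bar>" by linarith
      then have "pi \<le> \<bar>real_of_int k\<bar> * pi" by simp
      also have "\<dots> = \<bar>u\<bar>" using k by (simp add: abs_mult)
      also have "\<dots> \<le> pi / 2" using that z unfolding K_def by (auto simp: abs_le_iff)
      finally show False using pi_gt_zero by linarith
    qed
    then show False using gz k z reg by (simp add: g_def)
  qed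
  define \<mu> where "\<mu> = norm (g z0) / 2"
  have \<mu>: "0 < \<mu>" using gnz z0(1) by (simp add: \<mu>_def)
  show ?thesis
  proof (rule that[OF \<mu>])
    fix \<gamma> d :: "real \<Rightarrow> real^3" and x y
    assume \<gamma>: "\<And>t. (\<gamma> has_vector_derivative d t) (at t)" "\<And>t. \<gamma> (t + pi) = \<gamma> t" "\<And>t. norm (d t - d0 t) < \<mu>"
      and eq: "\<gamma> x = \<gamma> y"
    obtain j where j: "fst (deck j (x, 0)) \<in> {0..0 + pi}" by (rule deck_shift)
    define x' where "x' = x + of_int j * pi"
    obtain k where k: "fst (deck k (y, 0)) \<in> {x' - pi / 2..x' - pi / 2 + pi}" by (rule deck_shift)
    define y' where "y' = y + of_int k * pi"
    have zK: "(x', y' - x') \<in> K" using j k by (auto simp: K_def deck_def x'_def y'_def)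
    have "\<gamma> x' = \<gamma> y'"
      using eq periodic_int[of \<gamma> pi, OF \<gamma>(2)] by (simp add: x'_def y'_def)
    have D: "((\<lambda>t. \<gamma> t - \<gamma>0 t) has_derivative (\<lambda>a. a *\<^sub>R (d t - d0 t))) (at t within UNIV)" for t
      using has_vector_derivative_diff[OF \<gamma>(1) \<gamma>0(1)] by (simp add: has_vector_derivative_def)
    have "norm ((\<gamma> y' - \<gamma>0 y') - (\<gamma> x' - \<gamma>0 x')) \<le> \<mu> * norm (y' - x')"
    proof (rule differentiable_bound[OF convex_UNIV D])
      show "onorm (\<lambda>a. a *\<^sub>R (d t - d0 t)) \<le> \<mu>" for t
      proof (rule onorm_bound)
        fix a :: real
        have "\<bar>a\<bar> * norm (d t - d0 t) \<le> \<bar>a\<bar> * \<mu>" using \<gamma>(3)[of t] by (intro mult_left_mono) auto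
        then show "norm (a *\<^sub>R (d t - d0 t)) \<le> \<mu> * norm a" by (simp add: mult.commute)
      qed (use \<mu> in simp)
    qed auto
    then have "norm (\<gamma>0 y' - \<gamma>0 x') \<le> \<mu> * \<bar>y' - x'\<bar>"
      using \<open>\<gamma> x' = \<gamma> y'\<close> by (simp add: norm_minus_commute)
    moreover have "norm (\<gamma>0 y' - \<gamma>0 x') = \<bar>y' - x'\<bar> * norm (g (x', y' - x'))"
      using g[of "y' - x'" x'] by (metis add_diff_cancel_left' diff_add_cancel add.commute norm_scaleR)
    moreover have "\<bar>y' - x'\<bar> * (2 * \<mu>) \<le> \<bar>y' - x'\<bar> * norm (g (x', y' - x'))"
      using z0(2)[OF zK] by (intro mult_left_mono) (auto simp: \<mu>_def)
    moreover have "\<bar>y' - x'\<bar> * (2 * \<mu>) = 2 * (\<bar>y' - x'\<bar> * \<mu>)" "\<mu> * \<bar>y' - x'\<bar> = \<bar>y' - x'\<bar> * \<mu>"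
      by simp_all
    ultimately have "\<bar>y' - x'\<bar> * \<mu> \<le> 0" by linarith
    then have "\<bar>y' - x'\<bar> = 0" using \<mu> by (simp add: mult_le_0_iff)
    then have "y = x + of_int (j - k) * pi" by (simp add: x'_def y'_def algebra_simps)
    then show "\<exists>k::int. y = x + of_int k * pi" by blast
  qed
qed

section \<open>The isotopy\<close>

text \<open>Scaled to take the value 1 at 1 / 2, the largest argument that \<open>stage\<close> and
  \<open>width\<close> feed into it.\<close>

definition flat :: "real \<Rightarrow> real" where
  "flat x = inverse (flat_fun 1 (1 / 2)) * flat_fun 1 x"

lemma flat_half_pos: "0 < flat_fun 1 (1 / 2)"
  by (simp add: flat_fun_def)

lemma smooth_flat: "smooth_on flat UNIV"
  unfolding flat_def[abs_def] by (intro smooth_on_mult open_UNIV smooth_flat_fun smooth_on_const)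

lemma flat_values: "0 \<le> flat x" "x \<le> 0 \<Longrightarrow> flat x = 0" "flat (1 / 2) = 1" "x \<le> 1 / 2 \<Longrightarrow> flat x \<le> 1"
proof -
  show "0 \<le> flat x" "x \<le> 0 \<Longrightarrow> flat x = 0" "flat (1 / 2) = 1"
    using flat_half_pos by (simp_all add: flat_def flat_fun_def)
  assume x: "x \<le> 1 / 2"
  have "flat_fun 1 x \<le> flat_fun 1 (1 / 2)"
  proof (cases "0 < x")
    case True
    then have "inverse (1 / 2) \<le> inverse x" using x by (intro le_imp_inverse_le) auto
    then show ?thesis using True by (simp add: flat_fun_def)
  qed (simp add: flat_fun_def)
  then have "inverse (flat_fun 1 (1 / 2)) * flat_fun 1 x \<le> inverse (flat_fun 1 (1 / 2)) * flat_fun 1 (1 / 2)"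
    using flat_half_pos by (intro mult_left_mono) auto
  then show "flat x \<le> 1" using flat_half_pos by (simp add: flat_def)
qed

text \<open>It maps the whole line smoothly into [0, 1], so the isotopy extends to all real
  parameters without further gluing.\<close>

definition clock :: "real \<Rightarrow> real" where
  "clock s = (sin (pi * s / 2))\<^sup>2"

lemma clock_values: "0 \<le> clock s" "clock s \<le> 1" "clock 0 = 0" "clock 1 = 1"
  by (simp_all add: clock_def abs_square_le_1)

lemma smooth_real_sin: "smooth_on (sin :: real \<Rightarrow> real) UNIV"
proof -
  define D :: "nat \<Rightarrow> real \<Rightarrow> real" where "D n x = sin (x + of_nat n * (pi / 2))" for n x
  have "(D n has_vector_derivative D (Suc n) x) (at x)" for n x
  proof -
    have "(D n has_real_derivative cos (x + of_nat n * (pi / 2))) (at x)"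
      unfolding D_def[abs_def] by (auto intro!: derivative_eq_intros)
    moreover have "cos (x + of_nat n * (pi / 2)) = D (Suc n) x"
      by (simp add: D_def sin_add cos_add algebra_simps add_divide_distrib)
    ultimately show ?thesis by (simp add: has_real_derivative_iff_has_vector_derivative)
  qed
  from smooth_on_real_derivatives[of D 0, OF this] show ?thesis by (simp add: D_def[abs_def])
qed

lemma smooth_clock: "smooth_on clock UNIV"
proof -
  have "smooth_on (\<lambda>s. sin (pi / 2 * s)) UNIV"
    by (rule smooth_on_compose[OF open_UNIV open_UNIV subset_UNIV
        smooth_on_bounded_linear[OF bounded_linear_mult_right] smooth_real_sin])
  from smooth_on_mult[OF open_UNIV this this] show ?thesis
    by (simp add: clock_def[abs_def] power2_eq_square mult.commute)
qed

lemma real_smooth_compose: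
  fixes f :: "real \<Rightarrow> real" and g :: "real \<Rightarrow> real"
  assumes "smooth_on f UNIV" "smooth_on g UNIV"
  shows "smooth_on (\<lambda>x. g (f x)) UNIV"
  by (rule smooth_on_compose[OF open_UNIV open_UNIV _ assms]) simp

text \<open>During the first half of the isotopy the width is constant and the strip is deformed, during the
  second half the strip is constant and the width grows; flat functions glue the two halves.\<close>

definition stage :: "real \<Rightarrow> real" where
  "stage s = 1 - flat (1 / 2 - clock s)"

definition width :: "real \<Rightarrow> real \<Rightarrow> real" where
  "width w s = w + (1 - w) * flat (clock s - 1 / 2)"

lemma smooth_stage: "smooth_on stage UNIV"
proof -
  have "smooth_on (\<lambda>s. 1 / 2 - clock s) UNIV"
    by (intro smooth_on_diff smooth_on_const smooth_clock open_UNIV)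
  from smooth_on_diff[OF open_UNIV smooth_on_const[of 1] real_smooth_compose[OF this smooth_flat]]
  show ?thesis by (simp add: stage_def[abs_def])
qed

lemma smooth_width: "smooth_on (width w) UNIV"
proof -
  have "smooth_on (\<lambda>s. clock s - 1 / 2) UNIV"
    by (intro smooth_on_diff smooth_on_const smooth_clock open_UNIV)
  from smooth_on_add[OF open_UNIV smooth_on_const[of w] smooth_on_mult[OF open_UNIV smooth_on_const[of "1 - w"] real_smooth_compose[OF this smooth_flat]]]
  show ?thesis by (simp add: width_def[abs_def])
qed

lemma stage_values: "stage s \<in> {0..1}" "stage 0 = 0" "1 / 2 \<le> clock s \<Longrightarrow> stage s = 1"
  using flat_values(1,2,4)[of "1 / 2 - clock s"] clock_values(1)[of s] flat_values(3)
  by (auto simp: stage_def clock_values)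

lemma width_values:
  assumes "0 < w" "w < 1"
  shows "0 < width w s" "width w s \<le> 1" "clock s \<le> 1 / 2 \<Longrightarrow> width w s = w" "width w 1 = 1"
proof -
  have f: "0 \<le> flat (clock s - 1 / 2)" "flat (clock s - 1 / 2) \<le> 1"
    using flat_values(1,4)[of "clock s - 1 / 2"] clock_values(2)[of s] by auto
  show "0 < width w s" using f assms by (simp add: width_def add_pos_nonneg)
  have "(1 - w) * flat (clock s - 1 / 2) \<le> (1 - w) * 1" using f assms by (intro mult_left_mono) auto
  then show "width w s \<le> 1" by (simp add: width_def)
  show "clock s \<le> 1 / 2 \<Longrightarrow> width w s = w" by (simp add: width_def flat_values)
  show "width w 1 = 1" using flat_values(3) by (simp add: width_def clock_values)
qed

text \<open>The last clause is the chain rule for the generator of the deck group, whose linear part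
  is (a, b) \<mapsto> (a, - b).\<close>

lemma moebius_strip_lift:
  assumes "moebius_strip g"
  defines "G \<equiv> g \<circ> moebius_cover"
  shows "smooth_on G band" "\<And>x. x \<in> band \<Longrightarrow> inj (frechet_derivative G (at x))"
    "\<And>\<theta> t. G (\<theta> + pi, - t) = G (\<theta>, t)"
    "\<And>x y. \<lbrakk>x \<in> band; y \<in> band; G x = G y\<rbrakk> \<Longrightarrow> moebius_cover x = moebius_cover y"
    "\<And>\<theta> t a b. \<bar>t\<bar> < 1 \<Longrightarrow> frechet_derivative G (at (\<theta> + pi, - t)) (a, b) = frechet_derivative G (at (\<theta>, t)) (a, - b)"
proof -
  show smooth: "smooth_on G band" and "\<And>x. x \<in> band \<Longrightarrow> inj (frechet_derivative G (at x))"
    using assms(1) unfolding moebius_strip_def G_def by blast+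
  show inv: "G (\<theta> + pi, - t) = G (\<theta>, t)" for \<theta> t by (simp add: G_def moebius_cover_deck)
  have "embedding_map moebius_topology euclidean g" using assms(1) unfolding moebius_strip_def by blast
  then have "inj_on g moebius_band"
    unfolding embedding_map_def topspace_moebius_topology[symmetric] by (rule homeomorphic_imp_injective_map)
  then show "moebius_cover x = moebius_cover y" if "x \<in> band" "y \<in> band" "G x = G y" for x y
    using that moebius_cover_image by (auto simp: G_def inj_on_def)
  show "frechet_derivative G (at (\<theta> + pi, - t)) (a, b) = frechet_derivative G (at (\<theta>, t)) (a, - b)"
    if t: "\<bar>t\<bar> < 1" for \<theta> t a b
  proof -
    let ?D = "\<lambda>x. frechet_derivative G (at x)"
    have "((\<lambda>x::real \<times> real. (fst x + pi, - snd x)) has_derivative (\<lambda>v. (fst v, - snd v))) (at (\<theta>, t))"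
      by (auto intro!: derivative_eq_intros)
    moreover have "(G has_derivative ?D (\<theta> + pi, - t)) (at (\<theta> + pi, - t))"
      by (rule smooth_on_imp_derivative[OF smooth]) (use t in auto)
    ultimately have "((\<lambda>x. G (fst x + pi, - snd x)) has_derivative (\<lambda>v. ?D (\<theta> + pi, - t) (fst v, - snd v))) (at (\<theta>, t))"
      using diff_chain_at[of "\<lambda>x. (fst x + pi, - snd x)" "\<lambda>v. (fst v, - snd v)" "(\<theta>, t)" G] by (simp add: o_def)
    then have "(G has_derivative (\<lambda>v. ?D (\<theta> + pi, - t) (fst v, - snd v))) (at (\<theta>, t))"
      by (simp add: inv)
    from fun_cong[OF frechet_derivative_at[OF this], of "(a, - b)"] show ?thesis by simp
  qed
qed

lemma frechet_derivative_pair: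
  fixes G :: "real \<times> real \<Rightarrow> 'a::real_normed_vector"
  assumes "smooth_on G S" "x \<in> S"
  shows "frechet_derivative G (at x) v =
    fst v *\<^sub>R frechet_derivative G (at x) (1, 0) + snd v *\<^sub>R frechet_derivative G (at x) (0, 1)"
proof -
  have l: "linear (frechet_derivative G (at x))"
    using smooth_on_imp_derivative[OF assms] has_derivative_linear by blast
  have "v = fst v *\<^sub>R (1, 0) + snd v *\<^sub>R (0, 1)" by (simp add: prod_eq_iff)
  then show ?thesis by (metis linear_add[OF l] linear_scale[OF l])
qed

theorem theoremA:
  fixes g :: "(complex \<times> real) set \<Rightarrow> real^3"
  assumes "moebius_strip g"
  shows "\<exists>f. principal_analytic_moebius_developable f \<and> moebius_isotopic f g"
proof -
  define G where "G = g \<circ> moebius_cover"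
  note G = moebius_strip_lift[OF assms, folded G_def]
  define DG where "DG x v = frechet_derivative G (at x) v" for x v
  have DG: "(G has_derivative (\<lambda>v. fst v *\<^sub>R DG x (1, 0) + snd v *\<^sub>R DG x (0, 1))) (at x)" if "x \<in> band" for x
    unfolding DG_def
    by (rule has_derivative_eq_rhs[OF smooth_on_imp_derivative[OF G(1) that]])
      (rule ext, rule frechet_derivative_pair[OF G(1) that])
  have DGc: "continuous_on band (\<lambda>x. DG x v)" for v
    unfolding DG_def by (intro smooth_on_imp_continuous_on smooth_on_frechet_derivative G(1))
  have DGp: "DG (\<theta> + pi, - t) (a, b) = DG (\<theta>, t) (a, - b)" if "\<bar>t\<bar> < 1" for \<theta> t a b
    unfolding DG_def by (rule G(5)[OF that])
  define \<gamma>0 where "\<gamma>0 \<theta> = G (\<theta>, 0)" for \<theta>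
  define d0 where "d0 \<theta> = DG (\<theta>, 0) (1, 0)" for \<theta>
  define \<eta> where "\<eta> \<theta> = DG (\<theta>, 0) (0, 1)" for \<theta>
  have core_band: "(\<theta>, 0) \<in> band" for \<theta> by simp
  have \<gamma>0': "(\<gamma>0 has_vector_derivative d0 t) (at t)" for t
  proof -
    have "((\<lambda>\<theta>. (\<theta>, 0::real)) has_derivative (\<lambda>a. (a, 0))) (at t)" by (auto intro!: derivative_eq_intros)
    from diff_chain_at[OF this DG[OF core_band]] show ?thesis
      by (simp add: o_def \<gamma>0_def[abs_def] d0_def has_vector_derivative_def)
  qed
  have cont: "continuous_on UNIV d0" "continuous_on UNIV \<eta>"
    unfolding d0_def[abs_def] \<eta>_def[abs_def]
    by (rule continuous_on_compose2[OF DGc]; auto intro!: continuous_intros)+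
  have \<gamma>0p: "\<gamma>0 (t + pi) = \<gamma>0 t" for t using G(3)[of t 0] by (simp add: \<gamma>0_def)
  have d0p: "d0 (t + pi) = d0 t" for t using DGp[of 0 t 1 0] by (simp add: d0_def)
  have DGneg: "DG x (0, - 1) = - DG x (0, 1)" if "x \<in> band" for x
    using frechet_derivative_pair[OF G(1) that, of "(0, - 1)"] by (simp add: DG_def)
  have \<eta>p: "\<eta> (t + pi) = - \<eta> t" for t
    using DGp[of 0 t 0 1] DGneg[OF core_band] by (simp add: \<eta>_def)
  have indep0: "a = 0 \<and> b = 0" if "a *\<^sub>R d0 t + b *\<^sub>R \<eta> t = 0" for a b t
  proof -
    have "frechet_derivative G (at (t, 0)) (a, b) = frechet_derivative G (at (t, 0)) (0, 0)"
      using that frechet_derivative_pair[OF G(1) core_band, of t "(a, b)"]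
        frechet_derivative_pair[OF G(1) core_band, of t "(0, 0)"] by (simp add: d0_def \<eta>_def DG_def)
    then have "(a, b) = (0, 0)" using G(2)[OF core_band] by (rule injD[rotated])
    then show ?thesis by simp
  qed
  have independent_iff: "a = 0 \<and> b = 0" if "cross3 x y \<noteq> 0" "a *\<^sub>R x + b *\<^sub>R y = 0" for a b :: real and x y :: "real^3"
  proof -
    have "b *\<^sub>R cross3 x y = cross3 x (a *\<^sub>R x + b *\<^sub>R y)" "a *\<^sub>R cross3 x y = cross3 (a *\<^sub>R x + b *\<^sub>R y) y"
      by (simp_all add: cross_add_right cross_add_left cross_mult_left cross_mult_right)
    then show ?thesis unfolding that(2) using that(1) by simp
  qed
  have ne: "cross3 (d0 t) (\<eta> t) \<noteq> 0" for t
  proof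
    assume "cross3 (d0 t) (\<eta> t) = 0"
    moreover have "d0 t \<noteq> 0" using indep0[of 1 t 0] by auto
    ultimately have "(d0 t \<bullet> d0 t) *\<^sub>R \<eta> t = (d0 t \<bullet> \<eta> t) *\<^sub>R d0 t"
      using Lagrange[of "d0 t" "d0 t" "\<eta> t"] by simp
    then have "(- (d0 t \<bullet> \<eta> t)) *\<^sub>R d0 t + (d0 t \<bullet> d0 t) *\<^sub>R \<eta> t = 0" by simp
    from indep0[OF this] \<open>d0 t \<noteq> 0\<close> show False by simp
  qed
  have simple0: "\<exists>k::int. y = x + of_int k * pi" if "\<gamma>0 x = \<gamma>0 y" for x y
  proof -
    have "moebius_cover (x, 0) = moebius_cover (y, 0)"
      using that by (intro G(4) core_band) (simp add: \<gamma>0_def)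
    then obtain k where "(y, 0) = deck k (x, 0)" using moebius_cover_eq_iff by blast
    then show ?thesis by (auto simp: deck_def)
  qed
  have d0nz: "d0 t \<noteq> 0" for t using normal_part_nonzero(2)[OF ne[of t]] .
  obtain \<mu>1 where \<mu>1: "0 < \<mu>1"
    "\<And>s t d \<xi>. \<lbrakk>s \<in> {0..1}; norm (d - d0 t) < \<mu>1; norm (\<xi> - unit_normal (d0 t) (\<eta> t)) < \<mu>1\<rbrakk> \<Longrightarrow>
      cross3 (s *\<^sub>R d0 t + (1 - s) *\<^sub>R d) (s *\<^sub>R \<eta> t + (1 - s) *\<^sub>R \<xi>) \<noteq> 0"
    apply (rule transversal_interpolation[OF cont(1) d0p cont(2) \<eta>p ne])
    subgoal premises prems by (rule that[OF prems(2-)])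
    done
  obtain \<mu>2 where \<mu>2: "0 < \<mu>2"
    "\<And>\<gamma> d x y. \<lbrakk>\<And>t. (\<gamma> has_vector_derivative d t) (at t); \<And>t. \<gamma> (t + pi) = \<gamma> t; \<And>t. norm (d t - d0 t) < \<mu>2; \<gamma> x = \<gamma> y\<rbrakk>
      \<Longrightarrow> \<exists>k::int. y = x + of_int k * pi"
    apply (rule closed_curve_stability[OF \<gamma>0' cont(1) \<gamma>0p d0nz simple0])
     apply assumption
    subgoal premises prems by (rule that[OF prems(2-)])
    done
  \<comment> \<open>One tolerance for two conditions: transversality of the interpolated directions
    and simplicity of the interpolated cores.\<close>
  define e where "e = min \<mu>1 \<mu>2"
  have e: "0 < e" "e \<le> \<mu>1" "e \<le> \<mu>2" using \<mu>1(1) \<mu>2(1) by (auto simp: e_def)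
  obtain \<gamma> d \<xi> where strip: "parallel_strip \<gamma> d \<xi>"
    "\<forall>t. norm (d t - d0 t) < e" "\<forall>t. norm (\<xi> t - unit_normal (d0 t) (\<eta> t)) < e"
    by (rule parallel_approximation[OF \<gamma>0' cont(1) \<gamma>0p cont(2) \<eta>p ne e(1)]) (rule that)
  note \<gamma> = parallel_stripD(1-5)[OF strip(1)] strip(2,3)[rule_format] parallel_stripD(6,7)[OF strip(1)]
  obtain d' where d': "analytic_curve d'" "\<And>t. (\<gamma> has_vector_derivative d' t) (at t)"
    using analytic_curve_derivative[OF \<gamma>(1)] by blast
  \<comment> \<open>\<open>parallel_strip\<close> does not record that d is analytic; uniqueness of
    derivatives supplies it.\<close>
  have "d' = d" using vector_derivative_unique_at[OF d'(2) \<gamma>(3)] by (rule ext)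
  then have ad: "analytic_curve d" using d'(1) by simp
  obtain \<xi>' where \<xi>': "analytic_curve \<xi>'" "\<And>t. (\<xi> has_vector_derivative \<xi>' t) (at t)"
    using analytic_curve_derivative[OF \<gamma>(2)] by blast
  have dp: "d (t + pi) = d t" for t using half_periodic_derivative[OF \<gamma>(3), of 1 t] \<gamma>(4) by simp
  have \<xi>'p: "\<xi>' (t + pi) = - \<xi>' t" for t using half_periodic_derivative[OF \<xi>'(2), of "-1" t] \<gamma>(5) by simp
  have transversal: "cross3 (s *\<^sub>R d0 t + (1 - s) *\<^sub>R d t) (s *\<^sub>R \<eta> t + (1 - s) *\<^sub>R \<xi> t) \<noteq> 0"
    if "s \<in> {0..1}" for s t
    by (rule \<mu>1(2)[OF that]) (use \<gamma>(6)[of t] \<gamma>(7)[of t] e in linarith)+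

  define F where "F x = \<gamma> (fst x) + snd x *\<^sub>R \<xi> (fst x)" for x :: "real \<times> real"
  \<comment> \<open>The ruled strip at s = 0, the given one at s = 1; P and Q are the partial
    derivatives in angle and width.\<close>
  define \<Phi> where "\<Phi> s x = s *\<^sub>R G x + (1 - s) *\<^sub>R F x" for s x
  define P where "P s x = s *\<^sub>R DG x (1, 0) + (1 - s) *\<^sub>R (d (fst x) + snd x *\<^sub>R \<xi>' (fst x))" for s x
  define Q where "Q s x = s *\<^sub>R DG x (0, 1) + (1 - s) *\<^sub>R \<xi> (fst x)" for s and x :: "real \<times> real"
  have Fsmooth: "smooth_on F UNIV"
  proof -
    have 1: "smooth_on (\<lambda>x::real \<times> real. h (fst x)) UNIV" if "analytic_curve h" for h
      by (rule smooth_on_compose[OF open_UNIV open_UNIV _ _ analytic_curve_imp_smooth_on[OF that]])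
        (simp_all add: smooth_on_bounded_linear bounded_linear_fst)
    have 2: "smooth_on (snd :: real \<times> real \<Rightarrow> real) UNIV"
      by (rule smooth_on_bounded_linear[OF bounded_linear_snd])
    show ?thesis unfolding F_def[abs_def]
      by (intro smooth_on_add smooth_on_scaleR open_UNIV 1 2 \<gamma>(1,2))
  qed
  have Fder: "(F has_derivative (\<lambda>v. fst v *\<^sub>R (d (fst x) + snd x *\<^sub>R \<xi>' (fst x)) + snd v *\<^sub>R \<xi> (fst x))) (at x)" for x
  proof -
    have 1: "((\<lambda>x::real \<times> real. h (fst x)) has_derivative (\<lambda>v. fst v *\<^sub>R h')) (at x)"
      if "(h has_vector_derivative h') (at (fst x))" for h :: "real \<Rightarrow> real^3" and h'
      using diff_chain_at[of fst fst x h "\<lambda>a. a *\<^sub>R h'"] that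
      by (auto simp: o_def has_vector_derivative_def intro: bounded_linear_imp_has_derivative bounded_linear_fst)
    have "(F has_derivative (\<lambda>v. fst v *\<^sub>R d (fst x) + (snd x *\<^sub>R (fst v *\<^sub>R \<xi>' (fst x)) + snd v *\<^sub>R \<xi> (fst x)))) (at x)"
      unfolding F_def[abs_def]
      by (intro has_derivative_add has_derivative_scaleR 1 \<gamma>(3) \<xi>'(2) bounded_linear_imp_has_derivative bounded_linear_snd)
    then show ?thesis by (simp add: algebra_simps)
  qed
  have Finv: "F (\<theta> + pi, - t) = F (\<theta>, t)" for \<theta> t by (simp add: F_def \<gamma>)
  have \<Phi>inv: "\<Phi> s (\<theta> + pi, - t) = \<Phi> s (\<theta>, t)" for s \<theta> t by (simp add: \<Phi>_def Finv G(3))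
  have \<Phi>smooth: "smooth_on (\<Phi> s) band" for s
    unfolding \<Phi>_def[abs_def]
    by (intro smooth_on_add smooth_on_scaleR open_band smooth_on_const G(1) smooth_on_subset[OF Fsmooth subset_UNIV])
  have \<Phi>der: "(\<Phi> s has_derivative (\<lambda>v. fst v *\<^sub>R P s x + snd v *\<^sub>R Q s x)) (at x)" if "x \<in> band" for s x
  proof -
    have "(\<Phi> s has_derivative (\<lambda>v. s *\<^sub>R (fst v *\<^sub>R DG x (1, 0) + snd v *\<^sub>R DG x (0, 1)) +
        (1 - s) *\<^sub>R (fst v *\<^sub>R (d (fst x) + snd x *\<^sub>R \<xi>' (fst x)) + snd v *\<^sub>R \<xi> (fst x)))) (at x)"
      unfolding \<Phi>_def[abs_def]
      by (intro has_derivative_add has_derivative_scaleR_right DG[OF that] Fder)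
    then show ?thesis
      by (rule has_derivative_eq_rhs) (simp add: P_def Q_def fun_eq_iff algebra_simps)
  qed
  have c1: "continuous_on ({0..1} \<times> band) (\<lambda>z. DG (snd z) v)" for v
    by (rule continuous_on_compose2[OF DGc]) (auto intro!: continuous_intros)
  have c2: "continuous_on ({0..1} \<times> band) (\<lambda>z. h (fst (snd z)))" if "analytic_curve h" for h
    by (rule continuous_on_compose2[OF analytic_curve_imp_continuous_on[OF that, of UNIV]]) (auto intro!: continuous_intros)
  have c3: "continuous_on ({0..1} \<times> band) (\<lambda>z. G (snd z))"
    by (rule continuous_on_compose2[OF smooth_on_imp_continuous_on[OF G(1)]]) (auto intro!: continuous_intros)
  have core: "\<exists>k::int. y = x + of_int k * pi" if "s \<in> {0..1}" "\<Phi> s (x, 0) = \<Phi> s (y, 0)" for s x y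
  proof (rule \<mu>2(2)[of "\<lambda>\<theta>. s *\<^sub>R \<gamma>0 \<theta> + (1 - s) *\<^sub>R \<gamma> \<theta>" "\<lambda>\<theta>. s *\<^sub>R d0 \<theta> + (1 - s) *\<^sub>R d \<theta>"])
    show "((\<lambda>\<theta>. s *\<^sub>R \<gamma>0 \<theta> + (1 - s) *\<^sub>R \<gamma> \<theta>) has_vector_derivative s *\<^sub>R d0 t + (1 - s) *\<^sub>R d t) (at t)" for t
      by (intro has_vector_derivative_add bounded_linear.has_vector_derivative[OF bounded_linear_scaleR_right] \<gamma>0' \<gamma>(3))
    show "norm (s *\<^sub>R d0 t + (1 - s) *\<^sub>R d t - d0 t) < \<mu>2" for t
    proof -
      have "s *\<^sub>R d0 t + (1 - s) *\<^sub>R d t - d0 t = (1 - s) *\<^sub>R (d t - d0 t)" by (simp add: algebra_simps)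
      also have "norm \<dots> \<le> norm (d t - d0 t)" using that(1) by (simp add: mult_left_le_one_le)
      finally show ?thesis using \<gamma>(6)[of t] e(3) by linarith
    qed
    show "s *\<^sub>R \<gamma>0 (t + pi) + (1 - s) *\<^sub>R \<gamma> (t + pi) = s *\<^sub>R \<gamma>0 t + (1 - s) *\<^sub>R \<gamma> t" for t
      by (simp add: \<gamma>0p \<gamma>)
    show "s *\<^sub>R \<gamma>0 x + (1 - s) *\<^sub>R \<gamma> x = s *\<^sub>R \<gamma>0 y + (1 - s) *\<^sub>R \<gamma> y"
      using that(2) by (simp add: \<Phi>_def F_def \<gamma>0_def)
  qed
  obtain w where w: "0 < w" "w < 1"
    "\<And>s \<theta> t. \<lbrakk>s \<in> {0..1}; \<bar>t\<bar> \<le> w\<rbrakk> \<Longrightarrow>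
      inj (\<lambda>v::real \<times> real. fst v *\<^sub>R P s (\<theta>, t) + snd v *\<^sub>R Q s (\<theta>, t))"
    "\<And>s \<theta> t \<eta> u. \<lbrakk>s \<in> {0..1}; \<bar>t\<bar> \<le> w; \<bar>u\<bar> \<le> w; \<Phi> s (\<theta>, t) = \<Phi> s (\<eta>, u)\<rbrakk> \<Longrightarrow>
      moebius_cover (\<theta>, t) = moebius_cover (\<eta>, u)"
  proof (rule narrow_band_embedded[of \<Phi> P Q])
    show "continuous_on ({0..1} \<times> band) (\<lambda>z. P (fst z) (snd z))"
      unfolding P_def by (intro continuous_intros c1 c2 ad \<xi>'(1))
    show "continuous_on ({0..1} \<times> band) (\<lambda>z. Q (fst z) (snd z))"
      unfolding Q_def by (intro continuous_intros c1 c2 \<gamma>(2))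
    show "continuous_on ({0..1} \<times> band) (\<lambda>z. \<Phi> (fst z) (snd z))"
      unfolding \<Phi>_def F_def by (intro continuous_intros c2 c3 \<gamma>(1,2))
    show "P s (\<theta> + pi, - t) = P s (\<theta>, t)" if "\<bar>t\<bar> < 1" for s \<theta> t
      using DGp[OF that, of \<theta> 1 0] by (simp add: P_def dp \<xi>'p)
    show "Q s (\<theta> + pi, - t) = - Q s (\<theta>, t)" if "\<bar>t\<bar> < 1" for s \<theta> t
    proof -
      have "(\<theta>, t) \<in> band" using that by auto
      then show ?thesis using DGp[OF that, of \<theta> 0 1] DGneg by (simp add: Q_def \<gamma>(5))
    qed
    show "a = 0 \<and> b = 0" if "s \<in> {0..1}" "a *\<^sub>R P s (\<theta>, 0) + b *\<^sub>R Q s (\<theta>, 0) = 0" for s \<theta> a b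
      by (rule independent_iff[OF transversal[OF that(1), of \<theta>]])
        (use that(2) in \<open>simp add: P_def Q_def d0_def \<eta>_def\<close>)
    show "\<exists>k::int. y = x + of_int k * pi" if "s \<in> {0..1}" "\<Phi> s (x, 0) = \<Phi> s (y, 0)" for s x y
      by (rule core[OF that])
    fix w :: real
    assume "0 < w" "w < 1"
      "\<And>s \<theta> t. \<lbrakk>s \<in> {0..1}; \<bar>t\<bar> \<le> w\<rbrakk> \<Longrightarrow>
        inj (\<lambda>v::real \<times> real. fst v *\<^sub>R P s (\<theta>, t) + snd v *\<^sub>R Q s (\<theta>, t))"
      "\<And>s \<theta> t \<eta> u. \<lbrakk>s \<in> {0..1}; \<bar>t\<bar> \<le> w; \<bar>u\<bar> \<le> w; \<Phi> s (\<theta>, t) = \<Phi> s (\<eta>, u)\<rbrakk> \<Longrightarrow>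
        moebius_cover (\<theta>, t) = moebius_cover (\<eta>, u)"
    then show thesis by (rule that)
  qed (rule \<Phi>der \<Phi>inv; assumption)+

  \<comment> \<open>The interpolation is embedded on the narrow band only, so the width starts to
    grow only after the given strip has been reached.\<close>
  define H where "H s = descend (\<lambda>(\<theta>, t). \<Phi> (stage s) (\<theta>, width w s * t))" for s
  note wv = width_values[OF w(1,2)]
  have Hcov: "H s (moebius_cover x) = \<Phi> (stage s) (fst x, width w s * snd x)" if "x \<in> band" for s x
    using descend_moebius_cover[of "\<lambda>(\<theta>, t). \<Phi> (stage s) (\<theta>, width w s * t)" x] that \<Phi>inv[of "stage s"]
    by (simp add: H_def case_prod_unfold)
  have \<Phi>1: "\<Phi> 1 = G" by (rule ext) (simp add: \<Phi>_def)
  have H1: "H s c = g c" if end_values: "stage s = 1" "width w s = 1" "c \<in> moebius_band" for s c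
  proof -
    obtain x where "x \<in> band" "c = moebius_cover x"
      using end_values(3) unfolding moebius_cover_image[symmetric] by auto
    then show ?thesis using Hcov[of x s] end_values by (simp add: \<Phi>1 G_def)
  qed
  have strips: "moebius_strip (H s)" for s
  proof (cases "clock s \<le> 1 / 2")
    case True
    then have ws: "width w s = w" by (rule wv)
    show ?thesis
      unfolding H_def ws
    proof (rule moebius_strip_descend[OF w(1,2) \<Phi>inv \<Phi>smooth])
      show "inj (frechet_derivative (\<Phi> (stage s)) (at (\<theta>, t)))" if "\<bar>t\<bar> \<le> w" for \<theta> t
      proof -
        have "(\<theta>, t) \<in> band" using that w(2) by auto
        from frechet_derivative_at[OF \<Phi>der[OF this]] show ?thesis
          using w(3)[OF stage_values(1) that, of s \<theta>] by simp
      qed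
      show "moebius_cover (\<theta>, t) = moebius_cover (\<eta>, u)"
        if "\<bar>t\<bar> \<le> w" "\<bar>u\<bar> \<le> w" "\<Phi> (stage s) (\<theta>, t) = \<Phi> (stage s) (\<eta>, u)" for \<theta> t \<eta> u
        by (rule w(4)[OF stage_values(1) that])
    qed
  next
    case False
    then have st: "stage s = 1" by (intro stage_values) simp
    \<comment> \<open>Full width is treated apart: \<open>moebius_strip_descend\<close> needs a
      width below 1, but there the map equals g on the band.\<close>
    show ?thesis
    proof (cases "width w s = 1")
      case True
      show ?thesis by (rule moebius_strip_cong[OF assms]) (simp add: H1 st True)
    next
      case False
      then have w1: "width w s < 1" using wv(2)[of s] by simp
      show ?thesis
        unfolding H_def st \<Phi>1
      proof (rule moebius_strip_descend[OF wv(1) w1 G(3) G(1)])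
        show "inj (frechet_derivative G (at (\<theta>, t)))" if "\<bar>t\<bar> \<le> width w s" for \<theta> t
          by (rule G(2)) (use that w1 in auto)
        show "moebius_cover (\<theta>, t) = moebius_cover (\<eta>, u)"
          if "\<bar>t\<bar> \<le> width w s" "\<bar>u\<bar> \<le> width w s" "G (\<theta>, t) = G (\<eta>, u)" for \<theta> t \<eta> u
          by (rule G(4)[OF _ _ that(3)]) (use that(1,2) w1 in auto)
      qed
    qed
  qed
  have Hsmooth: "smooth_on (\<lambda>(s, x). H s (moebius_cover x)) (UNIV \<times> band)"
  proof -
    let ?O = "(UNIV :: real set) \<times> band"
    define L where "L z = (fst (snd z), width w (fst z) * snd (snd z))" for z :: "real \<times> real \<times> real"
    have o: "open ?O" by (intro open_Times open_UNIV open_band)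
    have fst_smooth: "smooth_on (fst :: real \<times> real \<times> real \<Rightarrow> real) ?O"
      by (rule smooth_on_bounded_linear[OF bounded_linear_fst])
    have S: "smooth_on (\<lambda>z. stage (fst z)) ?O"
      by (rule smooth_on_compose[OF o open_UNIV _ fst_smooth smooth_stage]) simp
    have Wd: "smooth_on (\<lambda>z. width w (fst z)) ?O"
      by (rule smooth_on_compose[OF o open_UNIV _ fst_smooth smooth_width]) simp
    have ss: "smooth_on (\<lambda>z::real \<times> real \<times> real. fst (snd z)) ?O" "smooth_on (\<lambda>z::real \<times> real \<times> real. snd (snd z)) ?O"
      by (rule smooth_on_bounded_linear,
          rule bounded_linear_compose[OF bounded_linear_fst bounded_linear_snd] bounded_linear_compose[OF bounded_linear_snd bounded_linear_snd])+
    have Ls: "smooth_on L ?O" unfolding L_def[abs_def]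
      by (intro smooth_on_Pair o ss smooth_on_mult Wd)
    have Lb: "L ` ?O \<subseteq> band"
    proof (rule image_subsetI)
      fix z assume z: "z \<in> ?O"
      have "\<bar>width w (fst z) * snd (snd z)\<bar> \<le> \<bar>snd (snd z)\<bar>"
        using wv(1,2)[of "fst z"] by (simp add: abs_mult mult_left_le_one_le)
      moreover have "\<bar>snd (snd z)\<bar> < 1" using z by (auto simp: abs_less_iff)
      ultimately show "L z \<in> band" by (auto simp: L_def abs_less_iff)
    qed
    have "smooth_on (\<lambda>z. stage (fst z) *\<^sub>R G (L z) + (1 - stage (fst z)) *\<^sub>R F (L z)) ?O"
      by (intro smooth_on_add smooth_on_scaleR smooth_on_diff o S smooth_on_const
          smooth_on_compose[OF o open_band Lb Ls G(1)] smooth_on_compose[OF o open_UNIV subset_UNIV Ls Fsmooth])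
    then show ?thesis
      by (rule smooth_on_cong[OF o, rotated]) (auto simp: Hcov \<Phi>_def L_def)
  qed
  define f where "f = H 0"
  have "moebius_isotopic f g"
    unfolding moebius_isotopic_def
  proof (intro exI[of _ H] conjI ballI)
    have "stage 1 = 1" by (rule stage_values(3)) (simp add: clock_values)
    then show "H 1 ` moebius_band = g ` moebius_band"
      using H1[of 1] wv(4) by auto
  qed (use Hsmooth strips in \<open>simp_all add: f_def\<close>)
  moreover have "principal_analytic_moebius_developable f"
  proof -
    have vd: "vector_derivative \<gamma> (at t) = d t" "vector_derivative \<xi> (at t) = \<xi>' t" for t
      by (rule vector_derivative_at, rule \<gamma>(3) \<xi>'(2))+
    have cr: "cross3 (d t) (\<xi> t) \<noteq> 0" for t using transversal[of 0 t] by simp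
    \<comment> \<open>With c = pi and \<epsilon> = w the rescaling in the definition is the one
      built into \<open>H 0\<close>, so f itself is the witness for F.\<close>
    have "moebius_developable_along pi w \<gamma> \<xi> f"
      unfolding moebius_developable_along_def vd
    proof (intro conjI allI exI[of _ f] ballI)
      show "moebius_strip f" "moebius_strip f" by (simp_all add: f_def strips)
      show "smooth_on \<gamma> UNIV" "smooth_on \<xi> UNIV" by (simp_all add: analytic_curve_imp_smooth_on \<gamma>)
      show "inj_on \<gamma> {0..<pi}"
      proof (rule inj_onI)
        fix x y assume xy: "x \<in> {0..<pi}" "y \<in> {0..<pi}" "\<gamma> x = \<gamma> y"
        \<comment> \<open>At s = 0 the interpolated core is \<gamma> itself.\<close>
        then obtain k :: int where k: "y = x + of_int k * pi" using core[of 0 x y] by (auto simp: \<Phi>_def F_def)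
        have "\<bar>of_int k * pi\<bar> < 1 * pi" using xy(1,2) k unfolding atLeastLessThan_iff by linarith
        then have "\<bar>real_of_int k\<bar> < 1" by (simp only: abs_mult abs_of_pos[OF pi_gt_zero] mult_less_cancel_right_pos[OF pi_gt_zero])
        then show "x = y" using k by simp
      qed
      show "d t \<noteq> 0" for t using cr[of t] by auto
      show "cross3 (d t) (\<xi> t) \<noteq> 0" for t by (rule cr)
      show "det (vector [d t, \<xi> t, \<xi>' t] :: real^3^3) = 0" for t
        using \<gamma>(9)[OF \<xi>'(2), of t] dot_cross_det[of "d t" "\<xi> t" "\<xi>' t"] cross_triple[of "d t" "\<xi> t" "\<xi>' t"]
        by (simp add: inner_commute)
      show "f (moebius_cover (\<theta>, \<tau>)) = \<gamma> (pi * \<theta> / pi) + (w * \<tau>) *\<^sub>R \<xi> (pi * \<theta> / pi)" if "\<tau> \<in> {-1<..<1}" for \<theta> \<tau>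
        using Hcov[of "(\<theta>, \<tau>)" 0] that wv(3)[of 0]
        by (simp add: f_def stage_values(2) clock_values \<Phi>_def F_def)
    qed (use \<gamma>(4,5) w in simp_all)
    then show ?thesis
      unfolding principal_analytic_moebius_developable_def
      using analytic_curve_imp_real_analytic_curve[OF \<gamma>(1)] analytic_curve_imp_real_analytic_curve[OF \<gamma>(2)] \<gamma>(8)
      by (intro exI[of _ pi] exI[of _ w] exI[of _ \<gamma>] exI[of _ \<xi>] conjI) (simp_all add: vd inner_commute)
  qed
  ultimately show ?thesis by blast
qed

end
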